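(* Let $(a_n)_{n\ge 0}$ (positive) and $(b_n)_{n\ge 0}$ (real) be Jacobi parameters with Jacobi operator $A$. Suppose that $(\rho_n)$ is a positive sequence tending to infinity. If there are an open $U\subset\mathbb{R}$ and a non-zero (i.e. not identically zero) function $h:U\to[0,\infty)$ such that $$\lim_{n\to\infty}\frac1{\rho_n}K_n(x,x)=h(x)$$ locally uniformly with respect to $x\in U$, then the operator $A$ is self-adjoint and $\frac1{\rho_n}\nu_n|_U$ converges vaguely on $U$ to $\nu$, i.e. $\lim_{n\to\infty}\frac1{\rho_n}\int f\,d\nu_n=\int f\,d\nu$ for every continuous $f$ compactly supported in $U$, where $$d\nu(x)=h(x)\,d\mu(x),\qquad x\in U .$$
   Context: The Jacobi matrix $\mathcal{A}$ is the infinite symmetric tridiagonal matrix with diagonal $b_0,b_1,\dots$ and off-diagonal $a_0,a_1,\dots$; $\mathcal{A}_n$ is its upper-left $n\times n$ truncation. The Jacobi operator $A$ is the closure in $\ell^2(\mathbb{N}_0)$ of the operator acting on finitely supported sequences by multiplication by $\mathcal{A}$. When $A$ is self-adjoint, $\mu(\cdot)=\langle E_A(\cdot)e_0,e_0\rangle_{\ell^2(\mathbb{N}_0)}$, where $E_A$ is the projection-valued spectral measure of $A$ and $e_0=(1,0,0,\dots)$. The polynomials $p_n$ are $p_0\equiv1$, $p_n(z)=\frac{1}{a_0a_1\cdots a_{n-1}}\det(z\operatorname{Id}-\mathcal{A}_n)$ for $n\ge1$; the Christoffel–Darboux kernel is $K_n(x,y)=\sum_{k=0}^np_k(x)\overline{p_k(y)}$.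 Finally $\nu_n=\sum_{y\in\sigma(\mathcal{A}_{n+1})}\delta_y$, with $\delta_y$ the Dirac measure at $y$, and $\nu_n|_U(\cdot)=\nu_n(\cdot\cap U)$. *)

theory Defs
  imports
    "HOL-Analysis.Analysis"
    "Jordan_Normal_Form.Spectral_Radius"
begin

section \<open>The complex Hilbert space of square-summable sequences\<close>

typedef ell2 = "{x :: nat \<Rightarrow> complex. summable (\<lambda>n. (cmod (x n))\<^sup>2)}"
  morphisms ell2_nth Abs_ell2
  by (rule exI[of _ "\<lambda>_. 0"]) simp

setup_lifting type_definition_ell2

lemma summable_ell2: "summable (\<lambda>n. (cmod (ell2_nth x n))\<^sup>2)"
  using ell2_nth by auto

lemma summable_ell2_mult: "summable (\<lambda>n. ell2_nth x n * cnj (ell2_nth y n))"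
proof (rule summable_comparison_test)
  show "summable (\<lambda>n. (cmod (ell2_nth x n))\<^sup>2 + (cmod (ell2_nth y n))\<^sup>2)"
    by (intro summable_add summable_ell2)
  have "cmod u * cmod v \<le> (cmod u)\<^sup>2 + (cmod v)\<^sup>2" for u v
  proof -
    have "2 * (cmod u * cmod v) \<le> (cmod u)\<^sup>2 + (cmod v)\<^sup>2"
      using sum_squares_bound[of "cmod u" "cmod v"] by simp
    moreover have "0 \<le> cmod u * cmod v" by simp
    ultimately show ?thesis by linarith
  qed
  then show "\<exists>N. \<forall>n\<ge>N. norm (ell2_nth x n * cnj (ell2_nth y n))
      \<le> (cmod (ell2_nth x n))\<^sup>2 + (cmod (ell2_nth y n))\<^sup>2"
    by (simp add: norm_mult)
qed

text \<open>The inner product is linear in the first argument.\<close>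

definition cinner :: "ell2 \<Rightarrow> ell2 \<Rightarrow> complex" where
  "cinner x y = (\<Sum>n. ell2_nth x n * cnj (ell2_nth y n))"

lift_definition scaleC :: "complex \<Rightarrow> ell2 \<Rightarrow> ell2" is "\<lambda>c x n. c * x n"
  by (simp add: norm_mult power_mult_distrib summable_mult)

lift_definition ell2_basis :: "nat \<Rightarrow> ell2" is "\<lambda>k n. if n = k then 1 else 0"
proof -
  fix k :: nat
  show "summable (\<lambda>n. (cmod (if n = k then 1 else 0))\<^sup>2)"
    using summable_finite[of "{k}" "\<lambda>n. (cmod (if n = k then 1 else 0))\<^sup>2"] by auto
qed

lemma summable_norm_add_power2:
  fixes x y :: "nat \<Rightarrow> complex"
  assumes "summable (\<lambda>n. (cmod (x n))\<^sup>2)" "summable (\<lambda>n. (cmod (y n))\<^sup>2)"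
  shows "summable (\<lambda>n. (cmod (x n + y n))\<^sup>2)"
proof (rule summable_comparison_test)
  show "summable (\<lambda>n. 2 * (cmod (x n))\<^sup>2 + 2 * (cmod (y n))\<^sup>2)"
    by (intro summable_add summable_mult assms)
  have "(cmod (u + v))\<^sup>2 \<le> 2 * (cmod u)\<^sup>2 + 2 * (cmod v)\<^sup>2" for u v
  proof -
    have "(cmod (u + v))\<^sup>2 \<le> (cmod u + cmod v)\<^sup>2"
      by (intro power_mono norm_triangle_ineq) simp
    also have "\<dots> = (cmod u)\<^sup>2 + (cmod v)\<^sup>2 + 2 * cmod u * cmod v"
      by (simp add: power2_sum)
    finally show ?thesis
      using sum_squares_bound[of "cmod u" "cmod v"] by linarith
  qed
  then show "\<exists>N. \<forall>n\<ge>N. norm ((cmod (x n + y n))\<^sup>2) \<le> 2 * (cmod (x n))\<^sup>2 + 2 * (cmod (y n))\<^sup>2"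
    by simp
qed

text \<open>As a type of class \<^class>\<open>real_inner\<close>, \<open>ell2\<close> carries the real part of \<open>cinner\<close>;
  this gives the usual norm and topology.\<close>

instantiation ell2 :: real_inner
begin

lift_definition zero_ell2 :: ell2 is "\<lambda>_. 0" by simp

lift_definition plus_ell2 :: "ell2 \<Rightarrow> ell2 \<Rightarrow> ell2" is "\<lambda>x y n. x n + y n"
  using summable_norm_add_power2 by auto

lift_definition uminus_ell2 :: "ell2 \<Rightarrow> ell2" is "\<lambda>x n. - x n" by simp

lift_definition minus_ell2 :: "ell2 \<Rightarrow> ell2 \<Rightarrow> ell2" is "\<lambda>x y n. x n - y n"
proof -
  fix x y :: "nat \<Rightarrow> complex"
  assume "summable (\<lambda>n. (cmod (x n))\<^sup>2)" "summable (\<lambda>n. (cmod (y n))\<^sup>2)"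
  then show "summable (\<lambda>n. (cmod (x n - y n))\<^sup>2)"
    using summable_norm_add_power2[of x "\<lambda>n. - y n"] by simp
qed

lift_definition scaleR_ell2 :: "real \<Rightarrow> ell2 \<Rightarrow> ell2" is "\<lambda>c x n. c *\<^sub>R x n"
  by (simp add: power_mult_distrib summable_mult)

definition inner_ell2 :: "ell2 \<Rightarrow> ell2 \<Rightarrow> real" where
  "inner_ell2 x y = Re (cinner x y)"

definition norm_ell2 :: "ell2 \<Rightarrow> real" where
  "norm_ell2 x = sqrt (inner x x)"

definition sgn_ell2 :: "ell2 \<Rightarrow> ell2" where
  "sgn_ell2 x = scaleR (inverse (norm x)) x"

definition dist_ell2 :: "ell2 \<Rightarrow> ell2 \<Rightarrow> real" where
  "dist_ell2 x y = norm (x - y)"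

definition uniformity_ell2 :: "(ell2 \<times> ell2) filter" where
  "uniformity_ell2 = (INF e\<in>{0 <..}. principal {(x, y). dist x y < e})"

definition open_ell2 :: "ell2 set \<Rightarrow> bool" where
  "open_ell2 U = (\<forall>x\<in>U. eventually (\<lambda>(x', y). x' = x \<longrightarrow> y \<in> U) uniformity)"

instance
proof
  fix x y z :: ell2 and r s :: real
  show "x + y + z = x + (y + z)" "x + y = y + x" "0 + x = x" "- x + x = 0" "x - y = x + - y"
    "r *\<^sub>R (x + y) = r *\<^sub>R x + r *\<^sub>R y" "(r + s) *\<^sub>R x = r *\<^sub>R x + s *\<^sub>R x"
    "r *\<^sub>R s *\<^sub>R x = (r * s) *\<^sub>R x" "1 *\<^sub>R x = x"
    by (transfer; simp add: algebra_simps)+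
  show "dist x y = norm (x - y)" by (rule dist_ell2_def)
  show "sgn x = inverse (norm x) *\<^sub>R x" by (rule sgn_ell2_def)
  show "uniformity = (INF e\<in>{0 <..}. principal {(x :: ell2, y). dist x y < e})"
    by (rule uniformity_ell2_def)
  show "open U = (\<forall>x\<in>U. \<forall>\<^sub>F (x', y) in uniformity. x' = x \<longrightarrow> y \<in> U)" for U :: "ell2 set"
    by (rule open_ell2_def)
  show "norm x = sqrt (inner x x)" by (rule norm_ell2_def)
  have re: "inner u v = (\<Sum>n. Re (ell2_nth u n * cnj (ell2_nth v n)))"
    and sre: "summable (\<lambda>n. Re (ell2_nth u n * cnj (ell2_nth v n)))" for u v
    unfolding inner_ell2_def cinner_def
    using Re_suminf[OF summable_ell2_mult] summable_Re[OF summable_ell2_mult] by auto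
  show "inner x y = inner y x"
    unfolding re by (simp add: mult.commute)
  show "inner (x + y) z = inner x z + inner y z"
    unfolding re suminf_add[OF sre sre] by (simp add: plus_ell2.rep_eq algebra_simps)
  show "inner (r *\<^sub>R x) y = r * inner x y"
    unfolding re suminf_mult[OF sre, symmetric]
    by (simp add: scaleR_ell2.rep_eq algebra_simps)
  have sq: "inner x x = (\<Sum>n. (cmod (ell2_nth x n))\<^sup>2)"
    unfolding re by (simp add: cmod_power2) (simp add: power2_eq_square)
  show "0 \<le> inner x x"
    unfolding sq by (intro suminf_nonneg summable_ell2) simp
  show "inner x x = 0 \<longleftrightarrow> x = 0"
    unfolding sq
    by (subst suminf_eq_zero_iff[OF summable_ell2])
       (auto simp: zero_ell2.rep_eq ell2_nth_inject[symmetric] fun_eq_iff)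
qed

end

section \<open>Unbounded operators\<close>

text \<open>An unbounded operator is represented by its graph, a subset of \<open>ell2 \<times> ell2\<close>;
  its closure as an operator is the topological closure of the graph.\<close>

definition adjoint_graph :: "(ell2 \<times> ell2) set \<Rightarrow> (ell2 \<times> ell2) set" where
  "adjoint_graph A = {(y, z). \<forall>(x, w)\<in>A. cinner w y = cinner x z}"

text \<open>If \<open>Domain A\<close> is dense then \<open>adjoint_graph A\<close> is single-valued, so that a self-adjoint \<open>A\<close>
  is automatically the graph of a linear operator.\<close>

definition self_adjoint :: "(ell2 \<times> ell2) set \<Rightarrow> bool" where
  "self_adjoint A \<longleftrightarrow> closure (Domain A) = UNIV \<and> adjoint_graph A = A"

text \<open>Idempotence and symmetry imply boundedness.\<close>

definition orthogonal_projection :: "(ell2 \<Rightarrow> ell2) \<Rightarrow> bool" where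
  "orthogonal_projection P \<longleftrightarrow>
     (\<forall>x y. P (x + y) = P x + P y) \<and> (\<forall>c x. P (scaleC c x) = scaleC c (P x)) \<and>
     (\<forall>x. P (P x) = P x) \<and> (\<forall>x y. cinner (P x) y = cinner x (P y))"

text \<open>Only the values on Borel sets matter.\<close>

definition projection_valued_measure :: "(real set \<Rightarrow> ell2 \<Rightarrow> ell2) \<Rightarrow> bool" where
  "projection_valued_measure E \<longleftrightarrow>
     (\<forall>B\<in>sets borel. orthogonal_projection (E B)) \<and>
     (\<forall>x. E {} x = 0) \<and> (\<forall>x. E UNIV x = x) \<and>
     (\<forall>B\<in>sets borel. \<forall>C\<in>sets borel. \<forall>x. E (B \<inter> C) x = E B (E C x)) \<and>
     (\<forall>B :: nat \<Rightarrow> real set. range B \<subseteq> sets borel \<longrightarrow> disjoint_family B \<longrightarrow>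
        (\<forall>x. (\<lambda>i. E (B i) x) sums E (\<Union>i. B i) x))"

text \<open>The measure \<open>B \<mapsto> \<langle>E(B)x, x\<rangle>\<close>, whose values are real and nonnegative.\<close>

definition pvm_measure :: "(real set \<Rightarrow> ell2 \<Rightarrow> ell2) \<Rightarrow> ell2 \<Rightarrow> real measure" where
  "pvm_measure E x = measure_of UNIV (sets borel) (\<lambda>B. ennreal (Re (cinner (E B x) x)))"

text \<open>\<open>A = \<integral> t dE(t)\<close>: a vector \<open>x\<close> is in the domain of \<open>A\<close> iff \<open>\<integral> t\<^sup>2 d\<langle>E(t)x, x\<rangle> < \<infinity>\<close>, and then
  \<open>\<langle>Ax, x\<rangle> = \<integral> t d\<langle>E(t)x, x\<rangle>\<close>. By polarization this determines \<open>A\<close> on its domain; conversely, by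
  the spectral theorem, a self-adjoint \<open>A\<close> has exactly one such \<open>E\<close> up to values on non-Borel
  sets.\<close>

definition spectral_measure_of :: "(ell2 \<times> ell2) set \<Rightarrow> (real set \<Rightarrow> ell2 \<Rightarrow> ell2) \<Rightarrow> bool" where
  "spectral_measure_of A E \<longleftrightarrow>
     projection_valued_measure E \<and>
     Domain A = {x. integrable (pvm_measure E x) (\<lambda>t. t\<^sup>2)} \<and>
     (\<forall>(x, y)\<in>A. cinner y x = complex_of_real (\<integral>t. t \<partial>pvm_measure E x))"

section \<open>Jacobi operators and orthogonal polynomials\<close>

definition jacobi_matrix :: "(nat \<Rightarrow> real) \<Rightarrow> (nat \<Rightarrow> real) \<Rightarrow> nat \<Rightarrow> nat \<Rightarrow> real" where
  "jacobi_matrix a b i j =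
     (if i = j then b i else if j = Suc i then a i else if i = Suc j then a j else 0)"

definition jacobi_trunc :: "(nat \<Rightarrow> real) \<Rightarrow> (nat \<Rightarrow> real) \<Rightarrow> nat \<Rightarrow> real mat" where
  "jacobi_trunc a b n = mat n n (\<lambda>(i, j). jacobi_matrix a b i j)"

definition jacobi_graph_finite :: "(nat \<Rightarrow> real) \<Rightarrow> (nat \<Rightarrow> real) \<Rightarrow> (ell2 \<times> ell2) set" where
  "jacobi_graph_finite a b = {(x, y). finite {j. ell2_nth x j \<noteq> 0} \<and>
     (\<forall>i. ell2_nth y i =
        (\<Sum>j | ell2_nth x j \<noteq> 0. complex_of_real (jacobi_matrix a b i j) * ell2_nth x j))}"

definition jacobi_operator :: "(nat \<Rightarrow> real) \<Rightarrow> (nat \<Rightarrow> real) \<Rightarrow> (ell2 \<times> ell2) set" where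
  "jacobi_operator a b = closure (jacobi_graph_finite a b)"

text \<open>For \<open>n = 0\<close> the determinant and the product are empty, so this is \<open>1\<close>.\<close>

definition orth_poly :: "(nat \<Rightarrow> real) \<Rightarrow> (nat \<Rightarrow> real) \<Rightarrow> nat \<Rightarrow> complex \<Rightarrow> complex" where
  "orth_poly a b n z =
     1 / (\<Prod>k<n. complex_of_real (a k)) *
     Determinant.det (z \<cdot>\<^sub>m 1\<^sub>m n - map_mat complex_of_real (jacobi_trunc a b n))"

definition CD_kernel :: "(nat \<Rightarrow> real) \<Rightarrow> (nat \<Rightarrow> real) \<Rightarrow> nat \<Rightarrow> complex \<Rightarrow> complex \<Rightarrow> complex" where
  "CD_kernel a b n x y = (\<Sum>k\<le>n. orth_poly a b k x * cnj (orth_poly a b k y))"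

text \<open>The sum of the Dirac measures at the eigenvalues of the truncation of size \<open>n + 1\<close>, i.e. the
  counting measure of the spectrum viewed as a Borel measure on the line. The truncation is
  real symmetric, so its real spectrum is its whole spectrum.\<close>

definition eigenvalue_measure :: "(nat \<Rightarrow> real) \<Rightarrow> (nat \<Rightarrow> real) \<Rightarrow> nat \<Rightarrow> real measure" where
  "eigenvalue_measure a b n =
     distr (count_space (spectrum (jacobi_trunc a b (n + 1)))) borel (\<lambda>y. y)"

section \<open>Modes of convergence\<close>

definition locally_uniform_limit ::
    "real set \<Rightarrow> (nat \<Rightarrow> real \<Rightarrow> complex) \<Rightarrow> (real \<Rightarrow> complex) \<Rightarrow> bool" where
  "locally_uniform_limit U f g \<longleftrightarrow>
     (\<forall>x\<in>U. \<exists>V. open V \<and> x \<in> V \<and> V \<subseteq> U \<and> uniform_limit V f g sequentially)"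

text \<open>\<open>density M (indicator U)\<close> is the measure \<open>B \<mapsto> M (B \<inter> U)\<close>.\<close>

definition restrict_measure :: "real measure \<Rightarrow> real set \<Rightarrow> real measure" where
  "restrict_measure M U = density M (indicator U)"

text \<open>A continuous function with compact support in the open set \<open>U\<close> is identified with its
  continuous extension by zero to the line.\<close>

definition vaguely_converges_on ::
    "real set \<Rightarrow> (nat \<Rightarrow> real measure) \<Rightarrow> real measure \<Rightarrow> bool" where
  "vaguely_converges_on U M N \<longleftrightarrow>
     (\<forall>f :: real \<Rightarrow> real. continuous_on UNIV f \<longrightarrow>
        (\<exists>K. compact K \<and> K \<subseteq> U \<and> (\<forall>x. x \<notin> K \<longrightarrow> f x = 0)) \<longrightarrow>
        (\<lambda>n. \<integral>x. f x \<partial>M n) \<longlonglongrightarrow> (\<integral>x. f x \<partial>N))"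

end

theory Submission
  imports Defs "HOL-Probability.Probability_Measure"
begin

text \<open>Let \<open>p\<^sub>n\<close> be the orthonormal polynomials of the Jacobi parameters and \<open>K\<^sub>n(x) = \<Sum>k\<le>n. p\<^sub>k(x)\<^sup>2\<close>
their Christoffel-Darboux kernel on the diagonal.

Self-adjointness. At a point \<open>t\<close> with \<open>h(t) > 0\<close> the kernel \<open>K\<^sub>n(t)\<close> grows like \<open>\<rho>\<^sub>n\<close>, so it is
unbounded. The adjoint of the Jacobi operator is the maximal operator, which applies the matrix to
every square-summable sequence with square-summable image; by Green's formula its failure to be
symmetric is measured by the limit of the Wronskians \<open>W\<^sub>n(u, v)\<close>. The identity
\<open>W\<^sub>n(u, v) p\<^sub>n(t) = W\<^sub>n(u, p) v\<^sub>n - W\<^sub>n(v, p) u\<^sub>n\<close> and the Cauchy-Schwarz bound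
\<open>|W\<^sub>n(u, p)|\<^sup>2 \<le> C K\<^sub>n(t)\<close> show that a nonzero limit would make \<open>\<Sum>n. p\<^sub>n(t)\<^sup>2 / K\<^sub>n(t)\<close> converge, which
contradicts the theorem of Abel and Dini because \<open>K\<^sub>n(t)\<close> is the partial sum of \<open>p\<^sub>n(t)\<^sup>2\<close>. So the
maximal operator \<open>T\<close> is symmetric (\<open>max_graph_symmetric\<close>). If it were a proper extension of the Jacobi
operator, a vector \<open>(u, Tu)\<close> of its graph orthogonal to the smaller graph would satisfy
\<open>T(Tu) = -u\<close>, hence \<open>\<parallel>Tu\<parallel>\<^sup>2 = -\<parallel>u\<parallel>\<^sup>2\<close>, and vanish (\<open>jacobi_operator_eq_max_graph\<close>).

Reduction to Gauss quadrature. The spectrum of the truncation of size \<open>n + 1\<close> is the set of the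
\<open>n + 1\<close> simple real zeros of \<open>p\<^sub>n\<^sub>+\<^sub>1\<close>. The Gauss quadrature measure \<open>\<mu>\<^sub>n\<close> gives the zero \<open>y\<close> the mass
\<open>1 / K\<^sub>n(y)\<close> (\<open>gauss_quadrature\<close>). Therefore \<open>1/\<rho>\<^sub>n \<integral> f d\<nu>\<^sub>n = \<integral> f K\<^sub>n/\<rho>\<^sub>n d\<mu>\<^sub>n\<close>. For \<open>f\<close> with compact support
in \<open>U\<close> the quotient \<open>K\<^sub>n/\<rho>\<^sub>n\<close> tends to \<open>h\<close> uniformly on the support, and \<open>\<mu>\<^sub>n\<close> has mass one, so it only
remains to prove \<open>\<integral> f h d\<mu>\<^sub>n \<longlonglongrightarrow> \<integral> f h d\<mu>\<close>, where \<open>f h\<close> is continuous with compact support.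

Convergence of the quadrature measures. The spectral measure \<open>\<mu>\<close> integrates \<open>p\<^sub>k\<close> to \<open>1\<close> for \<open>k = 0\<close> and
to \<open>0\<close> otherwise (\<open>spectral_measure_p\<close>), and so does \<open>\<mu>\<^sub>n\<close> for \<open>n \<ge> k\<close>; hence every polynomial
eventually has the same integral against both. Self-adjointness makes \<open>A - \<i>\<close> have dense range on
finite vectors, which says that a complex polynomial \<open>Q\<close> can be chosen with \<open>(t - \<i>) Q(t) - 1\<close> small
in \<open>L\<^sup>2(\<mu>)\<close>, and then also in \<open>L\<^sup>2(\<mu>\<^sub>n)\<close> because the square of its modulus is a polynomial. So the real
and imaginary parts of \<open>1/(t - \<i>)\<close> are approximated by the same polynomials in \<open>L\<^sup>2(\<mu>)\<close> and in
\<open>L\<^sup>2(\<mu>\<^sub>n)\<close> at the same time. The functions with this property are stable under multiplication by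
these two functions, which by the Stone-Weierstrass theorem generate all continuous functions of
compact support, and their integrals converge (\<open>compact_support_converges\<close>).\<close>

section \<open>Orthonormal polynomials and Gauss quadrature\<close>

text \<open>The tridiagonal matrix acting on an arbitrary sequence: the same map serves for sequences of polynomial
values, for vectors of the Hilbert space and for finite coefficient sequences.\<close>

definition jac :: "(nat \<Rightarrow> real) \<Rightarrow> (nat \<Rightarrow> real) \<Rightarrow> (nat \<Rightarrow> 'a::real_field) \<Rightarrow> nat \<Rightarrow> 'a" where
  "jac a b v n = of_real (a n) * v (Suc n) + of_real (b n) * v n +
     (case n of 0 \<Rightarrow> 0 | Suc m \<Rightarrow> of_real (a m) * v m)"

text \<open>Polymorphic in the field, so that zeros can be sought over the complex numbers and values be taken
over the reals.\<close>

fun jpoly :: "(nat \<Rightarrow> real) \<Rightarrow> (nat \<Rightarrow> real) \<Rightarrow> nat \<Rightarrow> 'a::real_field poly" where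
  "jpoly a b 0 = 1"
| "jpoly a b (Suc 0) = Polynomial.smult (of_real (1 / a 0)) [:- of_real (b 0), 1:]"
| "jpoly a b (Suc (Suc n)) = Polynomial.smult (of_real (1 / a (Suc n)))
     ([:- of_real (b (Suc n)), 1:] * jpoly a b (Suc n) - Polynomial.smult (of_real (a n)) (jpoly a b n))"

text \<open>Green's formula: the symmetric matrix leaves only a boundary term, since all interior products cancel
by telescoping.\<close>

lemma green_formula:
  fixes u v :: "nat \<Rightarrow> 'a::real_field"
  shows "(\<Sum>k\<le>n. jac a b u k * v k - u k * jac a b v k) =
    of_real (a n) * (u (Suc n) * v n - u n * v (Suc n))"
proof (induction n)
  case 0 show ?case by (simp add: jac_def algebra_simps)
next
  case (Suc n) then show ?case by (simp add: jac_def algebra_simps)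
qed

locale jacobi_parameters =
  fixes a b :: "nat \<Rightarrow> real"
  assumes a_pos: "a n > 0"
begin

abbreviation J :: "(nat \<Rightarrow> 'a::real_field) \<Rightarrow> nat \<Rightarrow> 'a" where "J \<equiv> jac a b"
abbreviation p :: "nat \<Rightarrow> 'a::real_field \<Rightarrow> 'a" where "p n \<equiv> poly (jpoly a b n)"

lemma a_nonzero: "a n \<noteq> 0" using a_pos[of n] by simp

text \<open>The three-term recurrence: as a sequence in the degree, the polynomials are a formal eigenvector.\<close>

lemma jac_p: "J (\<lambda>n. p n z) n = z * p n z"
proof (cases n)
  case 0
  then show ?thesis using a_nonzero[of 0] by (simp add: jac_def field_simps)
next
  case (Suc m)
  then show ?thesis using a_nonzero[of n] by (simp add: jac_def field_simps)
qed

lemma p_of_real: "p n (of_real x) = of_real (p n x)"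
  by (induction a b n rule: jpoly.induct) (auto simp: of_real_divide)

lemma degree_jpoly: "degree (jpoly a b n :: 'a::real_field poly) = n \<and> (jpoly a b n :: 'a poly) \<noteq> 0"
proof (induction n rule: less_induct)
  case (less n)
  consider "n = 0" | "n = Suc 0" | m where "n = Suc (Suc m)"
    by (metis not0_implies_Suc)
  then show ?case
  proof cases
    case 3
    have d1: "degree (jpoly a b (Suc m) :: 'a poly) = Suc m" "(jpoly a b (Suc m) :: 'a poly) \<noteq> 0"
      and d0: "degree (jpoly a b m :: 'a poly) = m"
      using less.IH[of "Suc m"] less.IH[of m] 3 by auto
    let ?q = "[:- of_real (b (Suc m)), 1:] * (jpoly a b (Suc m) :: 'a poly)"
    let ?r = "Polynomial.smult (of_real (a m)) (jpoly a b m :: 'a poly)"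
    have dq: "degree ?q = Suc (Suc m)"
      using d1 by (subst degree_mult_eq) auto
    have dr: "degree ?r \<le> m" using d0 degree_smult_le[of "of_real (a m)" "jpoly a b m :: 'a poly"] by simp
    have dd: "degree (?q - ?r) = Suc (Suc m)"
    proof -
      have "degree (?q + (- ?r)) = degree ?q"
        by (rule degree_add_eq_left) (use dq dr in simp)
      then show ?thesis using dq by simp
    qed
    then have "?q - ?r \<noteq> 0" by (metis degree_0 nat.distinct(1))
    then show ?thesis using dd 3 a_nonzero[of "Suc m"] by (simp del: mult_pCons_left)
  qed (use a_nonzero[of 0] in simp_all)
qed

lemma christoffel_darboux:
  "(z - w) * (\<Sum>k\<le>n. p k z * p k w) = of_real (a n) * (p (Suc n) z * p n w - p n z * p (Suc n) w)"
proof -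
  have "of_real (a n) * (p (Suc n) z * p n w - p n z * p (Suc n) w) =
     (\<Sum>k\<le>n. J (\<lambda>n. p n z) k * p k w - p k z * J (\<lambda>n. p n w) k)"
    by (rule green_formula[symmetric])
  also have "\<dots> = (z - w) * (\<Sum>k\<le>n. p k z * p k w)"
    unfolding jac_p by (simp add: sum_distrib_left algebra_simps)
  finally show ?thesis by simp
qed

text \<open>The limit of the Christoffel-Darboux formula for coinciding arguments, obtained from Green's formula
for the sequence of derivatives, which solves \<open>J d = z d + p\<close>.\<close>

lemma christoffel_darboux_confluent:
  "(\<Sum>k\<le>n. p k z * p k z) = of_real (a n) *
     (poly (pderiv (jpoly a b (Suc n))) z * p n z - poly (pderiv (jpoly a b n)) z * p (Suc n) z)"
proof -
  define d where "d n = poly (pderiv (jpoly a b n)) z" for n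
  have "J d n = p n z + z * d n" for n
  proof (cases n)
    case 0 then show ?thesis using a_nonzero[of 0] by (simp add: jac_def d_def pderiv_smult pderiv_pCons field_simps)
  next
    case (Suc m)
    then show ?thesis using a_nonzero[of n]
      by (simp add: jac_def d_def pderiv_smult pderiv_mult pderiv_diff pderiv_pCons pderiv_add field_simps)
  qed
  then have "J d k * p k z - d k * J (\<lambda>n. p n z) k = p k z * p k z" for k
    unfolding jac_p by (simp add: algebra_simps)
  then show ?thesis using green_formula[of a b d "\<lambda>n. p n z" n] unfolding d_def by simp
qed

definition nodes :: "nat \<Rightarrow> real set" where "nodes n = {x. p (Suc n) x = 0}"

definition K :: "nat \<Rightarrow> real \<Rightarrow> real" where "K n x = (\<Sum>k\<le>n. (p k x)\<^sup>2)"

lemma K_ge_1: "K n x \<ge> 1"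
proof -
  have "(p 0 x)\<^sup>2 \<le> K n x" unfolding K_def by (rule member_le_sum) auto
  then show ?thesis by simp
qed

text \<open>For conjugate arguments the sum in the Christoffel-Darboux formula is positive, but at a zero the
right-hand side vanishes.\<close>

lemma root_real:
  fixes z :: complex assumes "p (Suc n) z = 0" shows "z \<in> \<real>"
proof -
  have cnjp: "p k (cnj z) = cnj (p k z)" for k
    by (induction a b k rule: jpoly.induct) auto
  have "(z - cnj z) * (\<Sum>k\<le>n. p k z * p k (cnj z)) = 0"
    unfolding christoffel_darboux using assms cnjp[of "Suc n"] by simp
  moreover have "(\<Sum>k\<le>n. p k z * p k (cnj z)) = of_real (\<Sum>k\<le>n. (cmod (p k z))\<^sup>2)"
    unfolding cnjp by (simp flip: complex_norm_square)
  moreover have "(\<Sum>k\<le>n. (cmod (p k z))\<^sup>2) \<ge> (cmod (p 0 z))\<^sup>2"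
    by (rule member_le_sum) auto
  ultimately have "(z - cnj z) * of_real (\<Sum>k\<le>n. (cmod (p k z))\<^sup>2) = 0"
    and "(\<Sum>k\<le>n. (cmod (p k z))\<^sup>2) \<noteq> 0" by (simp, force)
  then have "z = cnj z" by (metis eq_iff_diff_eq_0 mult_eq_0_iff of_real_eq_0_iff)
  then show ?thesis by (metis Reals_cnj_iff)
qed

lemma nodes_finite: "finite (nodes n)"
  unfolding nodes_def by (rule poly_roots_finite) (use degree_jpoly in auto)

text \<open>Over the complex numbers a polynomial has as many zeros as its degree as soon as they are simple. The
zeros are real, and the confluent formula shows that the derivative does not vanish there, because
\<open>K\<close> is positive.\<close>

lemma nodes_card: "card (nodes n) = Suc n"
proof -
  let ?q = "jpoly a b (Suc n) :: complex poly"
  have q0: "?q \<noteq> 0" "degree ?q = Suc n" using degree_jpoly by blast+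
  have roots: "{z. poly ?q z = 0} = of_real ` nodes n"
    using root_real[of n] by (fastforce simp: nodes_def p_of_real elim!: Reals_cases simp del: jpoly.simps)
  have "rsquarefree ?q" unfolding rsquarefree_roots
  proof (intro allI notI)
    fix z assume z: "poly ?q z = 0 \<and> poly (pderiv ?q) z = 0"
    then obtain x where x: "z = of_real x" using root_real Reals_cases by metis
    have "(\<Sum>k\<le>n. p k z * p k z) = 0" using christoffel_darboux_confluent[of z n] z by simp
    then have "of_real (K n x) = (0::complex)" unfolding x p_of_real K_def
      by (simp add: power2_eq_square)
    then show False using K_ge_1[of n x] by simp
  qed
  then have "?q = Polynomial.smult (lead_coeff ?q) (\<Prod>z | poly ?q z = 0. [:-z, 1:])"
    using complex_poly_decompose_rsquarefree[of ?q] by simp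
  then have "degree ?q = degree (\<Prod>z | poly ?q z = 0. [:-z, 1:])"
    using q0 by (metis degree_smult_eq leading_coeff_0_iff)
  also have "\<dots> = card {z. poly ?q z = 0}"
    by (subst degree_prod_eq_sum_degree) auto
  also have "\<dots> = card (nodes n)" unfolding roots by (rule card_image) (auto simp: inj_on_def)
  finally show ?thesis using q0 by simp
qed

lemma nodes_orthogonal:
  assumes "x \<in> nodes n" "y \<in> nodes n" "x \<noteq> y" shows "(\<Sum>k\<le>n. p k x * p k y) = 0"
proof -
  have "(x - y) * (\<Sum>k\<le>n. p k x * p k y) = 0"
    unfolding christoffel_darboux using assms(1,2)  by (simp add: nodes_def del: jpoly.simps)
  then show ?thesis using assms(3) by simp
qed

text \<open>By the Christoffel-Darboux formula the rows \<open>(p\<^sub>0(y), \<dots>, p\<^sub>n(y))\<close>, for \<open>y\<close> a node, are orthogonal with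
squared length \<open>K\<^sub>n(y)\<close>. There are \<open>n + 1\<close> of them, so they form a square matrix; a right inverse of it
is a left inverse, and the columns are orthonormal with weights \<open>1 / K\<^sub>n(y)\<close>.\<close>

lemma gauss_quadrature:
  assumes "j \<le> n" "k \<le> n"
  shows "(\<Sum>y\<in>nodes n. p j y * p k y / K n y) = (if j = k then 1 else 0)"
proof -
  obtain g where g: "bij_betw g {..<Suc n} (nodes n)"
    using ex_bij_betw_nat_finite[OF nodes_finite] nodes_card by (metis atLeast0LessThan)
  define V where "V = mat (Suc n) (Suc n) (\<lambda>(i, k). p k (g i))"
  define W where "W = mat (Suc n) (Suc n) (\<lambda>(k, i). p k (g i) / K n (g i))"
  have car: "V \<in> carrier_mat (Suc n) (Suc n)" "W \<in> carrier_mat (Suc n) (Suc n)"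
    by (auto simp: V_def W_def)
  have "V * W = 1\<^sub>m (Suc n)"
  proof (rule eq_matI)
    fix i l assume "i < dim_row (1\<^sub>m (Suc n) :: real mat)" "l < dim_col (1\<^sub>m (Suc n) :: real mat)"
    then have il: "i < Suc n" "l < Suc n" by auto
    have "(V * W) $$ (i, l) = (\<Sum>k<Suc n. p k (g i) * (p k (g l) / K n (g l)))"
      using il by (simp add: V_def W_def scalar_prod_def atLeast0LessThan del: sum.lessThan_Suc)
    also have "\<dots> = (\<Sum>k\<le>n. p k (g i) * p k (g l)) / K n (g l)"
      by (simp add: sum_divide_distrib lessThan_Suc_atMost del: sum.lessThan_Suc)
    also have "\<dots> = (if i = l then 1 else 0)"
    proof (cases "i = l")
      case True
      then show ?thesis using K_ge_1[of n "g l"] by (simp add: K_def power2_eq_square)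
    next
      case False
      then have "g i \<noteq> g l" using g il by (meson bij_betw_imp_inj_on inj_on_eq_iff lessThan_iff)
      then show ?thesis using False nodes_orthogonal[of "g i" n "g l"] g il
        by (auto simp: bij_betw_def)
    qed
    finally show "(V * W) $$ (i, l) = 1\<^sub>m (Suc n) $$ (i, l)" using il by simp
  qed (use car in auto)
  then have "W * V = 1\<^sub>m (Suc n)" by (rule mat_mult_left_right_inverse[OF car])
  then have "(W * V) $$ (j, k) = (if j = k then 1 else 0)" using assms by simp
  moreover have "(W * V) $$ (j, k) = (\<Sum>i<Suc n. p j (g i) / K n (g i) * p k (g i))"
    using assms by (simp add: V_def W_def scalar_prod_def atLeast0LessThan del: sum.lessThan_Suc)
  moreover have "\<dots> = (\<Sum>y\<in>nodes n. p j y / K n y * p k y)"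
    by (rule sum.reindex_bij_betw[OF g])
  ultimately show ?thesis by (simp add: mult.commute)
qed

text \<open>Laplace expansion along the last row turns the characteristic determinant of a tridiagonal matrix
into the three-term recurrence.\<close>

lemma det_trunc:
  fixes z :: "'a::real_field"
  shows "Determinant.det (z \<cdot>\<^sub>m 1\<^sub>m n - map_mat of_real (jacobi_trunc a b n)) = of_real (\<Prod>k<n. a k) * p n z"
proof (induction n rule: less_induct)
  case (less n)
  define D where "D n = z \<cdot>\<^sub>m 1\<^sub>m n - map_mat of_real (jacobi_trunc a b n)" for n
  have Dc: "D n \<in> carrier_mat n n" for n by (auto simp: D_def jacobi_trunc_def)
  have Di: "D n $$ (i, j) = (if i = j then z else 0) - of_real (jacobi_matrix a b i j)" if "i < n" "j < n" for i j n
    using that by (simp add: D_def jacobi_trunc_def)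
  consider "n = 0" | "n = Suc 0" | m where "n = Suc (Suc m)"
    by (metis not0_implies_Suc)
  then have "Determinant.det (D n) = of_real (\<Prod>k<n. a k) * p n z"
  proof cases
    case 1 then show ?thesis using Dc[of 0] by simp
  next
    case 2
    then show ?thesis using det_single[of "D 1"] Dc[of 1] Di[of 0 1 0] a_nonzero[of 0]
      by (simp add: jacobi_matrix_def right_diff_distrib)
  next
    case 3
    define M where "M = mat_delete (D n) (Suc m) m"
    have sub: "mat_delete (D (Suc k)) k k = D k" for k
      by (rule eq_matI) (use Dc in \<open>auto simp: mat_delete_def Di D_def jacobi_trunc_def\<close>)
    have Mc: "M \<in> carrier_mat (Suc m) (Suc m)" using mat_delete_carrier[OF Dc[of n], of "Suc m" m] 3 by (simp add: M_def)
    have Mi: "M $$ (i, j) = D n $$ (i, if j < m then j else Suc j)" if "i < Suc m" "j < Suc m" for i j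
      using that Dc[of n] 3 by (auto simp: mat_delete_def M_def)
    have M': "mat_delete M m m = D m"
    proof (rule eq_matI)
      fix i j assume "i < dim_row (D m)" "j < dim_col (D m)"
      then have ij: "i < m" "j < m" using Dc[of m] by auto
      have "mat_delete M m m $$ (i, j) = M $$ (i, j)" using ij Mc by (simp add: mat_delete_def)
      also have "\<dots> = D m $$ (i, j)" using ij 3 by (simp add: Mi Di)
      finally show "mat_delete M m m $$ (i, j) = D m $$ (i, j)" .
    qed (use Mc Dc[of m] in auto)
    have detM: "Determinant.det M = - of_real (a m) * Determinant.det (D m)"
    proof -
      have "Determinant.det M = (\<Sum>i<Suc m. M $$ (i, m) * cofactor M i m)"
        by (rule laplace_expansion_column[OF Mc]) simp
      also have "\<dots> = M $$ (m, m) * cofactor M m m"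
        using 3 by (simp add: Mi Di jacobi_matrix_def)
      finally show ?thesis using 3 by (simp add: Mi Di jacobi_matrix_def cofactor_def M')
    qed
    have "Determinant.det (D n) = (\<Sum>j<n. D n $$ (Suc m, j) * cofactor (D n) (Suc m) j)"
      by (rule laplace_expansion_row[OF Dc]) (use 3 in simp)
    also have "\<dots> = D n $$ (Suc m, m) * cofactor (D n) (Suc m) m +
        D n $$ (Suc m, Suc m) * cofactor (D n) (Suc m) (Suc m)"
      using 3 by (simp add: Di jacobi_matrix_def)
    also have "\<dots> = of_real (a m) * Determinant.det M + (z - of_real (b (Suc m))) * Determinant.det (D (Suc m))"
      using 3 sub[of "Suc m"] by (simp add: Di jacobi_matrix_def cofactor_def M_def)
    also have "\<dots> = of_real (\<Prod>k<n. a k) * p n z"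
      unfolding detM using less.IH[of m] less.IH[of "Suc m"] 3 a_nonzero[of "Suc m"] unfolding D_def[symmetric]
      by (simp add: field_simps)
    finally show ?thesis .
  qed
  then show ?case by (simp add: D_def)
qed

lemma prod_a_nonzero: "(\<Prod>k<n. a k) \<noteq> 0" using a_nonzero by simp

lemma orth_poly_eq: "orth_poly a b n z = p n z"
  unfolding orth_poly_def det_trunc using prod_a_nonzero[of n]
  by (simp flip: of_real_prod)

lemma CD_kernel_eq: "CD_kernel a b n (of_real x) (of_real x) = of_real (K n x)"
  by (simp add: CD_kernel_def orth_poly_eq K_def p_of_real power2_eq_square)

lemma spectrum_trunc: "spectrum (jacobi_trunc a b (n + 1)) = nodes n"
proof -
  let ?A = "jacobi_trunc a b (Suc n)"
  have A: "?A \<in> carrier_mat (Suc n) (Suc n)" by (simp add: jacobi_trunc_def)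
  have "eigenvalue ?A x \<longleftrightarrow> p (Suc n) x = 0" for x
  proof -
    have "char_matrix ?A x = - (x \<cdot>\<^sub>m 1\<^sub>m (Suc n) - map_mat of_real ?A)"
      unfolding char_matrix_def by (rule eq_matI) (use A in auto)
    moreover have "(x \<cdot>\<^sub>m 1\<^sub>m (Suc n) - map_mat of_real ?A) \<in> carrier_mat (Suc n) (Suc n)"
      using A by (intro minus_carrier_mat) auto
    ultimately have "eigenvalue ?A x \<longleftrightarrow> Determinant.det (x \<cdot>\<^sub>m 1\<^sub>m (Suc n) - map_mat of_real ?A) = 0"
      unfolding eigenvalue_det[OF A] using det_0_negate by metis
    then show ?thesis unfolding det_trunc using prod_a_nonzero[of "Suc n"] by (simp del: jpoly.simps)
  qed
  then show ?thesis by (auto simp: spectrum_def nodes_def simp del: jpoly.simps)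
qed

end

section \<open>Hilbert space geometry of square-summable sequences\<close>

lemma norm_ell2_power2: "(norm x)\<^sup>2 = (\<Sum>n. (cmod (ell2_nth x n))\<^sup>2)"
proof -
  have "inner x x = (\<Sum>n. Re (ell2_nth x n * cnj (ell2_nth x n)))"
    unfolding inner_ell2_def cinner_def using Re_suminf[OF summable_ell2_mult] by auto
  also have "\<dots> = (\<Sum>n. (cmod (ell2_nth x n))\<^sup>2)"
    by (simp add: cmod_power2) (simp add: power2_eq_square)
  finally show ?thesis by (simp add: power2_norm_eq_inner)
qed

lemma sum_le_norm_ell2: "(\<Sum>k\<in>F. (cmod (ell2_nth x k))\<^sup>2) \<le> (norm x)\<^sup>2" if "finite F"
  unfolding norm_ell2_power2 by (rule sum_le_suminf[OF summable_ell2 that]) auto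

lemma nth_le_norm_ell2: "cmod (ell2_nth x k) \<le> norm x"
  using sum_le_norm_ell2[of "{k}" x] by (simp add: power2_le_iff_abs_le)

lemma cinner_add_left: "cinner (x + y) z = cinner x z + cinner y z"
  unfolding cinner_def by (subst suminf_add[OF summable_ell2_mult summable_ell2_mult])
    (simp add: plus_ell2.rep_eq algebra_simps)

lemma cinner_scaleC_left: "cinner (scaleC c x) y = c * cinner x y"
  unfolding cinner_def by (subst suminf_mult[OF summable_ell2_mult, symmetric])
    (simp add: scaleC.rep_eq algebra_simps)

lemma cinner_commute: "cinner y x = cnj (cinner x y)"
proof -
  have "(\<lambda>n. ell2_nth x n * cnj (ell2_nth y n)) sums cinner x y"
    unfolding cinner_def by (rule summable_sums[OF summable_ell2_mult])
  then have "(\<lambda>n. cnj (ell2_nth x n * cnj (ell2_nth y n))) sums cnj (cinner x y)"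
    by (simp only: sums_cnj)
  then show ?thesis unfolding cinner_def by (simp add: sums_iff mult.commute)
qed

lemma cinner_self: "cinner x x = of_real ((norm x)\<^sup>2)"
proof (rule complex_eqI)
  have "cnj (cinner x x) = cinner x x" by (rule cinner_commute[symmetric])
  then show "Im (cinner x x) = Im (of_real ((norm x)\<^sup>2))" by (simp add: complex_eq_iff)
  show "Re (cinner x x) = Re (of_real ((norm x)\<^sup>2))"
    by (simp add: power2_norm_eq_inner inner_ell2_def)
qed

lemma Im_cinner: "Im (cinner x y) = inner (scaleC (- \<i>) x) y"
  by (simp add: inner_ell2_def cinner_scaleC_left)

lemma bounded_linear_scaleC: "bounded_linear (scaleC c)"
proof (rule bounded_linear_intro[of _ "cmod c"])
  show "scaleC c (x + y) = scaleC c x + scaleC c y" for x y by transfer (simp add: algebra_simps)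
  show "scaleC c (r *\<^sub>R x) = r *\<^sub>R scaleC c x" for r x by transfer simp
  show "norm (scaleC c x) \<le> norm x * cmod c" for x
  proof -
    have "(norm (scaleC c x))\<^sup>2 = (cmod c)\<^sup>2 * (norm x)\<^sup>2"
      unfolding norm_ell2_power2
      by (subst suminf_mult[OF summable_ell2, symmetric]) (simp add: scaleC.rep_eq norm_mult power_mult_distrib)
    then have "norm (scaleC c x) = cmod c * norm x"
      by (metis norm_ge_zero power2_eq_imp_eq power_mult_distrib zero_le_mult_iff)
    then show ?thesis by simp
  qed
qed

lemma tendsto_cinner [tendsto_intros]:
  assumes "(f \<longlongrightarrow> x) F" "(g \<longlongrightarrow> y) F" shows "((\<lambda>t. cinner (f t) (g t)) \<longlongrightarrow> cinner x y) F"
proof -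
  have eq: "cinner u v = Complex (inner u v) (inner (scaleC (- \<i>) u) v)" for u v
    by (rule complex_eqI) (simp add: inner_ell2_def, simp add: Im_cinner)
  show ?thesis unfolding eq
    by (intro tendsto_Complex tendsto_inner assms bounded_linear.tendsto[OF bounded_linear_scaleC])
qed

lemma cinner_add_right: "cinner x (y + z) = cinner x y + cinner x z"
  using cinner_add_left[of y z x] by (metis cinner_commute complex_cnj_add)

lemma cinner_scaleC_right: "cinner x (scaleC c y) = cnj c * cinner x y"
  using cinner_scaleC_left[of c y x] by (metis cinner_commute complex_cnj_mult)

lemma uminus_scaleC: "- x = scaleC (-1) x" by transfer simp

lemma cinner_minus_right: "cinner x (- y) = - cinner x y"
  by (simp add: uminus_scaleC[of y] cinner_scaleC_right)

lemma cinner_sums: "(\<lambda>n. ell2_nth x n * cnj (ell2_nth y n)) sums cinner x y"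
  unfolding cinner_def by (rule summable_sums[OF summable_ell2_mult])

lemma cinner_basis: "cinner x (ell2_basis k) = ell2_nth x k"
proof -
  have "cinner x (ell2_basis k) = (\<Sum>n\<in>{k}. ell2_nth x n * cnj (ell2_nth (ell2_basis k) n))"
    unfolding cinner_def by (rule suminf_finite) (auto simp: ell2_basis.rep_eq)
  then show ?thesis by (simp add: ell2_basis.rep_eq)
qed

lemma bounded_linear_nth: "bounded_linear (\<lambda>x. ell2_nth x k)"
  by (rule bounded_linear_intro[of _ 1])
    (auto simp: plus_ell2.rep_eq scaleR_ell2.rep_eq nth_le_norm_ell2)

text \<open>A Cauchy sequence converges in each coordinate; the bounds on finite sums of squares pass to the limit
and give convergence in norm.\<close>

instance ell2 :: complete_space
proof
  fix X :: "nat \<Rightarrow> ell2" assume X: "Cauchy X"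
  have "Cauchy (\<lambda>n. ell2_nth (X n) k)" for k
    by (rule bounded_linear.Cauchy[OF bounded_linear_nth X])
  then have "\<forall>k. \<exists>l. (\<lambda>n. ell2_nth (X n) k) \<longlonglongrightarrow> l"
    by (simp add: Cauchy_convergent_iff convergent_def)
  then obtain l where l: "\<And>k. (\<lambda>n. ell2_nth (X n) k) \<longlonglongrightarrow> l k" by metis
  have bound: "\<exists>N. \<forall>n\<ge>N. \<forall>M. (\<Sum>k<M. (cmod (ell2_nth (X n) k - l k))\<^sup>2) \<le> e\<^sup>2" if e: "e > 0" for e
  proof -
    obtain N where N: "\<And>m n. m \<ge> N \<Longrightarrow> n \<ge> N \<Longrightarrow> dist (X m) (X n) < e"
      using X e unfolding Cauchy_def by blast
    have "(\<Sum>k<M. (cmod (ell2_nth (X n) k - l k))\<^sup>2) \<le> e\<^sup>2" if n: "n \<ge> N" for n M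
    proof (rule tendsto_upperbound)
      show "(\<lambda>m. \<Sum>k<M. (cmod (ell2_nth (X n) k - ell2_nth (X m) k))\<^sup>2)
          \<longlonglongrightarrow> (\<Sum>k<M. (cmod (ell2_nth (X n) k - l k))\<^sup>2)"
        by (intro tendsto_intros l)
      have "(\<Sum>k<M. (cmod (ell2_nth (X n) k - ell2_nth (X m) k))\<^sup>2) \<le> e\<^sup>2" if m: "m \<ge> N" for m
      proof -
        have "(\<Sum>k<M. (cmod (ell2_nth (X n) k - ell2_nth (X m) k))\<^sup>2) \<le> (norm (X n - X m))\<^sup>2"
          using sum_le_norm_ell2[of "{..<M}" "X n - X m"] by (simp add: minus_ell2.rep_eq)
        also have "\<dots> \<le> e\<^sup>2"
          using N[OF n m] by (intro power_mono) (auto simp: dist_norm)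
        finally show ?thesis .
      qed
      then show "\<forall>\<^sub>F m in sequentially. (\<Sum>k<M. (cmod (ell2_nth (X n) k - ell2_nth (X m) k))\<^sup>2) \<le> e\<^sup>2"
        using eventually_sequentially by blast
    qed simp
    then show ?thesis by blast
  qed
  have diff: "summable (\<lambda>k. (cmod (ell2_nth (X n) k - l k))\<^sup>2) \<and> (\<Sum>k. (cmod (ell2_nth (X n) k - l k))\<^sup>2) \<le> e\<^sup>2"
    if "\<forall>M. (\<Sum>k<M. (cmod (ell2_nth (X n) k - l k))\<^sup>2) \<le> e\<^sup>2" for n e
  proof -
    have "summable (\<lambda>k. (cmod (ell2_nth (X n) k - l k))\<^sup>2)"
      by (rule summableI_nonneg_bounded[of _ "e\<^sup>2"]) (use that in auto)
    then show ?thesis using that by (intro conjI suminf_le_const) auto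
  qed
  obtain N where "\<forall>M. (\<Sum>k<M. (cmod (ell2_nth (X N) k - l k))\<^sup>2) \<le> 1\<^sup>2"
    using bound[of 1] by force
  from diff[OF this] have "summable (\<lambda>k. (cmod (ell2_nth (X N) k - l k))\<^sup>2)" by blast
  then have "summable (\<lambda>k. (cmod (l k - ell2_nth (X N) k))\<^sup>2)" by (simp add: norm_minus_commute)
  from summable_norm_add_power2[OF this summable_ell2[of "X N"]]
  have sl: "summable (\<lambda>k. (cmod (l k))\<^sup>2)" by simp
  define L where "L = Abs_ell2 l"
  have L: "ell2_nth L = l" unfolding L_def by (rule Abs_ell2_inverse) (use sl in simp)
  have "X \<longlonglongrightarrow> L"
  proof (rule LIMSEQ_I)
    fix r :: real assume r: "0 < r"
    obtain N where N: "\<forall>n\<ge>N. \<forall>M. (\<Sum>k<M. (cmod (ell2_nth (X n) k - l k))\<^sup>2) \<le> (r / 2)\<^sup>2"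
      using bound[of "r / 2"] r by auto
    have "norm (X n - L) < r" if "n \<ge> N" for n
    proof -
      have "(norm (X n - L))\<^sup>2 \<le> (r / 2)\<^sup>2"
        unfolding norm_ell2_power2 using diff[of n "r / 2"] N that by (auto simp: minus_ell2.rep_eq L)
      then have "norm (X n - L) \<le> r / 2" using r by (simp add: power2_le_iff_abs_le)
      then show ?thesis using r by simp
    qed
    then show "\<exists>no. \<forall>n\<ge>no. norm (X n - L) < r" by blast
  qed
  then show "convergent X" by (auto simp: convergent_def)
qed

text \<open>The projection theorem. A minimizing sequence of approximants is Cauchy by the parallelogram law, and
the variation of the distance along \<open>y\<close> shows that its limit is the foot of the perpendicular.\<close>

lemma orthogonal_projection_exists:
  fixes S :: "'a::{real_inner, complete_space} set"
  assumes S: "Real_Vector_Spaces.subspace S" "closed S"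
  shows "\<exists>s\<in>S. \<forall>y\<in>S. inner (x - s) y = 0"
proof -
  define d where "d = (INF s\<in>S. (norm (x - s))\<^sup>2)"
  have S0: "0 \<in> S" using S(1) by (rule subspace_0)
  have bdd: "bdd_below ((\<lambda>s. (norm (x - s))\<^sup>2) ` S)" by (rule bdd_belowI[of _ 0]) auto
  have d_le: "d \<le> (norm (x - s))\<^sup>2" if "s \<in> S" for s
    unfolding d_def by (rule cINF_lower[OF bdd that])
  have "\<exists>s\<in>S. (norm (x - s))\<^sup>2 < d + 1 / Suc n" for n
    using cINF_less_iff[OF _ bdd, of "d + 1 / Suc n"] S0 unfolding d_def by auto
  then obtain s where s: "\<And>n. s n \<in> S" "\<And>n. (norm (x - s n))\<^sup>2 < d + 1 / Suc n" by metis
  have par: "(norm (s m - s n))\<^sup>2 \<le> 2 / Suc m + 2 / Suc n" for m n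
  proof -
    define u v where "u = x - s m" and "v = x - s n"
    have "(1/2) *\<^sub>R (s m + s n) \<in> S" using S(1) s(1) by (intro subspace_scale subspace_add)
    from d_le[OF this] have "d \<le> (norm ((1/2) *\<^sub>R (u + v)))\<^sup>2"
      by (simp add: u_def v_def algebra_simps flip: scaleR_add_left)
    also have "\<dots> = (1/4) * inner (u + v) (u + v)" by (simp add: power_divide power2_norm_eq_inner)
    finally have "4 * d \<le> inner (u + v) (u + v)" by simp
    moreover have "inner (u + v) (u + v) + inner (u - v) (u - v) = 2 * inner u u + 2 * inner v v"
      by (simp add: inner_diff_left inner_diff_right inner_add_left inner_add_right inner_commute)
    ultimately have "(norm (u - v))\<^sup>2 \<le> 2 * (norm u)\<^sup>2 + 2 * (norm v)\<^sup>2 - 4 * d"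
      by (simp add: power2_norm_eq_inner)
    moreover have "norm (u - v) = norm (s m - s n)" by (simp add: u_def v_def norm_minus_commute)
    ultimately show ?thesis using s(2)[of m] s(2)[of n] by (simp add: u_def v_def)
  qed
  have "Cauchy s"
  proof (rule metric_CauchyI)
    fix e :: real assume e: "0 < e"
    obtain N where N: "4 / e\<^sup>2 < real (Suc N)" using reals_Archimedean2 by (metis less_SucI of_nat_Suc of_nat_less_iff order_less_trans lessI)
    then have N': "4 / Suc N < e\<^sup>2" using e by (simp add: field_simps)
    have "dist (s m) (s n) < e" if "m \<ge> N" "n \<ge> N" for m n
    proof -
      have "2 / Suc m \<le> 2 / Suc N" "2 / Suc n \<le> 2 / Suc N" using that by (auto intro!: divide_left_mono)
      then have "(norm (s m - s n))\<^sup>2 < e\<^sup>2" using par[of m n] N' by simp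
      then show ?thesis using e by (simp add: dist_norm power2_less_imp_less)
    qed
    then show "\<exists>M. \<forall>m\<ge>M. \<forall>n\<ge>M. dist (s m) (s n) < e" by blast
  qed
  then obtain l where l: "s \<longlonglongrightarrow> l" using Cauchy_convergent convergent_def by blast
  have lS: "l \<in> S" by (rule closed_sequentially[OF S(2) s(1) l])
  have nl: "(norm (x - l))\<^sup>2 \<le> d"
  proof (rule LIMSEQ_le)
    show "(\<lambda>n. (norm (x - s n))\<^sup>2) \<longlonglongrightarrow> (norm (x - l))\<^sup>2" by (intro tendsto_intros l)
    show "(\<lambda>n. d + 1 / Suc n) \<longlonglongrightarrow> d"
      using tendsto_add[OF tendsto_const LIMSEQ_inverse_real_of_nat, of d] by (simp add: inverse_eq_divide)
    show "\<exists>N. \<forall>n\<ge>N. (norm (x - s n))\<^sup>2 \<le> d + 1 / real (Suc n)" using s(2) less_imp_le by blast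
  qed
  have "inner (x - l) y = 0" if y: "y \<in> S" for y
  proof (cases "y = 0")
    case False
    \<comment> \<open>The coefficient that minimizes the distance of \<open>x\<close> from the line \<open>l + c y\<close>.\<close>
    define c where "c = inner (x - l) y / inner y y"
    have yy: "inner y y > 0" using False by simp
    have "l + c *\<^sub>R y \<in> S" using S(1) lS y by (intro subspace_add subspace_scale)
    from d_le[OF this] have "inner (x - l) (x - l) \<le> inner (x - l - c *\<^sub>R y) (x - l - c *\<^sub>R y)"
      using nl by (simp add: power2_norm_eq_inner diff_diff_eq)
    also have "\<dots> = inner (x - l) (x - l) - 2 * c * inner (x - l) y + c * c * inner y y"
      by (simp add: inner_diff_left inner_diff_right inner_commute algebra_simps)
    also have "c * c * inner y y = c * inner (x - l) y" using yy by (simp add: c_def)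
    finally have "c * inner (x - l) y \<le> 0" by simp
    then have "(inner (x - l) y)\<^sup>2 \<le> 0" using yy by (simp add: c_def divide_le_0_iff power2_eq_square)
    then show ?thesis by simp
  qed simp
  then show ?thesis using lS by blast
qed

lemma subspace_closure:
  fixes S :: "'a::real_normed_vector set"
  assumes S: "Real_Vector_Spaces.subspace S"
  shows "Real_Vector_Spaces.subspace (closure S)"
proof (rule subspaceI)
  show "0 \<in> closure S" using subspace_0[OF S] closure_subset by blast
next
  fix x y assume "x \<in> closure S" "y \<in> closure S"
  then obtain f g where "\<And>n. f n \<in> S" "f \<longlonglongrightarrow> x" "\<And>n. g n \<in> S" "g \<longlonglongrightarrow> y"
    unfolding closure_sequential by blast
  then have "(\<lambda>n. f n + g n) \<longlonglongrightarrow> x + y" "\<And>n. f n + g n \<in> S"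
    using S by (auto intro: tendsto_add subspace_add)
  then show "x + y \<in> closure S"
    unfolding closure_sequential by (intro exI[of _ "\<lambda>n. f n + g n"]) auto
next
  fix c x assume "x \<in> closure S"
  then obtain f where "\<And>n. f n \<in> S" "f \<longlonglongrightarrow> x"
    unfolding closure_sequential by blast
  then have "(\<lambda>n. c *\<^sub>R f n) \<longlonglongrightarrow> c *\<^sub>R x" "\<And>n. c *\<^sub>R f n \<in> S"
    using S by (auto intro: tendsto_intros subspace_scale)
  then show "c *\<^sub>R x \<in> closure S"
    unfolding closure_sequential by (intro exI[of _ "\<lambda>n. c *\<^sub>R f n"]) auto
qed

text \<open>The residual of a point after projection onto the closure of \<open>S\<close> is orthogonal to \<open>S\<close>, hence zero.\<close>

lemma dense_if_orthogonal_complement_trivial: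
  fixes S :: "'a::{real_inner, complete_space} set"
  assumes "Real_Vector_Spaces.subspace S" and triv: "\<And>u. (\<And>s. s \<in> S \<Longrightarrow> inner u s = 0) \<Longrightarrow> u = 0"
  shows "closure S = UNIV"
proof -
  have "x \<in> closure S" for x
  proof -
    obtain s where s: "s \<in> closure S" "\<forall>y\<in>closure S. inner (x - s) y = 0"
      using orthogonal_projection_exists[of "closure S" x] closed_subspace assms(1)
      subspace_closure by blast
    then have "x - s = 0" using triv closure_subset by blast
    then show ?thesis using s by simp
  qed
  then show ?thesis by blast
qed

section \<open>Self-adjointness of the Jacobi operator\<close>

text \<open>Over a block on which the partial sums at least double, the quotients contribute at least one half, and
since the partial sums are unbounded there is such a block after every index.\<close>

lemma abel_dini_divergence:
  fixes d :: "nat \<Rightarrow> real"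
  assumes d: "\<And>n. d n \<ge> 0" and pos: "\<And>n. (\<Sum>k\<le>n. d k) > 0"
    and lim: "filterlim (\<lambda>n. \<Sum>k\<le>n. d k) at_top sequentially"
  shows "\<not> summable (\<lambda>n. d n / (\<Sum>k\<le>n. d k))"
proof
  define S where "S n = (\<Sum>k\<le>n. d k)" for n
  assume "summable (\<lambda>n. d n / (\<Sum>k\<le>n. d k))"
  then have "summable (\<lambda>n. d n / S n)" by (simp add: S_def)
  then have "\<exists>N. \<forall>m\<ge>N. \<forall>n. norm (\<Sum>k\<in>{m..<n}. d k / S k) < 1 / 2"
    unfolding summable_Cauchy by (rule allE[of _ "1 / 2"]) simp
  then obtain N where N: "\<And>m n. m \<ge> N \<Longrightarrow> norm (\<Sum>k\<in>{m..<n}. d k / S k) < 1 / 2"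
    by blast
  have "\<forall>\<^sub>F n in sequentially. S n \<ge> 2 * S N"
    using lim unfolding filterlim_at_top S_def by blast
  then obtain n where n: "S n \<ge> 2 * S N" "n \<ge> N"
    by (metis eventually_sequentially nat_le_linear)
  have split: "S n = S N + (\<Sum>k\<in>{Suc N..<Suc n}. d k)"
    unfolding S_def using n(2) sum.atLeastLessThan_concat[of 0 "Suc N" "Suc n" d]
    by (simp add: atLeast0LessThan lessThan_Suc_atMost)
  have "1 / 2 \<le> (S n - S N) / S n"
    using n(1) pos[of n] by (simp add: S_def field_simps)
  also have "\<dots> = (\<Sum>k\<in>{Suc N..<Suc n}. d k / S n)"
  proof -
    have "S n - S N = (\<Sum>k\<in>{Suc N..<Suc n}. d k)" using split by simp
    then show ?thesis by (simp only: sum_divide_distrib)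
  qed
  also have "\<dots> \<le> (\<Sum>k\<in>{Suc N..<Suc n}. d k / S k)"
  proof (rule sum_mono)
    fix k assume "k \<in> {Suc N..<Suc n}"
    then have "S k \<le> S n" unfolding S_def by (intro sum_mono2) (use d in auto)
    then show "d k / S n \<le> d k / S k"
      using d[of k] pos[of k] by (intro divide_left_mono) (auto simp: S_def)
  qed
  finally show False using N[of "Suc N" "Suc n"] by simp
qed

lemma ex_ell2_finite:
  assumes "finite {k. v k \<noteq> 0}" shows "\<exists>x. ell2_nth x = v"
proof -
  have "summable (\<lambda>n. (cmod (v n))\<^sup>2)" by (rule summable_finite[OF assms]) auto
  then show ?thesis by (metis Abs_ell2_inverse mem_Collect_eq)
qed

lemma adjoint_graph_closure: "adjoint_graph (closure G) = adjoint_graph G"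
proof
  show "adjoint_graph (closure G) \<subseteq> adjoint_graph G"
    unfolding adjoint_graph_def using closure_subset[of G] by blast
  show "adjoint_graph G \<subseteq> adjoint_graph (closure G)"
  proof clarify
    fix y z assume yz: "(y, z) \<in> adjoint_graph G"
    have "cinner w y = cinner x z" if xw: "(x, w) \<in> closure G" for x w
    proof -
      obtain f where f: "\<And>n. f n \<in> G" "f \<longlonglongrightarrow> (x, w)" using xw unfolding closure_sequential by blast
      have "(\<lambda>n. cinner (snd (f n)) y) \<longlonglongrightarrow> cinner w y" "(\<lambda>n. cinner (fst (f n)) z) \<longlonglongrightarrow> cinner x z"
        using tendsto_fst[OF f(2)] tendsto_snd[OF f(2)] by (auto intro!: tendsto_intros)
      moreover have "cinner (snd (f n)) y = cinner (fst (f n)) z" for n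
        using yz f(1)[of n] unfolding adjoint_graph_def by (cases "f n") auto
      ultimately show ?thesis using LIMSEQ_unique by simp
    qed
    then show "(y, z) \<in> adjoint_graph (closure G)" unfolding adjoint_graph_def by blast
  qed
qed

context jacobi_parameters
begin

text \<open>The maximal operator, with the largest domain on which the matrix acts inside the Hilbert space.\<close>

definition max_graph :: "(ell2 \<times> ell2) set" where
  "max_graph = {(x, w). \<forall>k. ell2_nth w k = J (ell2_nth x) k}"

lemma J_cnj: "J (\<lambda>n. cnj (v n)) k = cnj (J v k)"
  by (cases k) (simp_all add: jac_def)

lemma J_add: "J (\<lambda>n. u n + v n) k = J u k + J v k"
  by (cases k) (simp_all add: jac_def algebra_simps)

lemma J_mult: "J (\<lambda>n. c * v n) k = c * J v k"
  by (cases k) (simp_all add: jac_def algebra_simps)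

lemma jacobi_matrix_sum:
  assumes "finite {j. v j \<noteq> 0}"
  shows "(\<Sum>j | v j \<noteq> 0. complex_of_real (jacobi_matrix a b i j) * v j) = J v i"
proof -
  have "(\<Sum>j | v j \<noteq> 0. complex_of_real (jacobi_matrix a b i j) * v j) =
      (\<Sum>j\<le>Suc i. complex_of_real (jacobi_matrix a b i j) * v j)"
    by (rule sum.mono_neutral_cong) (use assms in \<open>auto simp: jacobi_matrix_def\<close>)
  also have "\<dots> = J v i"
  proof (cases i)
    case (Suc m)
    have "(\<Sum>j<m. complex_of_real (jacobi_matrix a b i j) * v j) = 0"
      by (rule sum.neutral) (auto simp: Suc jacobi_matrix_def)
    then show ?thesis
      by (simp add: Suc jacobi_matrix_def jac_def lessThan_Suc_atMost[symmetric])
  qed (simp add: jacobi_matrix_def jac_def)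
  finally show ?thesis .
qed

lemma finite_graph_eq: "jacobi_graph_finite a b = {(x, w) \<in> max_graph. finite {k. ell2_nth x k \<noteq> 0}}"
  unfolding jacobi_graph_finite_def max_graph_def by (auto simp: jacobi_matrix_sum)

text \<open>The matrix has finitely many nonzero entries in each column, so that it maps finitely supported
sequences to finitely supported ones.\<close>

lemma ex_finite_graph:
  assumes "finite {k. v k \<noteq> 0}"
  shows "\<exists>x w. (x, w) \<in> jacobi_graph_finite a b \<and> ell2_nth x = v \<and> ell2_nth w = J v"
proof -
  let ?S = "{k. v k \<noteq> 0}"
  have "finite {k. J v k \<noteq> 0}"
  proof (rule finite_subset)
    show "{k. J v k \<noteq> 0} \<subseteq> Suc -` ?S \<union> ?S \<union> Suc ` ?S"
      by (force simp: jac_def split: nat.splits)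
    show "finite (Suc -` ?S \<union> ?S \<union> Suc ` ?S)"
      using assms by (intro finite_UnI finite_imageI finite_vimageI) auto
  qed
  with ex_ell2_finite assms obtain x w where "ell2_nth x = v" "ell2_nth w = J v" by metis
  then show ?thesis using assms
    by (intro exI[of _ x] exI[of _ w]) (auto simp: finite_graph_eq max_graph_def)
qed

lemma max_graph_subspace: "Real_Vector_Spaces.subspace max_graph"
  by (rule subspaceI)
    (auto simp: max_graph_def zero_prod_def zero_ell2.rep_eq plus_ell2.rep_eq scaleR_ell2.rep_eq
      scaleR_conv_of_real J_add J_mult J_mult[of 0, simplified])

lemma max_graph_scaleC: "(x, w) \<in> max_graph \<Longrightarrow> (scaleC c x, scaleC c w) \<in> max_graph"
  by (auto simp: max_graph_def scaleC.rep_eq J_mult)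

lemma finite_graph_subspace: "Real_Vector_Spaces.subspace (jacobi_graph_finite a b)"
proof (rule subspaceI)
  note s = max_graph_subspace
  show "0 \<in> jacobi_graph_finite a b"
    using subspace_0[OF s] by (simp add: finite_graph_eq zero_prod_def zero_ell2.rep_eq)
  show "c *\<^sub>R x \<in> jacobi_graph_finite a b" if "x \<in> jacobi_graph_finite a b" for c x
  proof (cases x)
    case (Pair x1 x2)
    then have "finite {k. ell2_nth (c *\<^sub>R x1) k \<noteq> 0}"
      using that by (auto simp: finite_graph_eq scaleR_ell2.rep_eq elim: finite_subset[rotated])
    then show ?thesis using that Pair subspace_scale[OF s, of x c] by (auto simp: finite_graph_eq)
  qed
  show "x + y \<in> jacobi_graph_finite a b" if "x \<in> jacobi_graph_finite a b" "y \<in> jacobi_graph_finite a b" for x y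
  proof (cases x, cases y)
    fix x1 x2 y1 y2 assume e: "x = (x1, x2)" "y = (y1, y2)"
    have "finite {k. ell2_nth (x1 + y1) k \<noteq> 0}"
    proof (rule finite_subset)
      show "{k. ell2_nth (x1 + y1) k \<noteq> 0} \<subseteq> {k. ell2_nth x1 k \<noteq> 0} \<union> {k. ell2_nth y1 k \<noteq> 0}"
        by (auto simp: plus_ell2.rep_eq)
    qed (use that e in \<open>auto simp: finite_graph_eq\<close>)
    then show ?thesis using that e subspace_add[OF s, of x y] by (auto simp: finite_graph_eq)
  qed
qed

lemma finite_graph_scaleC:
  "(x, w) \<in> jacobi_graph_finite a b \<Longrightarrow> (scaleC c x, scaleC c w) \<in> jacobi_graph_finite a b"
  using max_graph_scaleC[of x w c]
  by (auto simp: finite_graph_eq scaleC.rep_eq elim: finite_subset[rotated])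

lemma green_limit:
  assumes "(x, w) \<in> max_graph" "(y, z) \<in> max_graph"
  shows "(\<lambda>n. of_real (a n) * (ell2_nth x (Suc n) * cnj (ell2_nth y n) - ell2_nth x n * cnj (ell2_nth y (Suc n))))
     \<longlonglongrightarrow> cinner w y - cinner x z"
proof -
  have "(\<lambda>n. \<Sum>k\<le>n. ell2_nth w k * cnj (ell2_nth y k) - ell2_nth x k * cnj (ell2_nth z k))
     \<longlonglongrightarrow> cinner w y - cinner x z"
    using sums_diff[OF cinner_sums[of w y] cinner_sums[of x z]] by (simp only: sums_def_le)
  moreover have "(\<Sum>k\<le>n. ell2_nth w k * cnj (ell2_nth y k) - ell2_nth x k * cnj (ell2_nth z k)) =
     of_real (a n) * (ell2_nth x (Suc n) * cnj (ell2_nth y n) - ell2_nth x n * cnj (ell2_nth y (Suc n)))" for n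
    using green_formula[of a b "ell2_nth x" "\<lambda>k. cnj (ell2_nth y k)" n] assms
    by (simp add: max_graph_def J_cnj)
  ultimately show ?thesis by simp
qed

text \<open>One inclusion is Green's formula without boundary term. For the other, testing against the \<open>i\<close>-th basis
vector reads off the \<open>i\<close>-th coordinate.\<close>

lemma adjoint_finite_graph: "adjoint_graph (jacobi_graph_finite a b) = max_graph"
proof (intro equalityI subrelI)
  fix y z assume yz: "(y, z) \<in> max_graph"
  have "cinner w y = cinner x z" if xw: "(x, w) \<in> jacobi_graph_finite a b" for x w
  proof -
    have fin: "finite {k. ell2_nth x k \<noteq> 0}" and mx: "(x, w) \<in> max_graph" using xw by (auto simp: finite_graph_eq)
    then obtain N where N: "\<And>k. k \<ge> N \<Longrightarrow> ell2_nth x k = 0"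
      using finite_nat_set_iff_bounded by (metis (mono_tags, lifting) leD mem_Collect_eq)
    have "(\<lambda>n. of_real (a n) * (ell2_nth x (Suc n) * cnj (ell2_nth y n) - ell2_nth x n * cnj (ell2_nth y (Suc n))))
      \<longlonglongrightarrow> 0"
      by (rule tendsto_eventually, rule eventually_sequentiallyI[of N]) (use N in auto)
    then have "cinner w y - cinner x z = 0" by (rule LIMSEQ_unique[OF green_limit[OF mx yz]])
    then show ?thesis by simp
  qed
  then show "(y, z) \<in> adjoint_graph (jacobi_graph_finite a b)" unfolding adjoint_graph_def by blast
next
  fix y z assume yz: "(y, z) \<in> adjoint_graph (jacobi_graph_finite a b)"
  have "ell2_nth z i = J (ell2_nth y) i" for i
  proof -
    let ?e = "\<lambda>k. if k = i then 1 else 0 :: complex"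
    have sub: "{k. ?e k \<noteq> 0} \<subseteq> {i}" by auto
    obtain x w where xw: "(x, w) \<in> jacobi_graph_finite a b" "ell2_nth x = ?e" "ell2_nth w = J ?e"
      using ex_finite_graph[OF finite_subset[OF sub finite.insertI[OF finite.emptyI]]] by blast
    have xe: "x = ell2_basis i" using xw(2) by (simp add: ell2_nth_inject[symmetric] ell2_basis.rep_eq fun_eq_iff)
    have "(\<lambda>n. \<Sum>k\<le>n. ell2_nth w k * cnj (ell2_nth y k)) \<longlonglongrightarrow> cinner w y"
      using cinner_sums[of w y] by (simp only: sums_def_le)
    moreover have "(\<lambda>n. \<Sum>k\<le>n. ell2_nth w k * cnj (ell2_nth y k)) \<longlonglongrightarrow> cnj (J (ell2_nth y) i)"
    proof (rule tendsto_eventually, rule eventually_sequentiallyI)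
      fix n assume n: "n \<ge> Suc i"
      have "(\<Sum>k\<le>n. ell2_nth w k * cnj (ell2_nth y k)) = (\<Sum>k\<le>n. ?e k * cnj (J (ell2_nth y) k))"
        using green_formula[of a b ?e "\<lambda>k. cnj (ell2_nth y k)" n] n
        by (simp add: sum_subtractf xw(3) J_cnj)
      also have "\<dots> = (\<Sum>k\<in>{i}. ?e k * cnj (J (ell2_nth y) k))"
        by (rule sum.mono_neutral_right) (use n in auto)
      finally show "(\<Sum>k\<le>n. ell2_nth w k * cnj (ell2_nth y k)) = cnj (J (ell2_nth y) i)" by simp
    qed
    ultimately have "cinner w y = cnj (J (ell2_nth y) i)" by (rule LIMSEQ_unique)
    moreover have "cinner w y = cinner x z" using yz xw(1) unfolding adjoint_graph_def by blast
    moreover have "cinner x z = cnj (ell2_nth z i)"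
      unfolding xe using cinner_basis[of z i] cinner_commute by metis
    ultimately show ?thesis by simp
  qed
  then show "(y, z) \<in> max_graph" by (simp add: max_graph_def)
qed

lemma adjoint_jacobi_operator: "adjoint_graph (jacobi_operator a b) = max_graph"
  unfolding jacobi_operator_def adjoint_graph_closure adjoint_finite_graph ..

text \<open>Since \<open>p\<close> is a formal eigenvector for \<open>t\<close>, Green's formula writes the Wronskian of \<open>x\<close> and \<open>p\<close> as an
inner product of \<open>(A - t)x\<close> with a section of \<open>p\<close>.\<close>

lemma wronskian_p_bound:
  assumes xw: "(x, w) \<in> max_graph"
  shows "(cmod (of_real (a n) * (ell2_nth x (Suc n) * of_real (p n t) - ell2_nth x n * of_real (p (Suc n) t))))\<^sup>2
      \<le> (norm (w - t *\<^sub>R x))\<^sup>2 * K n t"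
proof -
  let ?d = "w - t *\<^sub>R x"
  let ?P = "\<lambda>k. complex_of_real (p k t)"
  have JP: "J ?P k = of_real t * ?P k" for k
    using jac_p[of "complex_of_real t" k] by (simp add: p_of_real)
  have "of_real (a n) * (ell2_nth x (Suc n) * ?P n - ell2_nth x n * ?P (Suc n)) =
      (\<Sum>k\<le>n. J (ell2_nth x) k * ?P k - ell2_nth x k * J ?P k)"
    by (rule green_formula[symmetric])
  also have "\<dots> = (\<Sum>k\<le>n. ell2_nth ?d k * ?P k)"
    unfolding JP using xw
    by (intro sum.cong) (auto simp: max_graph_def minus_ell2.rep_eq scaleR_ell2.rep_eq scaleR_conv_of_real algebra_simps)
  finally have eq: "of_real (a n) * (ell2_nth x (Suc n) * ?P n - ell2_nth x n * ?P (Suc n)) =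
      (\<Sum>k\<le>n. ell2_nth ?d k * ?P k)" .
  have "cmod (\<Sum>k\<le>n. ell2_nth ?d k * ?P k) \<le> (\<Sum>k\<le>n. cmod (ell2_nth ?d k) * \<bar>p k t\<bar>)"
    by (rule order_trans[OF norm_sum]) (simp add: norm_mult)
  then have "(cmod (\<Sum>k\<le>n. ell2_nth ?d k * ?P k))\<^sup>2 \<le> (\<Sum>k\<le>n. cmod (ell2_nth ?d k) * \<bar>p k t\<bar>)\<^sup>2"
    by (intro power_mono) auto
  also have "\<dots> \<le> (\<Sum>k\<le>n. (cmod (ell2_nth ?d k))\<^sup>2) * (\<Sum>k\<le>n. \<bar>p k t\<bar>\<^sup>2)"
    by (rule Cauchy_Schwarz_ineq_sum)
  also have "\<dots> \<le> (norm ?d)\<^sup>2 * K n t"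
    using sum_le_norm_ell2[of "{..n}" ?d] K_ge_1[of n t] by (intro mult_mono) (auto simp: K_def)
  finally show ?thesis unfolding eq .
qed

text \<open>The limit \<open>L\<close> of the Wronskians of \<open>x\<close> and \<open>y\<close> is the defect of symmetry. A nonzero \<open>L\<close> would bound
\<open>p\<^sub>n(t)\<^sup>2 / K\<^sub>n(t)\<close> by the summable sequence \<open>|x\<^sub>n|\<^sup>2 + |y\<^sub>n|\<^sup>2\<close>, against the Abel-Dini theorem.\<close>

lemma max_graph_symmetric:
  assumes K: "filterlim (\<lambda>n. K n t) at_top sequentially"
    and xw: "(x, w) \<in> max_graph" and yz: "(y, z) \<in> max_graph"
  shows "cinner w y = cinner x z"
proof (rule ccontr)
  define L where "L = cinner w y - cinner x z"
  define u where "u = ell2_nth x"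
  define v where "v n = cnj (ell2_nth y n)" for n
  define P where "P n = complex_of_real (p n t)" for n
  define W where "W f g n = of_real (a n) * (f (Suc n) * g n - f n * g (Suc n))" for f g :: "nat \<Rightarrow> complex" and n
  define C D where "C = (norm (w - t *\<^sub>R x))\<^sup>2" and "D = (norm (z - t *\<^sub>R y))\<^sup>2"
  assume "cinner w y \<noteq> cinner x z"
  then have L: "cmod L > 0" by (simp add: L_def)
  have "W u v \<longlonglongrightarrow> L" using green_limit[OF xw yz] by (simp add: W_def[abs_def] u_def v_def L_def)
  then have "(\<lambda>n. cmod (W u v n)) \<longlonglongrightarrow> cmod L" by (rule tendsto_norm)
  from order_tendstoD(1)[OF this, of "cmod L / 2"] L
  have ev: "\<forall>\<^sub>F n in sequentially. cmod L / 2 < cmod (W u v n)" by simp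
  have bu: "(cmod (W u P n))\<^sup>2 \<le> C * K n t" for n
    using wronskian_p_bound[OF xw, of n t] by (simp add: W_def u_def P_def C_def)
  have bv: "(cmod (W v P n))\<^sup>2 \<le> D * K n t" for n
  proof -
    have "W v P n = cnj (W (ell2_nth y) P n)" by (simp add: W_def v_def P_def)
    then have "cmod (W v P n) = cmod (W (ell2_nth y) P n)" by simp
    then show ?thesis
      using wronskian_p_bound[OF yz, of n t] by (simp only: W_def P_def D_def)
  qed
  \<comment> \<open>The Pluecker relation between three solutions.\<close>
  have plu: "W u v n * P n = W u P n * v n - W v P n * u n" for n
    by (simp add: W_def algebra_simps)
  have bound: "(p n t)\<^sup>2 / K n t \<le> (8 / (cmod L)\<^sup>2) * (C * (cmod (ell2_nth y n))\<^sup>2 + D * (cmod (ell2_nth x n))\<^sup>2)"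
    if n: "cmod L / 2 < cmod (W u v n)" for n
  proof -
    have "(cmod L / 2)\<^sup>2 * (p n t)\<^sup>2 \<le> (cmod (W u v n))\<^sup>2 * (p n t)\<^sup>2"
      using n by (intro mult_right_mono power_mono) auto
    also have "\<dots> = (cmod (W u v n * P n))\<^sup>2" by (simp add: norm_mult power_mult_distrib P_def)
    also have "\<dots> \<le> (cmod (W u P n * v n) + cmod (W v P n * u n))\<^sup>2"
      unfolding plu by (intro power_mono norm_triangle_ineq4) simp
    also have "\<dots> \<le> 2 * (cmod (W u P n * v n))\<^sup>2 + 2 * (cmod (W v P n * u n))\<^sup>2"
      using sum_squares_bound[of "cmod (W u P n * v n)" "cmod (W v P n * u n)"] by (simp add: power2_sum)
    also have "\<dots> = 2 * ((cmod (W u P n))\<^sup>2 * (cmod (v n))\<^sup>2) + 2 * ((cmod (W v P n))\<^sup>2 * (cmod (u n))\<^sup>2)"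
      by (simp add: norm_mult power_mult_distrib)
    also have "\<dots> \<le> 2 * (C * K n t * (cmod (v n))\<^sup>2) + 2 * (D * K n t * (cmod (u n))\<^sup>2)"
      using bu[of n] bv[of n] by (intro add_mono mult_left_mono mult_right_mono) auto
    finally show ?thesis using L K_ge_1[of n t]
      by (simp add: u_def v_def field_simps)
  qed
  have "summable (\<lambda>n. (8 / (cmod L)\<^sup>2) * (C * (cmod (ell2_nth y n))\<^sup>2 + D * (cmod (ell2_nth x n))\<^sup>2))"
    by (intro summable_mult summable_add summable_ell2)
  then have "summable (\<lambda>n. (p n t)\<^sup>2 / K n t)"
  proof (rule summable_comparison_test_ev[rotated])
    show "\<forall>\<^sub>F n in sequentially. norm ((p n t)\<^sup>2 / K n t)
      \<le> (8 / (cmod L)\<^sup>2) * (C * (cmod (ell2_nth y n))\<^sup>2 + D * (cmod (ell2_nth x n))\<^sup>2)"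
      using ev
    proof eventually_elim
      case (elim n)
      have "norm ((p n t)\<^sup>2 / K n t) = (p n t)\<^sup>2 / K n t" using K_ge_1[of n t] by simp
      then show ?case using bound[OF elim] by (simp only:)
    qed
  qed
  moreover have "(\<Sum>k\<le>n. (p k t)\<^sup>2) > 0" for n using K_ge_1[of n t] by (simp add: K_def)
  ultimately show False
    using abel_dini_divergence[of "\<lambda>n. (p n t)\<^sup>2"] K unfolding K_def by simp
qed

text \<open>On a set that is stable under complex multiples, orthogonality for the real inner product is
orthogonality for the complex one.\<close>

lemma orthogonal_complex:
  assumes sc: "\<And>s c. s \<in> S \<Longrightarrow> scaleC c s \<in> S" and "\<And>s. s \<in> S \<Longrightarrow> inner u s = 0" "s \<in> S"
  shows "cinner s u = 0"
proof (rule complex_eqI)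
  show "Re (cinner s u) = Re 0" using assms(2)[OF assms(3)] by (simp add: inner_commute flip: inner_ell2_def)
  show "Im (cinner s u) = Im 0" using assms(2)[OF sc[OF assms(3)]] by (simp add: Im_cinner inner_commute)
qed

text \<open>The orthogonal residual \<open>(u, v)\<close> of an element of the maximal graph lies in the maximal graph, and
orthogonality to the finite graph puts \<open>(v, -u)\<close> into its adjoint, which is the maximal graph again.
Symmetry then gives \<open>\<parallel>v\<parallel>\<^sup>2 = -\<parallel>u\<parallel>\<^sup>2\<close>.\<close>

lemma jacobi_operator_eq_max_graph:
  assumes K: "filterlim (\<lambda>n. K n t) at_top sequentially"
  shows "jacobi_operator a b = max_graph"
proof
  have fin: "jacobi_graph_finite a b \<subseteq> max_graph" by (auto simp: finite_graph_eq)
  show sub: "jacobi_operator a b \<subseteq> max_graph"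
  proof (rule subrelI)
    fix y z assume yz: "(y, z) \<in> jacobi_operator a b"
    have "(y, z) \<in> adjoint_graph (jacobi_graph_finite a b)"
      unfolding adjoint_graph_def
    proof clarify
      fix x w assume "(x, w) \<in> jacobi_graph_finite a b"
      then have "(x, w) \<in> adjoint_graph (closure (jacobi_graph_finite a b))"
        using fin adjoint_jacobi_operator unfolding jacobi_operator_def by blast
      then have "cinner z x = cinner y w" using yz unfolding adjoint_graph_def jacobi_operator_def by blast
      then show "cinner w y = cinner x z" by (metis cinner_commute)
    qed
    then show "(y, z) \<in> max_graph" by (simp add: adjoint_finite_graph)
  qed
  show "max_graph \<subseteq> jacobi_operator a b"
  proof (rule subrelI)
    fix x w assume xw: "(x, w) \<in> max_graph"
    have sub2: "Real_Vector_Spaces.subspace (jacobi_operator a b)"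
      unfolding jacobi_operator_def by (rule subspace_closure[OF finite_graph_subspace])
    obtain s where s: "s \<in> jacobi_operator a b" "\<And>y. y \<in> jacobi_operator a b \<Longrightarrow> inner ((x, w) - s) y = 0"
      using orthogonal_projection_exists[OF sub2, of "(x, w)"] by (auto simp: jacobi_operator_def)
    obtain u v where uv: "(x, w) - s = (u, v)" by force
    have uvm: "(u, v) \<in> max_graph"
      unfolding uv[symmetric] using sub s(1) xw by (intro subspace_diff[OF max_graph_subspace]) auto
    have "(v, - u) \<in> adjoint_graph (jacobi_graph_finite a b)"
      unfolding adjoint_graph_def
    proof clarify
      fix y z assume yz: "(y, z) \<in> jacobi_graph_finite a b"
      have orth: "Re (cinner (scaleC c y) u + cinner (scaleC c z) v) = 0" for c
      proof -
        have "(scaleC c y, scaleC c z) \<in> jacobi_operator a b"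
          unfolding jacobi_operator_def using finite_graph_scaleC[OF yz] closure_subset by blast
        from s(2)[OF this] show ?thesis unfolding uv
          by (simp add: inner_commute flip: inner_ell2_def)
      qed
      have "cinner y u + cinner z v = 0"
        using orth[of 1] orth[of "-\<i>"] by (simp add: complex_eq_iff cinner_scaleC_left)
      then show "cinner z v = cinner y (- u)"
        by (simp add: cinner_minus_right add_eq_0_iff)
    qed
    then have "(v, - u) \<in> max_graph" by (simp add: adjoint_finite_graph)
    from max_graph_symmetric[OF K uvm this] have "cinner v v = - cinner u u" by (simp add: cinner_minus_right)
    then have "of_real ((norm v)\<^sup>2 + (norm u)\<^sup>2) = (0::complex)" by (simp add: cinner_self)
    then have "(norm v)\<^sup>2 + (norm u)\<^sup>2 = 0" by (simp only: of_real_eq_0_iff)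
    then have "u = 0" "v = 0" by (auto simp: sum_power2_eq_zero_iff)
    then have "(x, w) = s" using uv by (simp add: zero_prod_def[symmetric])
    then show "(x, w) \<in> jacobi_operator a b" using s(1) by simp
  qed
qed

lemma closure_Domain_jacobi: "closure (Domain (jacobi_operator a b)) = UNIV"
proof -
  let ?S = "Domain (jacobi_graph_finite a b)"
  have dom: "?S = fst ` jacobi_graph_finite a b" by force
  have "closure ?S = UNIV"
  proof (rule dense_if_orthogonal_complement_trivial)
    show "Real_Vector_Spaces.subspace ?S"
      unfolding dom by (intro linear_subspace_image finite_graph_subspace) (simp add: bounded_linear.linear bounded_linear_fst)
    fix u assume u: "\<And>s. s \<in> ?S \<Longrightarrow> inner u s = 0"
    have "ell2_nth u k = 0" for k
    proof -
      let ?v = "\<lambda>j. if j = k then ell2_nth u k else 0"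
      have sub: "{j. ?v j \<noteq> 0} \<subseteq> {k}" by auto
      obtain x w where xw: "(x, w) \<in> jacobi_graph_finite a b" "ell2_nth x = ?v"
        using ex_finite_graph[OF finite_subset[OF sub finite.insertI[OF finite.emptyI]]] by blast
      have "x = scaleC (ell2_nth u k) (ell2_basis k)"
        using xw(2) by (simp add: ell2_nth_inject[symmetric] ell2_basis.rep_eq scaleC.rep_eq fun_eq_iff)
      then have "inner u (scaleC (ell2_nth u k) (ell2_basis k)) = 0" using u xw(1) by blast
      then have "(cmod (ell2_nth u k))\<^sup>2 = 0"
        by (simp add: inner_ell2_def cinner_scaleC_right cinner_basis cmod_power2 power2_eq_square complex_eq_iff)
      then show ?thesis by simp
    qed
    then show "u = 0" by (simp add: ell2_nth_inject[symmetric] zero_ell2.rep_eq fun_eq_iff)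
  qed
  moreover have "?S \<subseteq> Domain (jacobi_operator a b)"
    unfolding jacobi_operator_def using closure_subset by blast
  ultimately show ?thesis using closure_mono by blast
qed

theorem self_adjoint_jacobi:
  assumes "filterlim (\<lambda>n. K n t) at_top sequentially"
  shows "self_adjoint (jacobi_operator a b)"
  unfolding self_adjoint_def
  using closure_Domain_jacobi adjoint_jacobi_operator jacobi_operator_eq_max_graph[OF assms] by simp

text \<open>A vector orthogonal to the range of \<open>J - \<i>\<close> on finite vectors would be an eigenvector of the
symmetric maximal operator for the nonreal number \<open>-\<i>\<close>. So the range is dense, and in particular it
approximates the zeroth basis vector. It is in this form that self-adjointness enters the
convergence of the quadrature measures.\<close>

lemma resolvent_approximation:
  assumes K: "filterlim (\<lambda>n. K n t) at_top sequentially" and e: "e > 0"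
  shows "\<exists>v :: nat \<Rightarrow> complex. \<exists>N. (\<forall>k>N. v k = 0) \<and>
    (\<Sum>k\<le>Suc N. (cmod (J v k - \<i> * v k - (if k = 0 then 1 else 0)))\<^sup>2) < e"
proof -
  let ?f = "\<lambda>(x, w). w + scaleC (- \<i>) x"
  let ?S = "?f ` jacobi_graph_finite a b"
  interpret sc: bounded_linear "scaleC (- \<i>)" by (rule bounded_linear_scaleC)
  have "closure ?S = UNIV"
  proof (rule dense_if_orthogonal_complement_trivial)
    have "linear ?f" by (rule linearI) (auto simp: sc.add sc.scale algebra_simps)
    then show "Real_Vector_Spaces.subspace ?S" by (rule linear_subspace_image[OF _ finite_graph_subspace])
    fix u assume u: "\<And>s. s \<in> ?S \<Longrightarrow> inner u s = 0"
    have cl: "scaleC c s \<in> ?S" if "s \<in> ?S" for c s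
    proof -
      from that obtain x w where xw: "(x, w) \<in> jacobi_graph_finite a b" "s = w + scaleC (- \<i>) x" by auto
      have "scaleC c s = ?f (scaleC c x, scaleC c w)" unfolding xw(2) by transfer (auto simp: algebra_simps)
      then show ?thesis using finite_graph_scaleC[OF xw(1)] by blast
    qed
    have "(u, scaleC (- \<i>) u) \<in> adjoint_graph (jacobi_graph_finite a b)"
      unfolding adjoint_graph_def
    proof clarify
      fix x w assume "(x, w) \<in> jacobi_graph_finite a b"
      then have "w + scaleC (- \<i>) x \<in> ?S" by force
      from orthogonal_complex[OF cl u this] have "cinner (w + scaleC (- \<i>) x) u = 0" .
      then show "cinner w u = cinner x (scaleC (- \<i>) u)"
        by (simp add: cinner_add_left cinner_scaleC_left cinner_scaleC_right)
    qed
    then have m: "(u, scaleC (- \<i>) u) \<in> max_graph" by (simp add: adjoint_finite_graph)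
    from max_graph_symmetric[OF K m m] have "cinner u u = 0"
      by (simp add: cinner_scaleC_left cinner_scaleC_right)
    then show "u = 0" by (simp add: cinner_self)
  qed
  then have "ell2_basis 0 \<in> closure ?S" by simp
  then obtain s where s: "s \<in> ?S" "dist s (ell2_basis 0) < sqrt e"
    unfolding closure_approachable using e by (metis real_sqrt_gt_zero)
  then obtain x w where xw: "(x, w) \<in> jacobi_graph_finite a b" "s = w + scaleC (- \<i>) x" by auto
  then have fin: "finite {k. ell2_nth x k \<noteq> 0}" and w: "ell2_nth w k = J (ell2_nth x) k" for k
    by (auto simp: finite_graph_eq max_graph_def)
  then obtain N where N: "\<forall>k>N. ell2_nth x k = 0"
    using finite_nat_set_iff_bounded_le by (metis (mono_tags, lifting) leD mem_Collect_eq)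
  have "(\<Sum>k\<le>Suc N. (cmod (ell2_nth (s - ell2_basis 0) k))\<^sup>2) \<le> (norm (s - ell2_basis 0))\<^sup>2"
    by (rule sum_le_norm_ell2) simp
  also have "\<dots> < (sqrt e)\<^sup>2" using s(2) by (intro power_strict_mono) (auto simp: dist_norm)
  also have "\<dots> = e" using e by simp
  finally have "(\<Sum>k\<le>Suc N. (cmod (ell2_nth (s - ell2_basis 0) k))\<^sup>2) < e" .
  moreover have "ell2_nth (s - ell2_basis 0) k = J (ell2_nth x) k - \<i> * ell2_nth x k - (if k = 0 then 1 else 0)" for k
    by (simp add: xw(2) minus_ell2.rep_eq plus_ell2.rep_eq scaleC.rep_eq ell2_basis.rep_eq w)
  ultimately show ?thesis using N by (intro exI[of _ "ell2_nth x"] exI[of _ N]) simp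
qed

end

section \<open>Moments of the spectral measure\<close>

text \<open>An equality between sums of measures, stated on sets, extends to integrals. The densities \<open>g1\<close> and
\<open>g2\<close> will be the negative and the positive part of a signed density.\<close>

lemma nn_integral_eq_of_sets:
  assumes [measurable_cong]: "sets M1 = sets borel" "sets M2 = sets borel" "sets N = sets borel"
    and [measurable]: "g1 \<in> borel_measurable borel" "g2 \<in> borel_measurable borel"
    and eq: "\<And>B. B \<in> sets borel \<Longrightarrow>
      emeasure M1 B + (\<integral>\<^sup>+t. g1 t * indicator B t \<partial>N) = emeasure M2 B + (\<integral>\<^sup>+t. g2 t * indicator B t \<partial>N)"
    and f: "f \<in> borel_measurable (borel :: real measure)"
  shows "(\<integral>\<^sup>+t. f t \<partial>M1) + (\<integral>\<^sup>+t. g1 t * f t \<partial>N) = (\<integral>\<^sup>+t. f t \<partial>M2) + (\<integral>\<^sup>+t. g2 t * f t \<partial>N)"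
  using f
proof (induction rule: borel_measurable_induct)
  case (cong f g)
  then have "f = g" by (auto simp: fun_eq_iff)
  then show ?case using cong by simp
next
  case (set A)
  then show ?case using eq[of A] by simp
next
  case (mult u c)
  have *: "(\<integral>\<^sup>+t. c * u t \<partial>M) + (\<integral>\<^sup>+t. g t * (c * u t) \<partial>N) = c * ((\<integral>\<^sup>+t. u t \<partial>M) + (\<integral>\<^sup>+t. g t * u t \<partial>N))"
    if "sets M = sets borel" "g \<in> borel_measurable borel" for M g
  proof -
    note [measurable_cong] = that(1) and [measurable] = that(2) mult.hyps(2)
    have "(\<integral>\<^sup>+t. g t * (c * u t) \<partial>N) = (\<integral>\<^sup>+t. c * (g t * u t) \<partial>N)" by (simp add: ac_simps)
    then show ?thesis by (simp add: nn_integral_cmult distrib_left)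
  qed
  show ?case using mult.IH by (simp add: *[OF assms(1,4)] *[OF assms(2,5)])
next
  case (add u v)
  have *: "(\<integral>\<^sup>+t. u t + v t \<partial>M) + (\<integral>\<^sup>+t. g t * (u t + v t) \<partial>N) =
      ((\<integral>\<^sup>+t. u t \<partial>M) + (\<integral>\<^sup>+t. g t * u t \<partial>N)) + ((\<integral>\<^sup>+t. v t \<partial>M) + (\<integral>\<^sup>+t. g t * v t \<partial>N))"
    if "sets M = sets borel" "g \<in> borel_measurable borel" for M g
  proof -
    note [measurable_cong] = that(1) and [measurable] = that(2) add.hyps(1,3)
    show ?thesis by (simp add: distrib_left nn_integral_add ac_simps)
  qed
  have "(\<integral>\<^sup>+t. v t + u t \<partial>M1) + (\<integral>\<^sup>+t. g1 t * (v t + u t) \<partial>N) = (\<integral>\<^sup>+t. v t + u t \<partial>M2) + (\<integral>\<^sup>+t. g2 t * (v t + u t) \<partial>N)"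
    using add.IH *[OF assms(1,4)] *[OF assms(2,5)] by (simp add: add.commute)
  then show ?case .
next
  case (seq U)
  have *: "(\<integral>\<^sup>+t. (SUP i. U i) t \<partial>M) + (\<integral>\<^sup>+t. g t * (SUP i. U i) t \<partial>N) =
      (SUP i. (\<integral>\<^sup>+t. U i t \<partial>M) + (\<integral>\<^sup>+t. g t * U i t \<partial>N))"
    if "sets M = sets borel" "g \<in> borel_measurable borel" for M g
  proof -
    note [measurable_cong] = that(1) and [measurable] = that(2) seq.hyps(1)
    have inc: "incseq (\<lambda>i t. g t * U i t)"
      using seq.hyps(3) by (auto simp: incseq_def le_fun_def intro!: mult_left_mono)
    have "(\<integral>\<^sup>+t. (SUP i. U i) t \<partial>M) = (SUP i. \<integral>\<^sup>+t. U i t \<partial>M)"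
      unfolding SUP_apply by (rule nn_integral_monotone_convergence_SUP) (use seq.hyps in auto)
    moreover have "(\<integral>\<^sup>+t. g t * (SUP i. U i) t \<partial>N) = (SUP i. \<integral>\<^sup>+t. g t * U i t \<partial>N)"
      unfolding SUP_apply SUP_mult_left_ennreal
      by (rule nn_integral_monotone_convergence_SUP[OF inc]) simp
    moreover have "incseq (\<lambda>i. \<integral>\<^sup>+t. U i t \<partial>M)" "incseq (\<lambda>i. \<integral>\<^sup>+t. g t * U i t \<partial>N)"
      using seq.hyps(3) inc by (auto simp: incseq_def le_fun_def intro!: nn_integral_mono)
    ultimately show ?thesis by (simp add: ennreal_SUP_add)
  qed
  show ?case unfolding *[OF assms(1,4)] *[OF assms(2,5)] using seq.IH by simp
qed

lemma add_eq_of_enn2real: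
  assumes "enn2real w + enn2real x = enn2real y + enn2real z"
    and "w < \<infinity>" "x < \<infinity>" "y < \<infinity>" "z < \<infinity>"
  shows "w + x = y + z"
proof -
  have *: "u + v = ennreal (enn2real u + enn2real v)" if "u < \<infinity>" "v < \<infinity>" for u v
    using that by (simp add: ennreal_plus less_top)
  show ?thesis using *[OF assms(2,3)] *[OF assms(4,5)] assms(1) by simp
qed

text \<open>Two finite measures that differ by a signed density \<open>g\<close> have integrals that differ by the integral
against \<open>g\<close>. Moving the negative parts to the other side reduces this to nonnegative measures.\<close>

lemma integral_eq_of_measure_eq:
  fixes f g :: "real \<Rightarrow> real"
  assumes sets: "sets M1 = sets borel" "sets M2 = sets borel" "sets N = sets borel"
    and fin: "finite_measure M1" "finite_measure M2"
    and g: "g \<in> borel_measurable borel" "integrable N g"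
    and eq: "\<And>B. B \<in> sets borel \<Longrightarrow> measure M1 B = measure M2 B + (\<integral>t. indicator B t * g t \<partial>N)"
    and f: "integrable M1 f" "integrable M2 f" "integrable N (\<lambda>t. f t * g t)"
  shows "(\<integral>t. f t \<partial>M1) = (\<integral>t. f t \<partial>M2) + (\<integral>t. f t * g t \<partial>N)"
proof -
  interpret M1: finite_measure M1 by (rule fin)
  interpret M2: finite_measure M2 by (rule fin)
  note [measurable_cong] = sets and [measurable] = g(1)
  have [measurable]: "f \<in> borel_measurable borel"
    using f(1) sets(1) by (metis borel_measurable_integrable measurable_cong_sets)
  have split: "(\<integral>t. u t * g t \<partial>N) = enn2real (\<integral>\<^sup>+t. ennreal (g t) * ennreal (u t) \<partial>N) - enn2real (\<integral>\<^sup>+t. ennreal (- g t) * ennreal (u t) \<partial>N)"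
    and fin1: "(\<integral>\<^sup>+t. ennreal (g t) * ennreal (u t) \<partial>N) < \<infinity>"
    and fin2: "(\<integral>\<^sup>+t. ennreal (- g t) * ennreal (u t) \<partial>N) < \<infinity>"
    if u: "\<And>t. u t \<ge> 0" "integrable N (\<lambda>t. u t * g t)" for u
  proof -
    have e1: "(\<lambda>t. ennreal (g t) * ennreal (u t)) = (\<lambda>t. ennreal (u t * g t))"
      by (simp add: fun_eq_iff ennreal_mult''[OF u(1), symmetric] mult.commute)
    have e2: "(\<lambda>t. ennreal (- g t) * ennreal (u t)) = (\<lambda>t. ennreal (- (u t * g t)))"
    proof
      fix t show "ennreal (- g t) * ennreal (u t) = ennreal (- (u t * g t))"
        using ennreal_mult'[OF u(1)[of t], of "- g t"] by (simp add: mult.commute)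
    qed
    show "(\<integral>t. u t * g t \<partial>N) = enn2real (\<integral>\<^sup>+t. ennreal (g t) * ennreal (u t) \<partial>N) - enn2real (\<integral>\<^sup>+t. ennreal (- g t) * ennreal (u t) \<partial>N)"
      unfolding e1 e2 by (rule real_lebesgue_integral_def[OF u(2)])
    show "(\<integral>\<^sup>+t. ennreal (g t) * ennreal (u t) \<partial>N) < \<infinity>" "(\<integral>\<^sup>+t. ennreal (- g t) * ennreal (u t) \<partial>N) < \<infinity>"
      unfolding e1 e2 using real_integrable_def[THEN iffD1, OF u(2)] by (auto simp: less_top)
  qed
  have eqB: "emeasure M1 B + (\<integral>\<^sup>+t. ennreal (- g t) * indicator B t \<partial>N) =
      emeasure M2 B + (\<integral>\<^sup>+t. ennreal (g t) * indicator B t \<partial>N)" if B: "B \<in> sets borel" for B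
  proof -
    let ?u = "indicator B :: real \<Rightarrow> real"
    have iu: "integrable N (\<lambda>t. ?u t * g t)"
      using integrable_mult_indicator[of B N g] g(2) B sets(3) by simp
    note s = split[OF _ iu] fin1[OF _ iu] fin2[OF _ iu]
    have "enn2real (emeasure M1 B) + enn2real (\<integral>\<^sup>+t. ennreal (- g t) * indicator B t \<partial>N) =
       enn2real (emeasure M2 B) + enn2real (\<integral>\<^sup>+t. ennreal (g t) * indicator B t \<partial>N)"
      using eq[OF B] s(1) by (simp add: ennreal_indicator measure_def)
    then show ?thesis
      by (rule add_eq_of_enn2real) (use s(2,3) in \<open>auto simp: ennreal_indicator less_top[symmetric]\<close>)
  qed
  have nonneg: "(\<integral>t. u t \<partial>M1) = (\<integral>t. u t \<partial>M2) + (\<integral>t. u t * g t \<partial>N)"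
    if u: "\<And>t. u t \<ge> 0" "u \<in> borel_measurable borel" "integrable M1 u" "integrable M2 u" "integrable N (\<lambda>t. u t * g t)" for u
  proof -
    note [measurable] = u(2)
    have "(\<integral>\<^sup>+t. ennreal (u t) \<partial>M1) + (\<integral>\<^sup>+t. ennreal (- g t) * ennreal (u t) \<partial>N) =
        (\<integral>\<^sup>+t. ennreal (u t) \<partial>M2) + (\<integral>\<^sup>+t. ennreal (g t) * ennreal (u t) \<partial>N)"
      by (rule nn_integral_eq_of_sets[OF sets _ _ eqB]) auto
    moreover have "(\<integral>\<^sup>+t. ennreal (u t) \<partial>M1) = ennreal (\<integral>t. u t \<partial>M1)" "(\<integral>\<^sup>+t. ennreal (u t) \<partial>M2) = ennreal (\<integral>t. u t \<partial>M2)"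
      using u by (auto intro!: nn_integral_eq_integral)
    ultimately have "enn2real (ennreal (\<integral>t. u t \<partial>M1) + (\<integral>\<^sup>+t. ennreal (- g t) * ennreal (u t) \<partial>N)) =
        enn2real (ennreal (\<integral>t. u t \<partial>M2) + (\<integral>\<^sup>+t. ennreal (g t) * ennreal (u t) \<partial>N))" by simp
    moreover have "(\<integral>t. u t \<partial>M1) \<ge> 0" "(\<integral>t. u t \<partial>M2) \<ge> 0" using u(1) by auto
    ultimately show ?thesis
      using fin1[OF u(1,5)] fin2[OF u(1,5)] split[OF u(1,5)] by (simp add: enn2real_plus)
  qed
  have part: "(\<integral>t. max 0 (v t) \<partial>M1) = (\<integral>t. max 0 (v t) \<partial>M2) + (\<integral>t. max 0 (v t) * g t \<partial>N)"
    and ipart: "integrable N (\<lambda>t. max 0 (v t) * g t)"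
    if v: "v = f \<or> v = (\<lambda>t. - f t)" for v
  proof -
    have [measurable]: "v \<in> borel_measurable borel" using v by auto
    show i: "integrable N (\<lambda>t. max 0 (v t) * g t)"
      by (rule Bochner_Integration.integrable_bound[OF f(3)])
        (use v in \<open>auto simp: abs_mult max_def intro!: mult_right_mono\<close>)
    show "(\<integral>t. max 0 (v t) \<partial>M1) = (\<integral>t. max 0 (v t) \<partial>M2) + (\<integral>t. max 0 (v t) * g t \<partial>N)"
      by (rule nonneg) (use v f i in auto)
  qed
  have dec: "f t = max 0 (f t) - max 0 (- f t)" for t by (simp add: max_def)
  have "(\<integral>t. f t \<partial>M1) = (\<integral>t. max 0 (f t) \<partial>M1) - (\<integral>t. max 0 (- f t) \<partial>M1)"
    by (subst dec, rule Bochner_Integration.integral_diff) (use f in auto)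
  moreover have "(\<integral>t. f t \<partial>M2) = (\<integral>t. max 0 (f t) \<partial>M2) - (\<integral>t. max 0 (- f t) \<partial>M2)"
    by (subst dec, rule Bochner_Integration.integral_diff) (use f in auto)
  moreover have "(\<integral>t. f t * g t \<partial>N) = (\<integral>t. max 0 (f t) * g t \<partial>N) - (\<integral>t. max 0 (- f t) * g t \<partial>N)"
  proof -
    have "(\<integral>t. f t * g t \<partial>N) = (\<integral>t. max 0 (f t) * g t - max 0 (- f t) * g t \<partial>N)"
      by (rule Bochner_Integration.integral_cong) (auto simp: max_def)
    also have "\<dots> = (\<integral>t. max 0 (f t) * g t \<partial>N) - (\<integral>t. max 0 (- f t) * g t \<partial>N)"
      by (rule Bochner_Integration.integral_diff) (use ipart in auto)
    finally show ?thesis .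
  qed
  ultimately show ?thesis using part[of f] part[of "\<lambda>t. - f t"] by simp
qed

text \<open>Apply the bound to the parts of bounded intervals on which \<open>f\<close> is positive or negative, and use
monotone convergence.\<close>

lemma integrable_of_bounded_set_integrals:
  fixes f :: "real \<Rightarrow> real"
  assumes sets: "sets M = sets borel" and [measurable]: "f \<in> borel_measurable borel"
    and int: "\<And>n::nat. integrable M (\<lambda>t. indicator {-real n..real n} t * f t)"
    and bound: "\<And>C n. C \<in> sets borel \<Longrightarrow> C \<subseteq> {-real n..real n} \<Longrightarrow> \<bar>\<integral>t. indicator C t * f t \<partial>M\<bar> \<le> B"
  shows "integrable M f"
proof -
  note [measurable_cong] = sets
  have pos: "integrable M (\<lambda>t. max 0 (v t))" if v: "v = f \<or> v = (\<lambda>t. - f t)" for v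
  proof -
    have [measurable]: "v \<in> borel_measurable borel" using v by auto
    define F where "F n t = indicator ({-real n..real n} \<inter> {t. v t > 0}) t * v t" for n :: nat and t
    have iF: "integrable M (F n)" for n
    proof (rule Bochner_Integration.integrable_bound[OF int[of n]])
      show "F n \<in> borel_measurable M" unfolding F_def by measurable
      show "AE t in M. norm (F n t) \<le> norm (indicator {-real n..real n} t * f t)"
        using v by (auto simp: F_def indicator_def)
    qed
    have mono: "mono (\<lambda>n. F n t)" for t
      by (auto simp: F_def mono_def indicator_def)
    have lim: "(\<lambda>n. F n t) \<longlonglongrightarrow> max 0 (v t)" for t
    proof (rule tendsto_eventually)
      obtain N :: nat where N: "\<bar>t\<bar> \<le> N" using real_arch_simple by blast
      show "\<forall>\<^sub>F n in sequentially. F n t = max 0 (v t)"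
        by (rule eventually_sequentiallyI[of N]) (use N in \<open>auto simp: F_def indicator_def\<close>)
    qed
    have le: "(\<integral>t. F n t \<partial>M) \<le> B" for n
    proof -
      let ?C = "{-real n..real n} \<inter> {t. v t > 0}"
      have "\<bar>\<integral>t. indicator ?C t * f t \<partial>M\<bar> \<le> B" by (rule bound) auto
      moreover have "(\<integral>t. F n t \<partial>M) = (\<integral>t. indicator ?C t * f t \<partial>M) \<or> (\<integral>t. F n t \<partial>M) = - (\<integral>t. indicator ?C t * f t \<partial>M)"
        using v by (auto simp: F_def[abs_def])
      ultimately show ?thesis by auto
    qed
    have "incseq (\<lambda>n. \<integral>t. F n t \<partial>M)"
      unfolding incseq_def using mono by (auto intro!: integral_mono iF dest: monoD)
    then obtain L where L: "(\<lambda>n. \<integral>t. F n t \<partial>M) \<longlonglongrightarrow> L"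
      using le incseq_convergent[of "\<lambda>n. \<integral>t. F n t \<partial>M" B] by blast
    show ?thesis
      by (rule integrable_monotone_convergence[OF iF _ _ L]) (use mono lim in auto)
  qed
  have "integrable M (\<lambda>t. max 0 (f t) - max 0 (- f t))"
    by (rule Bochner_Integration.integrable_diff) (use pos in auto)
  moreover have "(\<lambda>t. max 0 (f t) - max 0 (- f t)) = f" by (auto simp: fun_eq_iff max_def)
  ultimately show ?thesis by simp
qed

text \<open>The measures \<open>\<langle>E(B)x, x\<rangle>\<close> form a real quadratic form in \<open>x\<close>, and polarizing it over the reals suffices to
reach the basis vectors; so the arguments are in terms of the real part of the inner product.\<close>

locale pvm =
  fixes E :: "real set \<Rightarrow> ell2 \<Rightarrow> ell2"
  assumes pvm: "projection_valued_measure E"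
begin

lemma E_proj: "B \<in> sets borel \<Longrightarrow> orthogonal_projection (E B)"
  using pvm by (simp add: projection_valued_measure_def)

lemma E_add: "B \<in> sets borel \<Longrightarrow> E B (x + y) = E B x + E B y"
  using E_proj by (simp add: orthogonal_projection_def)

lemma E_inner: "B \<in> sets borel \<Longrightarrow> inner (E B x) y = inner x (E B y)"
  using E_proj by (simp add: orthogonal_projection_def inner_ell2_def)

lemma E_scaleC: "B \<in> sets borel \<Longrightarrow> E B (scaleC c x) = scaleC c (E B x)"
  using E_proj by (simp add: orthogonal_projection_def)

lemma E_minus: "B \<in> sets borel \<Longrightarrow> E B (- x) = - E B x"
  by (simp add: uminus_scaleC E_scaleC)

lemma E_diff: "B \<in> sets borel \<Longrightarrow> E B (x - y) = E B x - E B y"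
  using E_add[of B x "- y"] by (simp add: E_minus)

lemma E_Int: "B \<in> sets borel \<Longrightarrow> C \<in> sets borel \<Longrightarrow> E B (E C x) = E (B \<inter> C) x"
  using pvm by (simp add: projection_valued_measure_def)

lemma E_nonneg: "B \<in> sets borel \<Longrightarrow> inner (E B x) x = (norm (E B x))\<^sup>2"
  using E_Int[of B B x] by (metis E_inner inf.idem power2_norm_eq_inner)

lemma E_contraction: "B \<in> sets borel \<Longrightarrow> norm (E B x) \<le> norm x"
proof -
  assume B: "B \<in> sets borel"
  have "(norm (E B x))\<^sup>2 \<le> norm (E B x) * norm x"
    using norm_cauchy_schwarz[of "E B x" x] E_nonneg[OF B] by simp
  then show ?thesis by (cases "norm (E B x) = 0") (auto simp: power2_eq_square)
qed

abbreviation \<mu> :: "ell2 \<Rightarrow> real measure" where "\<mu> x \<equiv> pvm_measure E x"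

lemma sets_\<mu> [simp, measurable_cong]: "sets (\<mu> x) = sets borel"
  and space_\<mu> [simp]: "space (\<mu> x) = UNIV"
  unfolding pvm_measure_def using sets.sigma_sets_eq[of "borel :: real measure"]
  by (auto simp: sets_measure_of_conv space_measure_of_conv)

lemma emeasure_\<mu>: assumes B: "B \<in> sets borel" shows "emeasure (\<mu> x) B = ennreal (inner (E B x) x)"
proof -
  have "emeasure (\<mu> x) B = ennreal (Re (cinner (E B x) x))"
  proof (rule emeasure_measure_of[OF pvm_measure_def])
    show "positive (sets (\<mu> x)) (\<lambda>B. ennreal (Re (cinner (E B x) x)))"
      using pvm by (simp add: positive_def projection_valued_measure_def flip: inner_ell2_def)
    show "countably_additive (sets (\<mu> x)) (\<lambda>B. ennreal (Re (cinner (E B x) x)))"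
      unfolding countably_additive_def
    proof (intro allI impI)
      fix A :: "nat \<Rightarrow> real set"
      assume A: "range A \<subseteq> sets (\<mu> x)" "disjoint_family A"
      then have "(\<lambda>i. E (A i) x) sums E (\<Union>i. A i) x"
        using pvm unfolding projection_valued_measure_def by simp
      then have s: "(\<lambda>i. inner (E (A i) x) x) sums inner (E (\<Union>i. A i) x) x"
        by (rule bounded_linear.sums[OF bounded_linear_inner_left])
      have nn: "0 \<le> inner (E (A i) x) x" for i using A E_nonneg[of "A i" x] by auto
      have "(\<Sum>i. ennreal (inner (E (A i) x) x)) = ennreal (inner (E (\<Union>i. A i) x) x)"
        using s nn by (simp add: suminf_ennreal2 sums_iff)
      then show "(\<Sum>i. ennreal (Re (cinner (E (A i) x) x))) = ennreal (Re (cinner (E (\<Union>i. A i) x) x))"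
        by (simp add: inner_ell2_def)
    qed
  qed (use B in auto)
  then show ?thesis by (simp add: inner_ell2_def)
qed

lemma measure_\<mu>: "B \<in> sets borel \<Longrightarrow> measure (\<mu> x) B = inner (E B x) x"
  by (simp add: measure_def emeasure_\<mu> E_nonneg)

lemma finite_\<mu>: "finite_measure (\<mu> x)"
  by (rule finite_measureI) (simp add: emeasure_\<mu>)

lemma E_UNIV: "E UNIV x = x" using pvm by (simp add: projection_valued_measure_def)

lemma \<mu>_projected:
  assumes C: "C \<in> sets borel" shows "\<mu> (E C x) = density (\<mu> x) (indicator C)"
proof (rule measure_eqI)
  fix B assume "B \<in> sets (\<mu> (E C x))"
  then have B: "B \<in> sets borel" by simp
  have "emeasure (\<mu> (E C x)) B = ennreal (inner (E B (E C x)) (E C x))" by (rule emeasure_\<mu>[OF B])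
  also have "inner (E B (E C x)) (E C x) = inner (E (B \<inter> C) x) x"
    using B C by (simp add: E_inner[symmetric] E_Int) (simp add: Int_left_commute Int_commute)
  also have "ennreal \<dots> = emeasure (\<mu> x) (B \<inter> C)" using B C by (simp add: emeasure_\<mu>)
  also have "\<dots> = (\<integral>\<^sup>+t. indicator (B \<inter> C) t \<partial>\<mu> x)" using B C by simp
  also have "\<dots> = (\<integral>\<^sup>+t. indicator C t * indicator B t \<partial>\<mu> x)"
    by (simp add: indicator_inter_arith mult.commute)
  also have "\<dots> = emeasure (density (\<mu> x) (indicator C)) B"
    using B C by (subst emeasure_density) auto
  finally show "emeasure (\<mu> (E C x)) B = emeasure (density (\<mu> x) (indicator C)) B" .
qed simp

end

text \<open>Linearity and symmetry of the operator are what the polarization of its quadratic form requires.\<close>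

locale spectral_measure = pvm +
  fixes A :: "(ell2 \<times> ell2) set"
  assumes spectral: "spectral_measure_of A E"
    and A_subspace: "Real_Vector_Spaces.subspace A"
    and A_symmetric: "\<And>x w y z. (x, w) \<in> A \<Longrightarrow> (y, z) \<in> A \<Longrightarrow> inner w y = inner x z"
begin

lemma Domain_iff: "x \<in> Domain A \<longleftrightarrow> integrable (\<mu> x) (\<lambda>t. t\<^sup>2)"
  using spectral by (simp add: spectral_measure_of_def)

lemma integrable_id: "x \<in> Domain A \<Longrightarrow> integrable (\<mu> x) (\<lambda>t. t)"
proof -
  interpret finite_measure "\<mu> x" by (rule finite_\<mu>)
  assume "x \<in> Domain A"
  then have "integrable (\<mu> x) (\<lambda>t. t\<^sup>2)" using Domain_iff by blast
  then have "integrable (\<mu> x) (\<lambda>t. 1 + t\<^sup>2)" by simp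
  then show ?thesis
  proof (rule Bochner_Integration.integrable_bound)
    have "2 * \<bar>t\<bar> \<le> 1 + t\<^sup>2" for t :: real using sum_squares_bound[of "\<bar>t\<bar>" 1] by simp
    then have "\<bar>t\<bar> \<le> 1 + t\<^sup>2" for t :: real by (smt (verit) abs_ge_zero)
    then show "AE t in \<mu> x. norm t \<le> norm (1 + t\<^sup>2)" by (auto intro: order_trans)
  qed simp
qed

lemma quadratic_form: "(x, w) \<in> A \<Longrightarrow> inner w x = (\<integral>t. t \<partial>\<mu> x)"
  using spectral by (fastforce simp: spectral_measure_of_def inner_ell2_def)

lemma E_Domain:
  assumes "y \<in> Domain A" "C \<in> sets borel" shows "E C y \<in> Domain A"
proof -
  have "integrable (\<mu> y) (\<lambda>t. indicator C t *\<^sub>R t\<^sup>2)"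
    using assms Domain_iff by (intro integrable_mult_indicator) auto
  then have "integrable (density (\<mu> y) (\<lambda>t. ennreal (indicator C t))) (\<lambda>t. t\<^sup>2)"
    using assms(2) by (subst integrable_density) auto
  then show ?thesis
    unfolding Domain_iff \<mu>_projected[OF assms(2)] by (simp add: ennreal_indicator)
qed

text \<open>The differential form of \<open>A = \<integral> t dE(t)\<close>: if the mixed measure \<open>B \<mapsto> \<langle>E(B)x, y\<rangle>\<close> has density \<open>g\<close>
with respect to the measure of \<open>y\<close>, then that of \<open>Ax\<close> and \<open>y\<close> has density \<open>t g(t)\<close>. The measures of the
two vectors \<open>x \<plusminus> E(C)y\<close> differ by four times the density \<open>g\<close> restricted to \<open>C\<close>; integrating \<open>t\<close> against
both and polarizing gives the claim.\<close>

lemma inner_operator_projection: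
  assumes xw: "(x, w) \<in> A" and y: "y \<in> Domain A" and C: "C \<in> sets borel"
    and g: "g \<in> borel_measurable borel" "integrable (\<mu> y) g"
    and eq: "\<And>B. B \<in> sets borel \<Longrightarrow> inner (E B x) y = (\<integral>t. indicator B t * g t \<partial>\<mu> y)"
    and int: "integrable (\<mu> y) (\<lambda>t. indicator C t * (t * g t))"
  shows "inner w (E C y) = (\<integral>t. indicator C t * (t * g t) \<partial>\<mu> y)"
proof -
  obtain z where z: "(E C y, z) \<in> A" using E_Domain[OF y C] by blast
  have plus: "(x + E C y, w + z) \<in> A" using subspace_add[OF A_subspace xw z] by simp
  have minus: "(x - E C y, w - z) \<in> A" using subspace_diff[OF A_subspace xw z] by simp
  let ?g = "\<lambda>t. 4 * (indicator C t * g t)"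
  have gC: "integrable (\<mu> y) (\<lambda>t. indicator C t * g t)"
    using integrable_mult_indicator[of C "\<mu> y" g] g(2) C by simp
  have "(\<integral>t. t \<partial>\<mu> (x + E C y)) = (\<integral>t. t \<partial>\<mu> (x - E C y)) + (\<integral>t. t * ?g t \<partial>\<mu> y)"
  proof (rule integral_eq_of_measure_eq)
    show "finite_measure (\<mu> (x + E C y))" "finite_measure (\<mu> (x - E C y))" by (rule finite_\<mu>)+
    show "?g \<in> borel_measurable borel" using g(1) C by measurable
    show "integrable (\<mu> y) ?g" using gC by simp
    show "integrable (\<mu> (x + E C y)) (\<lambda>t. t)" "integrable (\<mu> (x - E C y)) (\<lambda>t. t)"
      using plus minus by (auto intro!: integrable_id)
    have "integrable (\<mu> y) (\<lambda>t. 4 * (indicator C t * (t * g t)))" using int by simp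
    then show "integrable (\<mu> y) (\<lambda>t. t * ?g t)" by (simp add: ac_simps)
    fix B :: "real set" assume B: "B \<in> sets borel"
    have "measure (\<mu> (x + E C y)) B - measure (\<mu> (x - E C y)) B = 4 * inner (E B x) (E C y)"
    proof -
      have "inner (E B x + E B (E C y)) (x + E C y) - inner (E B x - E B (E C y)) (x - E C y) =
          2 * inner (E B x) (E C y) + 2 * inner (E B (E C y)) x"
        by (simp add: inner_add_left inner_add_right inner_diff_left inner_diff_right)
      moreover have "inner (E B (E C y)) x = inner (E B x) (E C y)"
        using E_inner[OF B, of "E C y" x] inner_commute[of "E C y" "E B x"] by simp
      ultimately show ?thesis by (simp add: measure_\<mu> B E_add E_diff)
    qed
    also have "inner (E B x) (E C y) = inner (E (C \<inter> B) x) y"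
      using B C by (simp add: E_inner[OF C, symmetric] E_Int)
    also have "\<dots> = (\<integral>t. indicator (C \<inter> B) t * g t \<partial>\<mu> y)" using B C by (intro eq) auto
    also have "4 * \<dots> = (\<integral>t. 4 * (indicator (C \<inter> B) t * g t) \<partial>\<mu> y)" by simp
    also have "\<dots> = (\<integral>t. indicator B t * ?g t \<partial>\<mu> y)"
      by (rule Bochner_Integration.integral_cong) (auto simp: indicator_inter_arith)
    finally show "measure (\<mu> (x + E C y)) B = measure (\<mu> (x - E C y)) B + (\<integral>t. indicator B t * ?g t \<partial>\<mu> y)" by simp
  qed simp_all
  then have "inner (w + z) (x + E C y) = inner (w - z) (x - E C y) + (\<integral>t. t * ?g t \<partial>\<mu> y)"
    using quadratic_form[OF plus] quadratic_form[OF minus] by simp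
  moreover have "inner (w + z) (x + E C y) - inner (w - z) (x - E C y) = 2 * inner w (E C y) + 2 * inner z x"
    by (simp add: inner_add_left inner_add_right inner_diff_left inner_diff_right)
  moreover have "inner z x = inner w (E C y)" using A_symmetric[OF z xw] by (simp add: inner_commute)
  moreover have "(\<integral>t. t * ?g t \<partial>\<mu> y) = 4 * (\<integral>t. indicator C t * (t * g t) \<partial>\<mu> y)"
  proof -
    have "(\<integral>t. t * ?g t \<partial>\<mu> y) = (\<integral>t. 4 * (indicator C t * (t * g t)) \<partial>\<mu> y)"
      by (rule Bochner_Integration.integral_cong) auto
    then show ?thesis by simp
  qed
  ultimately show ?thesis by simp
qed

text \<open>On a bounded set \<open>C\<close> the integrability of \<open>t g(t)\<close> is clear, and there its integral is an inner product
with \<open>E(C)y\<close>, which is bounded independently of \<open>C\<close>.\<close>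

lemma integrable_id_times:
  assumes xw: "(x, w) \<in> A" and y: "y \<in> Domain A"
    and g: "g \<in> borel_measurable borel" "integrable (\<mu> y) g"
    and eq: "\<And>B. B \<in> sets borel \<Longrightarrow> inner (E B x) y = (\<integral>t. indicator B t * g t \<partial>\<mu> y)"
  shows "integrable (\<mu> y) (\<lambda>t. t * g t)"
proof (rule integrable_of_bounded_set_integrals)
  show [measurable]: "(\<lambda>t. t * g t) \<in> borel_measurable borel" using g(1) by measurable
  have bint: "integrable (\<mu> y) (\<lambda>t. indicator C t * (t * g t))"
    if C: "C \<in> sets borel" "C \<subseteq> {-real n..real n}" for C n
  proof (rule Bochner_Integration.integrable_bound)
    show "integrable (\<mu> y) (\<lambda>t. real n * g t)" using g(2) by simp
    show "AE t in \<mu> y. norm (indicator C t * (t * g t)) \<le> norm (real n * g t)"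
    proof (rule AE_I2)
      fix t
      have "\<bar>t\<bar> \<le> real n" if "t \<in> C"
        using subsetD[OF C(2) that] by (simp add: abs_le_iff)
      then show "norm (indicator C t * (t * g t)) \<le> norm (real n * g t)"
        by (simp add: indicator_def abs_mult mult_right_mono)
    qed
    show "(\<lambda>t. indicator C t * (t * g t)) \<in> borel_measurable (\<mu> y)" using C by measurable
  qed
  show "integrable (\<mu> y) (\<lambda>t. indicator {-real n..real n} t * (t * g t))" for n
    by (rule bint) auto
  fix C :: "real set" and n :: nat assume C: "C \<in> sets borel" "C \<subseteq> {-real n..real n}"
  have "(\<integral>t. indicator C t * (t * g t) \<partial>\<mu> y) = inner w (E C y)"
    by (rule inner_operator_projection[OF xw y C(1) g eq bint[OF C], symmetric])
  also have "\<bar>\<dots>\<bar> \<le> norm w * norm (E C y)" by (rule Cauchy_Schwarz_ineq2)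
  also have "\<dots> \<le> norm w * norm y" using E_contraction[OF C(1)] by (intro mult_left_mono) auto
  finally show "\<bar>\<integral>t. indicator C t * (t * g t) \<partial>\<mu> y\<bar> \<le> norm w * norm y" .
qed simp

end

context jacobi_parameters
begin

lemma p_measurable [measurable]: "(p k :: real \<Rightarrow> real) \<in> borel_measurable borel"
  by (intro borel_measurable_continuous_onI continuous_intros)

lemma p_Suc: "p (Suc k) t = (t * p k t - b k * p k t - (case k of 0 \<Rightarrow> 0 | Suc m \<Rightarrow> a m * p m t)) / a k" for t :: real
  using jac_p[of t k] a_nonzero[of k]
  by (cases k) (simp_all add: jac_def field_simps del: jpoly.simps)

lemma basis_operator:
  obtains w where "(ell2_basis k, w) \<in> max_graph"
    "w = a k *\<^sub>R ell2_basis (Suc k) + b k *\<^sub>R ell2_basis k + (case k of 0 \<Rightarrow> 0 | Suc m \<Rightarrow> a m *\<^sub>R ell2_basis m)"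
proof
  let ?w = "a k *\<^sub>R ell2_basis (Suc k) + b k *\<^sub>R ell2_basis k + (case k of 0 \<Rightarrow> 0 | Suc m \<Rightarrow> a m *\<^sub>R ell2_basis m)"
  show "(ell2_basis k, ?w) \<in> max_graph"
    by (auto simp: max_graph_def jac_def plus_ell2.rep_eq scaleR_ell2.rep_eq ell2_basis.rep_eq
        zero_ell2.rep_eq scaleR_conv_of_real split: nat.splits)
qed simp

lemma inner_basis: "inner (ell2_basis j) (ell2_basis k) = (if j = k then 1 else 0)"
  by (simp add: inner_ell2_def cinner_basis ell2_basis.rep_eq)

text \<open>By induction along the recurrence, the mixed measure of the \<open>k\<close>-th and the zeroth basis vector has
density \<open>p\<^sub>k\<close>; evaluated on the whole line this is the orthogonality of the basis.\<close>

lemma spectral_measure_p: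
  assumes self: "jacobi_operator a b = max_graph"
    and sym: "\<And>x w y z. (x, w) \<in> max_graph \<Longrightarrow> (y, z) \<in> max_graph \<Longrightarrow> cinner w y = cinner x z"
    and E: "spectral_measure_of (jacobi_operator a b) E"
  shows "prob_space (pvm_measure E (ell2_basis 0))" "sets (pvm_measure E (ell2_basis 0)) = sets borel"
    "integrable (pvm_measure E (ell2_basis 0)) (p k)"
    "(\<integral>t. p k t \<partial>pvm_measure E (ell2_basis 0)) = (if k = 0 then 1 else 0)"
proof -
  interpret spectral_measure E max_graph
    using E self sym max_graph_subspace by unfold_locales (auto simp: spectral_measure_of_def inner_ell2_def)
  let ?\<mu> = "\<mu> (ell2_basis 0)"
  interpret fin: finite_measure ?\<mu> by (rule finite_\<mu>)
  show "prob_space ?\<mu>"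
    by (rule prob_spaceI) (simp add: emeasure_\<mu> E_UNIV inner_basis)
  show "sets ?\<mu> = sets borel" by simp
  have dom: "ell2_basis k \<in> Domain max_graph" for k using basis_operator[of k] by blast
  define H where "H k \<longleftrightarrow> integrable ?\<mu> (p k) \<and>
     (\<forall>B\<in>sets borel. inner (E B (ell2_basis k)) (ell2_basis 0) = (\<integral>t. indicator B t * p k t \<partial>?\<mu>))" for k
  have "H k" for k
  proof (induction k rule: less_induct)
    case (less k)
    show ?case
    proof (cases k)
      case 0
      have "inner (E B (ell2_basis 0)) (ell2_basis 0) = (\<integral>t. indicator B t \<partial>?\<mu>)" if "B \<in> sets borel" for B
        using that by (simp add: measure_\<mu>)
      moreover have "(p 0 :: real \<Rightarrow> real) = (\<lambda>t. 1)" by (simp add: fun_eq_iff)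
      ultimately show ?thesis unfolding H_def 0 by simp
    next
      case (Suc j)
      obtain w where xw: "(ell2_basis j, w) \<in> max_graph"
        and w: "w = a j *\<^sub>R ell2_basis (Suc j) + b j *\<^sub>R ell2_basis j + (case j of 0 \<Rightarrow> 0 | Suc m \<Rightarrow> a m *\<^sub>R ell2_basis m)"
        by (rule basis_operator)
      have Hj: "H j" using less.IH[of j] Suc by simp
      then have pj: "integrable ?\<mu> (p j)"
        and ej: "\<And>B. B \<in> sets borel \<Longrightarrow> inner (E B (ell2_basis j)) (ell2_basis 0) = (\<integral>t. indicator B t * p j t \<partial>?\<mu>)"
        by (auto simp: H_def)
      have tp: "integrable ?\<mu> (\<lambda>t. t * p j t)"
        by (rule integrable_id_times[OF xw dom p_measurable pj ej])
      define q where "q t = (case j of 0 \<Rightarrow> 0 | Suc m \<Rightarrow> a m * p m t)" for t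
      have q: "integrable ?\<mu> q"
      proof (cases j)
        case (Suc m)
        have "H m" using less.IH[of m] Suc \<open>k = Suc j\<close> by simp
        then show ?thesis by (simp add: Suc q_def[abs_def] H_def)
      qed (simp add: q_def[abs_def])
      have rec: "p k t = (t * p j t - b j * p j t - q t) / a j" for t :: real
        unfolding Suc q_def by (rule p_Suc)
      have aj_p: "a j * p k t = t * p j t - b j * p j t - q t" for t :: real
        unfolding rec[of t] using a_nonzero[of j] by simp
      have "integrable ?\<mu> (\<lambda>t. (t * p j t - b j * p j t - q t) / a j)"
        using tp pj q by simp
      then have "integrable ?\<mu> (p k)" by (simp only: rec[symmetric])
      moreover have "inner (E B (ell2_basis k)) (ell2_basis 0) = (\<integral>t. indicator B t * p k t \<partial>?\<mu>)"
        if B: "B \<in> sets borel" for B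
      proof -
        have iB: "integrable ?\<mu> (\<lambda>t. indicator B t * f t)" if "integrable ?\<mu> f" for f :: "real \<Rightarrow> real"
          using integrable_mult_indicator[of B ?\<mu> f] that B by simp
        have qB: "inner (case j of 0 \<Rightarrow> 0 | Suc m \<Rightarrow> a m *\<^sub>R ell2_basis m) (E B (ell2_basis 0)) = (\<integral>t. indicator B t * q t \<partial>?\<mu>)"
        proof (cases j)
          case (Suc m)
          have "H m" using less.IH[of m] Suc \<open>k = Suc j\<close> by simp
          then have "inner (ell2_basis m) (E B (ell2_basis 0)) = (\<integral>t. indicator B t * p m t \<partial>?\<mu>)"
            using B by (simp add: H_def E_inner[symmetric])
          then show ?thesis by (simp add: Suc q_def[abs_def] mult.left_commute)
        qed (simp add: q_def[abs_def])
        define I :: "(real \<Rightarrow> real) \<Rightarrow> real" where "I f = (\<integral>t. indicator B t * f t \<partial>?\<mu>)" for f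
        have I_diff: "I (\<lambda>t. f t - g t) = I f - I g" if "integrable ?\<mu> f" "integrable ?\<mu> g" for f g
          unfolding I_def right_diff_distrib by (rule Bochner_Integration.integral_diff[OF iB iB]) (rule that)+
        have I_cmult: "I (\<lambda>t. c * f t) = c * I f" for c f
        proof -
          have "I (\<lambda>t. c * f t) = (\<integral>t. c * (indicator B t * f t) \<partial>?\<mu>)"
            unfolding I_def by (simp only: mult.left_commute)
          then show ?thesis by (simp only: I_def integral_mult_right_zero)
        qed
        have "inner w (E B (ell2_basis 0)) = I (\<lambda>t. t * p j t)"
          unfolding I_def by (rule inner_operator_projection[OF xw dom B p_measurable pj ej iB[OF tp]])
        moreover have "inner w (E B (ell2_basis 0)) = a j * inner (E B (ell2_basis k)) (ell2_basis 0) + b j * I (p j) + I q"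
        proof -
          have "inner (ell2_basis (Suc j)) (E B (ell2_basis 0)) = inner (E B (ell2_basis k)) (ell2_basis 0)"
            unfolding Suc by (rule E_inner[OF B, symmetric])
          moreover have "inner (ell2_basis j) (E B (ell2_basis 0)) = I (p j)"
            unfolding I_def ej[OF B, symmetric] by (rule E_inner[OF B, symmetric])
          ultimately show ?thesis unfolding w inner_add_left inner_scaleR_left qB I_def by (simp only:)
        qed
        moreover have "a j * I (p k) = I (\<lambda>t. t * p j t) - b j * I (p j) - I q"
        proof -
          have "a j * I (p k) = I (\<lambda>t. a j * p k t)" by (rule I_cmult[symmetric])
          also have "\<dots> = I (\<lambda>t. t * p j t - b j * p j t - q t)" by (simp only: aj_p)
          also have "\<dots> = I (\<lambda>t. t * p j t) - b j * I (p j) - I q"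
            using tp pj q by (simp only: I_diff I_cmult integrable_mult_right Bochner_Integration.integrable_diff)
          finally show ?thesis .
        qed
        ultimately have "a j * inner (E B (ell2_basis k)) (ell2_basis 0) = a j * I (p k)" by simp
        then show ?thesis using a_nonzero[of j] by (simp only: mult_cancel_left I_def) simp
      qed
      ultimately show ?thesis by (simp add: H_def)
    qed
  qed
  then have ik: "integrable ?\<mu> (p k)"
    and ek: "\<forall>B\<in>sets borel. inner (E B (ell2_basis k)) (ell2_basis 0) = (\<integral>t. indicator B t * p k t \<partial>?\<mu>)"
    unfolding H_def by blast+
  show "integrable ?\<mu> (p k)" by (rule ik)
  have "inner (E UNIV (ell2_basis k)) (ell2_basis 0) = (\<integral>t. indicator UNIV t * p k t \<partial>?\<mu>)"
    by (rule bspec[OF ek]) simp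
  then show "(\<integral>t. p k t \<partial>?\<mu>) = (if k = 0 then 1 else 0)"
    unfolding E_UNIV inner_basis by simp
qed

end

section \<open>From convergence of moments to convergence of integrals\<close>

text \<open>The variance is nonnegative.\<close>

lemma integral_square_le:
  assumes "prob_space M" and f: "integrable M f" and f2: "integrable M (\<lambda>x. (f x)\<^sup>2)"
  shows "\<bar>\<integral>x. f x \<partial>M\<bar> \<le> sqrt (\<integral>x. (f x)\<^sup>2 \<partial>M)"
proof -
  interpret prob_space M by fact
  have "0 \<le> variance f" by simp
  also have "\<dots> = expectation (\<lambda>x. (f x)\<^sup>2) - (expectation f)\<^sup>2"
    by (rule variance_eq[OF f f2])
  finally show ?thesis by (intro real_le_rsqrt) simp
qed

text \<open>The last assumption says that the complex polynomial \<open>Q + \<i> R\<close> approximates \<open>1/(t - \<i>)\<close>: the two squares are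
those of the real and imaginary part of \<open>(t - \<i>) (Q(t) + \<i> R(t)) - 1\<close>.\<close>

locale moment_convergence =
  fixes M :: "nat \<Rightarrow> real measure" and \<mu> :: "real measure"
  assumes prob: "prob_space \<mu>" "\<And>n. prob_space (M n)"
    and sets [measurable_cong]: "sets \<mu> = sets borel" "\<And>n. sets (M n) = sets borel"
    and poly_integrable: "\<And>P. integrable \<mu> (poly P)" "\<And>n P. integrable (M n) (poly P)"
    and moments_eventually: "\<And>P. \<forall>\<^sub>F n in sequentially. (\<integral>t. poly P t \<partial>M n) = (\<integral>t. poly P t \<partial>\<mu>)"
    and resolvent_approx: "\<And>e. e > 0 \<Longrightarrow> \<exists>Q R.
      (\<integral>t. (t * poly Q t + poly R t - 1)\<^sup>2 + (t * poly R t - poly Q t)\<^sup>2 \<partial>\<mu>) < e"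
begin

definition integral_below :: "real \<Rightarrow> (real \<Rightarrow> real) \<Rightarrow> bool" where
  "integral_below e g \<longleftrightarrow> (\<integral>t. g t \<partial>\<mu>) < e \<and> (\<forall>\<^sub>F n in sequentially. (\<integral>t. g t \<partial>M n) < e)"

definition bdd_borel :: "(real \<Rightarrow> real) \<Rightarrow> bool" where
  "bdd_borel f \<longleftrightarrow> f \<in> borel_measurable borel \<and> (\<exists>B. \<forall>t. \<bar>f t\<bar> \<le> B)"

text \<open>The point is that one polynomial serves for the limit measure and for all but finitely many
measures of the sequence.\<close>

definition poly_approximable :: "(real \<Rightarrow> real) \<Rightarrow> bool" where
  "poly_approximable f \<longleftrightarrow> bdd_borel f \<and> (\<forall>e>0. \<exists>Q. integral_below e (\<lambda>t. (f t - poly Q t)\<^sup>2))"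

definition all_measures :: "real measure set" where "all_measures = insert \<mu> (range M)"

lemma all_measures_prob: "N \<in> all_measures \<Longrightarrow> prob_space N"
  and all_measures_sets: "N \<in> all_measures \<Longrightarrow> sets N = sets borel"
  and all_measures_int: "N \<in> all_measures \<Longrightarrow> integrable N (poly P)"
  using prob sets poly_integrable by (auto simp: all_measures_def)

lemma poly_measurable [measurable]: "poly (P::real poly) \<in> borel_measurable borel"
  by (intro borel_measurable_continuous_onI continuous_intros)

lemma integral_below_mono:
  assumes "integral_below e f" and "e \<le> e'" and "\<And>t. 0 \<le> g t" "\<And>t. g t \<le> f t"
    and "\<And>N. N \<in> all_measures \<Longrightarrow> integrable N f" "g \<in> borel_measurable borel"
  shows "integral_below e' g"
proof -
  have norm_le: "norm (g t) \<le> norm (f t)" for t using assms(3)[of t] assms(4)[of t] by simp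
  have *: "(\<integral>t. g t \<partial>N) \<le> (\<integral>t. f t \<partial>N)" if N: "N \<in> all_measures" for N
  proof (rule integral_mono)
    show "integrable N f" using assms(5) N .
    have "g \<in> borel_measurable N" using assms(6) all_measures_sets[OF N] by (simp cong: measurable_cong_sets)
    then show "integrable N g"
      by (rule Bochner_Integration.integrable_bound[OF assms(5)[OF N]])
        (intro AE_I2 norm_le)
  qed (use assms(4) in auto)
  show ?thesis unfolding integral_below_def
  proof
    show "(\<integral>t. g t \<partial>\<mu>) < e'" using *[of \<mu>] assms(1,2) by (simp add: all_measures_def integral_below_def)
    show "\<forall>\<^sub>F n in sequentially. (\<integral>t. g t \<partial>M n) < e'"
    proof (rule eventually_mono)
      show "\<forall>\<^sub>F n in sequentially. (\<integral>t. f t \<partial>M n) < e" using assms(1) by (simp add: integral_below_def)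
      show "(\<integral>t. g t \<partial>M n) < e'" if "(\<integral>t. f t \<partial>M n) < e" for n
        using *[of "M n"] that assms(2) by (simp add: all_measures_def)
    qed
  qed
qed

lemma integral_below_add:
  assumes "integral_below d f" "integral_below e g"
    and "\<And>N. N \<in> all_measures \<Longrightarrow> integrable N f" "\<And>N. N \<in> all_measures \<Longrightarrow> integrable N g"
  shows "integral_below (d + e) (\<lambda>t. f t + g t)"
proof -
  have *: "(\<integral>t. f t + g t \<partial>N) = (\<integral>t. f t \<partial>N) + (\<integral>t. g t \<partial>N)" if "N \<in> all_measures" for N
    using assms that by simp
  show ?thesis unfolding integral_below_def
  proof
    show "(\<integral>t. f t + g t \<partial>\<mu>) < d + e" using *[of \<mu>] assms by (simp add: all_measures_def integral_below_def)
    have "\<forall>\<^sub>F n in sequentially. (\<integral>t. f t \<partial>M n) < d \<and> (\<integral>t. g t \<partial>M n) < e"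
      using assms unfolding integral_below_def by (intro eventually_conj) auto
    then show "\<forall>\<^sub>F n in sequentially. (\<integral>t. f t + g t \<partial>M n) < d + e"
      by eventually_elim (use * in \<open>simp add: all_measures_def\<close>)
  qed
qed

lemma integral_below_cmult:
  assumes "integral_below e f" "c > 0" shows "integral_below (c * e) (\<lambda>t. c * f t)"
  using assms by (simp add: integral_below_def)

lemma bdd_times_integrable:
  assumes "bdd_borel f" "N \<in> all_measures" "integrable N g" shows "integrable N (\<lambda>t. f t * g t)"
proof -
  obtain B where B: "\<And>t. \<bar>f t\<bar> \<le> B" using assms(1) by (auto simp: bdd_borel_def)
  have "f \<in> borel_measurable N"
    using assms(1) all_measures_sets[OF assms(2)] by (simp add: bdd_borel_def cong: measurable_cong_sets)
  show ?thesis
  proof (rule Bochner_Integration.integrable_bound)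
    show "integrable N (\<lambda>t. B * g t)" using assms(3) by simp
    show "AE t in N. norm (f t * g t) \<le> norm (B * g t)"
    proof (rule AE_I2)
      fix t
      have "\<bar>f t\<bar> \<le> \<bar>B\<bar>" using B[of t] by simp
      then show "norm (f t * g t) \<le> norm (B * g t)" by (simp add: abs_mult mult_right_mono)
    qed
  qed (use \<open>f \<in> borel_measurable N\<close> assms(3) in auto)
qed

lemma bdd_integrable: "bdd_borel f \<Longrightarrow> N \<in> all_measures \<Longrightarrow> integrable N f"
  using bdd_times_integrable[of f N "poly 1"] all_measures_int[of N 1] by simp

lemma bdd_borel_const: "bdd_borel (\<lambda>t. c)" by (auto simp: bdd_borel_def)

lemma bdd_borel_add:
  assumes "bdd_borel f" "bdd_borel g" shows "bdd_borel (\<lambda>t. f t + g t)"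
proof -
  obtain B C where "\<And>t. \<bar>f t\<bar> \<le> B" "\<And>t. \<bar>g t\<bar> \<le> C" using assms unfolding bdd_borel_def by blast
  then have "\<bar>f t + g t\<bar> \<le> B + C" for t
    using abs_triangle_ineq[of "f t" "g t"] add_mono order_trans by blast
  then show ?thesis using assms unfolding bdd_borel_def by (intro conjI borel_measurable_add exI[of _ "B + C"]) auto
qed

lemma bdd_borel_mult:
  assumes "bdd_borel f" "bdd_borel g" shows "bdd_borel (\<lambda>t. f t * g t)"
proof -
  obtain B C where B: "\<And>t. \<bar>f t\<bar> \<le> B" "\<And>t. \<bar>g t\<bar> \<le> C" using assms unfolding bdd_borel_def by blast
  have "\<bar>f t * g t\<bar> \<le> B * C" for t
    unfolding abs_mult using B order_trans[OF abs_ge_zero B(1)] by (intro mult_mono) auto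
  then show ?thesis using assms unfolding bdd_borel_def by (intro conjI borel_measurable_times exI[of _ "B * C"]) auto
qed

lemma diff_square_integrable:
  assumes "bdd_borel f" "N \<in> all_measures" shows "integrable N (\<lambda>t. (f t - poly Q t)\<^sup>2)"
proof -
  have "integrable N (\<lambda>t. f t * f t - 2 * (f t * poly Q t) + poly (Q * Q) t)"
    by (intro Bochner_Integration.integrable_add Bochner_Integration.integrable_diff
        integrable_mult_right bdd_times_integrable bdd_integrable all_measures_int assms)
  then show ?thesis by (simp add: power2_eq_square algebra_simps)
qed

lemma diff_square_measurable:
  assumes "bdd_borel f" shows "(\<lambda>t. (f t - poly Q t)\<^sup>2) \<in> borel_measurable borel"
proof -
  have [measurable]: "f \<in> borel_measurable borel" using assms by (simp add: bdd_borel_def)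
  show ?thesis by measurable
qed

lemma poly_approximableI:
  assumes "bdd_borel f" "\<And>e. e > 0 \<Longrightarrow> \<exists>Q. integral_below e (\<lambda>t. (f t - poly Q t)\<^sup>2)" shows "poly_approximable f"
  using assms by (simp add: poly_approximable_def)

lemma square_sum_le: "(x + y)\<^sup>2 \<le> 2 * x\<^sup>2 + 2 * (y::real)\<^sup>2"
  using sum_squares_bound[of x y] by (simp add: power2_sum)

lemma poly_approximable_add:
  assumes "poly_approximable f" "poly_approximable g" shows "poly_approximable (\<lambda>t. f t + g t)"
proof (rule poly_approximableI)
  have bf: "bdd_borel f" and bg: "bdd_borel g" using assms by (auto simp: poly_approximable_def)
  show b: "bdd_borel (\<lambda>t. f t + g t)" by (intro bdd_borel_add bf bg)
  fix e :: real assume "e > 0"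
  then have "e / 4 > 0" by simp
  then obtain Q R where Q: "integral_below (e / 4) (\<lambda>t. (f t - poly Q t)\<^sup>2)" and R: "integral_below (e / 4) (\<lambda>t. (g t - poly R t)\<^sup>2)"
    using assms unfolding poly_approximable_def by meson
  have "integral_below (2 * (e / 4) + 2 * (e / 4)) (\<lambda>t. 2 * (f t - poly Q t)\<^sup>2 + 2 * (g t - poly R t)\<^sup>2)"
    by (intro integral_below_add integral_below_cmult Q R integrable_mult_right diff_square_integrable bf bg) auto
  then have "integral_below e (\<lambda>t. (f t + g t - poly (Q + R) t)\<^sup>2)"
  proof (rule integral_below_mono)
    show "(f t + g t - poly (Q + R) t)\<^sup>2 \<le> 2 * (f t - poly Q t)\<^sup>2 + 2 * (g t - poly R t)\<^sup>2" for t
      using square_sum_le[of "f t - poly Q t" "g t - poly R t"] by (simp add: algebra_simps)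
    show "integrable N (\<lambda>t. 2 * (f t - poly Q t)\<^sup>2 + 2 * (g t - poly R t)\<^sup>2)" if "N \<in> all_measures" for N
      by (intro Bochner_Integration.integrable_add integrable_mult_right diff_square_integrable bf bg that)
  qed (auto intro: diff_square_measurable[OF b] simp del: poly_add)
  then show "\<exists>Q. integral_below e (\<lambda>t. (f t + g t - poly Q t)\<^sup>2)" by blast
qed

lemma poly_approximable_const: "poly_approximable (\<lambda>t. c)"
proof (rule poly_approximableI[OF bdd_borel_const])
  fix e :: real assume "e > 0"
  then have "integral_below e (\<lambda>t. (c - poly [:c:] t)\<^sup>2)" by (simp add: integral_below_def)
  then show "\<exists>Q. integral_below e (\<lambda>t. (c - poly Q t)\<^sup>2)" by blast
qed

lemma poly_approximable_cmult:
  assumes "poly_approximable f" shows "poly_approximable (\<lambda>t. c * f t)"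
proof (cases "c = 0")
  case False
  have bf: "bdd_borel f" using assms by (simp add: poly_approximable_def)
  show ?thesis
  proof (rule poly_approximableI)
    show "bdd_borel (\<lambda>t. c * f t)" by (intro bdd_borel_mult bdd_borel_const bf)
    fix e :: real assume "e > 0"
    then have "e / c\<^sup>2 > 0" using False by simp
    then obtain Q where "integral_below (e / c\<^sup>2) (\<lambda>t. (f t - poly Q t)\<^sup>2)" using assms unfolding poly_approximable_def by meson
    from integral_below_cmult[OF this, of "c\<^sup>2"] have "integral_below e (\<lambda>t. c\<^sup>2 * (f t - poly Q t)\<^sup>2)" using False by simp
    moreover have "c\<^sup>2 * (f t - poly Q t)\<^sup>2 = (c * f t - poly (Polynomial.smult c Q) t)\<^sup>2" for t
      by (simp add: power2_eq_square algebra_simps)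
    ultimately show "\<exists>Q. integral_below e (\<lambda>t. (c * f t - poly Q t)\<^sup>2)" by (intro exI[of _ "Polynomial.smult c Q"]) simp
  qed
qed (use poly_approximable_const[of 0] in simp)

text \<open>The imaginary and the real part of the resolvent function \<open>1/(t - \<i>)\<close> on the real line.\<close>

definition res_im :: "real \<Rightarrow> real" where "res_im t = 1 / (1 + t\<^sup>2)"
definition res_re :: "real \<Rightarrow> real" where "res_re t = t / (1 + t\<^sup>2)"

lemma one_plus_square: "1 + t\<^sup>2 \<noteq> (0::real)" "1 + t\<^sup>2 > (0::real)"
  using zero_le_power2[of t] by linarith+

lemma res_im_times: "res_im t * (1 + t\<^sup>2) = 1" and res_re_eq: "res_re t = t * res_im t"
  using one_plus_square[of t] by (auto simp: res_im_def res_re_def)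

lemma res_im_bounds: "0 \<le> res_im t" "res_im t \<le> 1" and res_re_bound: "\<bar>res_re t\<bar> \<le> 1"
proof -
  show "0 \<le> res_im t" "res_im t \<le> 1" using one_plus_square[of t] by (auto simp: res_im_def field_simps)
  have "2 * \<bar>t\<bar> \<le> 1 + t\<^sup>2" using sum_squares_bound[of "\<bar>t\<bar>" 1] by simp
  then have "\<bar>t\<bar> \<le> 1 + t\<^sup>2" by simp
  then show "\<bar>res_re t\<bar> \<le> 1" using one_plus_square[of t] by (simp add: res_re_def field_simps)
qed

lemma bdd_borel_rs: "bdd_borel res_im" "bdd_borel res_re"
proof -
  have "res_im \<in> borel_measurable borel" "res_re \<in> borel_measurable borel"
    unfolding res_im_def[abs_def] res_re_def[abs_def] by measurable
  then show "bdd_borel res_im" "bdd_borel res_re"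
    using res_im_bounds res_re_bound by (auto simp: bdd_borel_def intro!: exI[of _ 1])
qed

text \<open>The squared distance of \<open>Q + \<i> R\<close> from \<open>1/(t - \<i>)\<close> is \<open>|(t - \<i>)(Q + \<i> R) - 1|\<^sup>2 / (1 + t\<^sup>2)\<close>. The numerator is
a polynomial, so that a bound for its integral against \<open>\<mu>\<close> carries over to the sequence.\<close>

lemma poly_approximable_rs: "poly_approximable res_im" "poly_approximable res_re"
proof -
  have *: "\<exists>Q R. integral_below e (\<lambda>t. (res_re t - poly Q t)\<^sup>2) \<and> integral_below e (\<lambda>t. (res_im t - poly R t)\<^sup>2)" if e: "e > 0" for e
  proof -
    obtain Q R where QR: "(\<integral>t. (t * poly Q t + poly R t - 1)\<^sup>2 + (t * poly R t - poly Q t)\<^sup>2 \<partial>\<mu>) < e"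
      using resolvent_approx[OF e] by blast
    define P where "P = ([:0, 1:] * Q + R - 1) * ([:0, 1:] * Q + R - 1) + ([:0, 1:] * R - Q) * ([:0, 1:] * R - Q)"
    have P: "poly P t = (t * poly Q t + poly R t - 1)\<^sup>2 + (t * poly R t - poly Q t)\<^sup>2" for t
      by (simp add: P_def power2_eq_square)
    have nP: "integral_below e (poly P)"
    proof -
      have "poly P = (\<lambda>t. (t * poly Q t + poly R t - 1)\<^sup>2 + (t * poly R t - poly Q t)\<^sup>2)"
        by (rule ext) (rule P)
      with QR have "(\<integral>t. poly P t \<partial>\<mu>) < e" by simp
      then show ?thesis unfolding integral_below_def using moments_eventually[of P] by (auto elim: eventually_mono)
    qed
    have eq: "(res_re t - poly Q t)\<^sup>2 + (res_im t - poly R t)\<^sup>2 = res_im t * poly P t" for t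
    proof -
      have 1: "(t * poly Q t + poly R t - 1)\<^sup>2 + (t * poly R t - poly Q t)\<^sup>2 =
          (1 + t\<^sup>2) * (poly Q t)\<^sup>2 + (1 + t\<^sup>2) * (poly R t)\<^sup>2 + 1 - 2 * t * poly Q t - 2 * poly R t"
        by (simp add: power2_eq_square algebra_simps)
      have "res_im t * (1 + t\<^sup>2) = 1" "res_re t = t * res_im t" using one_plus_square[of t] by (auto simp: res_im_def res_re_def)
      moreover have "(res_re t)\<^sup>2 + (res_im t)\<^sup>2 = res_im t"
      proof -
        have "(res_re t)\<^sup>2 + (res_im t)\<^sup>2 = res_im t * (res_im t * (1 + t\<^sup>2))" 
          unfolding \<open>res_re t = t * res_im t\<close> by (simp add: power2_eq_square algebra_simps)
        then show ?thesis using \<open>res_im t * (1 + t\<^sup>2) = 1\<close> by simp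
      qed
      moreover have "res_im t * poly P t = (res_im t * (1 + t\<^sup>2)) * (poly Q t)\<^sup>2 + (res_im t * (1 + t\<^sup>2)) * (poly R t)\<^sup>2 + res_im t
         - 2 * (t * res_im t) * poly Q t - 2 * res_im t * poly R t"
        unfolding P 1 by (simp add: algebra_simps)
      ultimately show ?thesis by (simp add: power2_diff)
    qed
    have le: "res_im t * poly P t \<le> poly P t" for t
      using res_im_bounds[of t] by (intro mult_left_le_one_le) (auto simp: P)
    have "(res_re t - poly Q t)\<^sup>2 \<le> poly P t" "(res_im t - poly R t)\<^sup>2 \<le> poly P t" for t
      using eq[of t] le[of t] zero_le_power2[of "res_re t - poly Q t"] zero_le_power2[of "res_im t - poly R t"] by linarith+
    then have "integral_below e (\<lambda>t. (res_re t - poly Q t)\<^sup>2)" "integral_below e (\<lambda>t. (res_im t - poly R t)\<^sup>2)"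
      by (auto intro!: integral_below_mono[OF nP] all_measures_int diff_square_measurable bdd_borel_rs)
    then show ?thesis by blast
  qed
  show "poly_approximable res_im" "poly_approximable res_re" using * by (auto intro!: poly_approximableI bdd_borel_rs)
qed

lemma poly_div_one_plus_square: "\<exists>P \<alpha> \<beta>. \<forall>t. poly Q t = (1 + t\<^sup>2) * poly P t + \<alpha> + \<beta> * (t::real)"
proof (induction Q)
  case 0
  show ?case by (intro exI[of _ 0]) simp
next
  case (pCons c Q)
  then obtain P \<alpha> \<beta> where "\<And>t. poly Q t = (1 + t\<^sup>2) * poly P t + \<alpha> + \<beta> * t" by blast
  then have "poly (pCons c Q) t = (1 + t\<^sup>2) * poly (pCons \<beta> P) t + (c - \<beta>) + \<alpha> * t" for t
    by (simp add: algebra_simps power2_eq_square)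
  then show ?case by blast
qed

text \<open>Let \<open>|m| \<le> 1\<close>. If \<open>Q\<close> approximates \<open>f\<close>, then \<open>m Q\<close> approximates \<open>m f\<close>. It remains to approximate \<open>m Q\<close>, which is
unbounded in general; the assumption is that it differs from a polynomial by an approximable
function.\<close>

lemma poly_approximable_mult_of_poly:
  assumes m: "bdd_borel m" "\<And>t. \<bar>m t\<bar> \<le> 1"
    and poly: "\<And>Q. \<exists>P g. poly_approximable g \<and> (\<forall>t. m t * poly Q t = poly P t + g t)"
    and f: "poly_approximable f"
  shows "poly_approximable (\<lambda>t. m t * f t)"
proof (rule poly_approximableI)
  have bf: "bdd_borel f" using f by (simp add: poly_approximable_def)
  show b: "bdd_borel (\<lambda>t. m t * f t)" by (intro bdd_borel_mult m bf)
  fix e :: real assume "e > 0"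
  then have e4: "e / 4 > 0" by simp
  then obtain Q where Q: "integral_below (e / 4) (\<lambda>t. (f t - poly Q t)\<^sup>2)" using f unfolding poly_approximable_def by meson
  obtain P g where g: "poly_approximable g" "\<And>t. m t * poly Q t = poly P t + g t" using poly by blast
  then obtain R where R: "integral_below (e / 4) (\<lambda>t. (g t - poly R t)\<^sup>2)" using e4 unfolding poly_approximable_def by meson
  have bg: "bdd_borel g" using g by (simp add: poly_approximable_def)
  have "integral_below (2 * (e / 4) + 2 * (e / 4)) (\<lambda>t. 2 * (f t - poly Q t)\<^sup>2 + 2 * (g t - poly R t)\<^sup>2)"
    by (intro integral_below_add integral_below_cmult Q R integrable_mult_right diff_square_integrable bf bg) auto
  then have "integral_below e (\<lambda>t. (m t * f t - poly (P + R) t)\<^sup>2)"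
  proof (rule integral_below_mono)
    fix t
    have "m t * f t - poly (P + R) t = m t * (f t - poly Q t) + (g t - poly R t)"
      using g(2)[of t] by (simp add: algebra_simps)
    then have "(m t * f t - poly (P + R) t)\<^sup>2 \<le> 2 * (m t * (f t - poly Q t))\<^sup>2 + 2 * (g t - poly R t)\<^sup>2"
      using square_sum_le by metis
    moreover have "(m t * (f t - poly Q t))\<^sup>2 \<le> (f t - poly Q t)\<^sup>2"
      unfolding power_mult_distrib using m(2)[of t]
      by (intro mult_left_le_one_le) (auto simp: abs_square_le_1)
    ultimately show "(m t * f t - poly (P + R) t)\<^sup>2 \<le> 2 * (f t - poly Q t)\<^sup>2 + 2 * (g t - poly R t)\<^sup>2" by simp
  next
    show "integrable N (\<lambda>t. 2 * (f t - poly Q t)\<^sup>2 + 2 * (g t - poly R t)\<^sup>2)" if "N \<in> all_measures" for N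
      by (intro Bochner_Integration.integrable_add integrable_mult_right diff_square_integrable bf bg that)
  qed (auto intro: diff_square_measurable[OF b] simp del: poly_add)
  then show "\<exists>Q. integral_below e (\<lambda>t. (m t * f t - poly Q t)\<^sup>2)" by blast
qed

lemma poly_approximable_res_im_mult:
  assumes "poly_approximable f" shows "poly_approximable (\<lambda>t. res_im t * f t)"
proof (rule poly_approximable_mult_of_poly[OF bdd_borel_rs(1) _ _ assms])
  show "\<bar>res_im t\<bar> \<le> 1" for t using res_im_bounds[of t] by simp
  fix Q :: "real poly"
  obtain P \<alpha> \<beta> where Q: "\<And>t. poly Q t = (1 + t\<^sup>2) * poly P t + \<alpha> + \<beta> * t"
    using poly_div_one_plus_square by blast
  have "res_im t * poly Q t = poly P t + (\<alpha> * res_im t + \<beta> * res_re t)" for t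
  proof -
    have "res_im t * poly Q t = (res_im t * (1 + t\<^sup>2)) * poly P t + (\<alpha> * res_im t + \<beta> * (t * res_im t))"
      unfolding Q by (simp add: algebra_simps)
    then show ?thesis by (simp add: res_im_times res_re_eq)
  qed
  moreover have "poly_approximable (\<lambda>t. \<alpha> * res_im t + \<beta> * res_re t)" by (intro poly_approximable_add poly_approximable_cmult poly_approximable_rs)
  ultimately show "\<exists>P g. poly_approximable g \<and> (\<forall>t. res_im t * poly Q t = poly P t + g t)" by blast
qed

lemma poly_approximable_res_re_mult:
  assumes "poly_approximable f" shows "poly_approximable (\<lambda>t. res_re t * f t)"
proof (rule poly_approximable_mult_of_poly[OF bdd_borel_rs(2) res_re_bound _ assms])
  fix Q :: "real poly"
  obtain P \<alpha> \<beta> where Q: "\<And>t. poly Q t = (1 + t\<^sup>2) * poly P t + \<alpha> + \<beta> * t"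
    using poly_div_one_plus_square by blast
  have "res_re t * poly Q t = poly (pCons \<beta> P) t + (\<alpha> * res_re t + (- \<beta>) * res_im t)" for t
  proof -
    have "res_re t * poly Q t = (res_im t * (1 + t\<^sup>2)) * (t * poly P t) + \<alpha> * (t * res_im t) + \<beta> * (res_im t * (1 + t\<^sup>2)) - \<beta> * res_im t"
      unfolding Q res_re_eq by (simp add: algebra_simps power2_eq_square)
    then show ?thesis by (simp add: res_im_times res_re_eq)
  qed
  moreover have "poly_approximable (\<lambda>t. \<alpha> * res_re t + (- \<beta>) * res_im t)" by (intro poly_approximable_add poly_approximable_cmult poly_approximable_rs)
  ultimately show "\<exists>P g. poly_approximable g \<and> (\<forall>t. res_re t * poly Q t = poly P t + g t)" by blast
qed

text \<open>Stated for products with an arbitrary approximable \<open>f\<close>, because approximable functions are not visibly closed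
under products whereas multipliers are.\<close>

lemma poly_approximable_real_polynomial_function:
  fixes g :: "real \<times> real \<Rightarrow> real"
  assumes "real_polynomial_function g"
  shows "poly_approximable f \<Longrightarrow> poly_approximable (\<lambda>t. g (res_re t, res_im t) * f t)"
  using assms
proof (induction g arbitrary: f rule: real_polynomial_function.induct)
  case (linear g)
  note prems = linear.prems
  interpret bounded_linear g by (rule linear.hyps)
  have "g (res_re t, res_im t) = res_re t * g (1, 0) + res_im t * g (0, 1)" for t
  proof -
    have "(res_re t, res_im t) = res_re t *\<^sub>R (1, 0) + res_im t *\<^sub>R (0, 1)" by simp
    then show ?thesis by (simp only: add scaleR real_scaleR_def)
  qed
  then have "(\<lambda>t. g (res_re t, res_im t) * f t) = (\<lambda>t. g (1, 0) * (res_re t * f t) + g (0, 1) * (res_im t * f t))"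
    by (simp add: algebra_simps)
  then show ?case using prems by (auto intro!: poly_approximable_add poly_approximable_cmult poly_approximable_res_re_mult poly_approximable_res_im_mult)
next
  case (const c)
  then show ?case by (rule poly_approximable_cmult)
next
  case (add g h)
  then show ?case using poly_approximable_add[of "\<lambda>t. g (res_re t, res_im t) * f t" "\<lambda>t. h (res_re t, res_im t) * f t"]
    by (simp add: algebra_simps)
next
  case (mult g h)
  have "poly_approximable (\<lambda>t. g (res_re t, res_im t) * (h (res_re t, res_im t) * f t))"
    using mult.IH(2)[OF mult.prems] by (rule mult.IH(1))
  then show ?case by (simp add: mult.assoc)
qed

lemma poly_approximable_converges:
  assumes "poly_approximable f" shows "(\<lambda>n. \<integral>t. f t \<partial>M n) \<longlonglongrightarrow> (\<integral>t. f t \<partial>\<mu>)"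
proof (rule LIMSEQ_I)
  fix r :: real assume r: "0 < r"
  have bf: "bdd_borel f" using assms by (simp add: poly_approximable_def)
  have "(r / 2)\<^sup>2 > 0" using r by simp
  then obtain Q where Q: "integral_below ((r / 2)\<^sup>2) (\<lambda>t. (f t - poly Q t)\<^sup>2)" using assms unfolding poly_approximable_def by meson
  have close: "\<bar>(\<integral>t. f t \<partial>N) - (\<integral>t. poly Q t \<partial>N)\<bar> < r / 2"
    if N: "N \<in> all_measures" and lt: "(\<integral>t. (f t - poly Q t)\<^sup>2 \<partial>N) < (r / 2)\<^sup>2" for N
  proof -
    have "\<bar>\<integral>t. f t - poly Q t \<partial>N\<bar> \<le> sqrt (\<integral>t. (f t - poly Q t)\<^sup>2 \<partial>N)"
      by (intro integral_square_le all_measures_prob Bochner_Integration.integrable_diff bdd_integrable all_measures_int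
          diff_square_integrable bf N)
    also have "\<dots> < r / 2" using real_sqrt_less_mono[OF lt] r by simp
    finally show ?thesis using bdd_integrable[OF bf N] all_measures_int[OF N] by simp
  qed
  have "\<forall>\<^sub>F n in sequentially. (\<integral>t. (f t - poly Q t)\<^sup>2 \<partial>M n) < (r / 2)\<^sup>2 \<and>
      (\<integral>t. poly Q t \<partial>M n) = (\<integral>t. poly Q t \<partial>\<mu>)"
    using Q moments_eventually[of Q] unfolding integral_below_def by (intro eventually_conj) auto
  then have "\<forall>\<^sub>F n in sequentially. norm ((\<integral>t. f t \<partial>M n) - (\<integral>t. f t \<partial>\<mu>)) < r"
  proof eventually_elim
    case (elim n)
    have "\<bar>(\<integral>t. f t \<partial>M n) - (\<integral>t. poly Q t \<partial>\<mu>)\<bar> < r / 2"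
      using close[of "M n"] elim by (simp add: all_measures_def)
    moreover have "\<bar>(\<integral>t. f t \<partial>\<mu>) - (\<integral>t. poly Q t \<partial>\<mu>)\<bar> < r / 2"
      using close[of \<mu>] Q by (simp add: all_measures_def integral_below_def)
    ultimately show ?case unfolding real_norm_def by linarith
  qed
  then show "\<exists>no. \<forall>n\<ge>no. norm ((\<integral>t. f t \<partial>M n) - (\<integral>t. f t \<partial>\<mu>)) < r"
    by (simp add: eventually_sequentially)
qed

text \<open>The curve \<open>t \<mapsto> (t, 1) / (1 + t\<^sup>2)\<close> is a circle without the point \<open>0\<close>, and \<open>t\<close> is recovered as the quotient of the
coordinates. A function of compact support vanishes near the missing point, so that it extends to a
continuous function on the plane; \<open>k\<close> is a cut-off in the second coordinate.\<close>

lemma compact_support_factors: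
  assumes f: "continuous_on UNIV f" and C: "\<And>t. \<bar>t\<bar> > C \<Longrightarrow> f t = (0::real)" and C0: "C > 0"
  shows "\<exists>F :: real \<times> real \<Rightarrow> real. continuous_on UNIV F \<and> (\<forall>t. F (res_re t, res_im t) = f t)"
proof -
  define d where "d = 1 / (1 + C\<^sup>2)"
  have d: "d > 0" using one_plus_square[of C] by (simp add: d_def)
  \<comment> \<open>Equal to one where the point comes from \<open>|t| \<le> C\<close>, and to zero where the maximum below replaces the coordinate.\<close>
  define k where "k y = max 0 (min 1 (2 * y / d - 1))" for y :: real
  define F where "F = (\<lambda>(x, y). f (x / max y (d / 2)) * k y)"
  have cf: "continuous_on UNIV (\<lambda>z :: real \<times> real. f (fst z / max (snd z) (d / 2)))"
  proof (rule continuous_on_compose2[OF f])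
    show "continuous_on UNIV (\<lambda>z. fst z / max (snd z) (d / 2) :: real)"
      using d by (intro continuous_intros) auto
  qed auto
  have "continuous_on UNIV F"
    unfolding F_def case_prod_unfold k_def by (intro continuous_intros cf) (use d in auto)
  moreover have "F (res_re t, res_im t) = f t" for t
  proof (cases "res_im t \<ge> d / 2")
    case True
    have "res_re t / res_im t = t" using one_plus_square[of t] by (simp add: res_re_def res_im_def)
    then have eq: "F (res_re t, res_im t) = f t * k (res_im t)" by (simp add: F_def max_absorb1[OF True])
    show ?thesis
    proof (cases "\<bar>t\<bar> > C")
      case True
      then show ?thesis using C eq by simp
    next
      case False
      then have "t\<^sup>2 \<le> C\<^sup>2" using power_mono[of "\<bar>t\<bar>" C 2] by simp
      then have "res_im t \<ge> d" unfolding res_im_def d_def using one_plus_square[of t] by (intro divide_left_mono) auto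
      then have "k (res_im t) = 1" using d by (simp add: k_def field_simps)
      then show ?thesis using eq by simp
    qed
  next
    case False
    have "\<bar>t\<bar> > C"
    proof (rule ccontr)
      assume "\<not> \<bar>t\<bar> > C"
      then have "t\<^sup>2 \<le> C\<^sup>2" using power_mono[of "\<bar>t\<bar>" C 2] by simp
      then have "res_im t \<ge> d" unfolding res_im_def d_def using one_plus_square[of t] by (intro divide_left_mono) auto
      then show False using False d by simp
    qed
    moreover have "k (res_im t) = 0" using False d by (simp add: k_def field_simps)
    ultimately show ?thesis using C by (simp add: F_def)
  qed
  ultimately show ?thesis by blast
qed

text \<open>Stone-Weierstrass approximates the function uniformly by a polynomial in the two parts of the
resolvent function, whose integrals converge.\<close>

theorem compact_support_converges:
  assumes f: "continuous_on UNIV f" and C: "\<And>t. \<bar>t\<bar> > C \<Longrightarrow> f t = (0::real)"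
  shows "(\<lambda>n. \<integral>t. f t \<partial>M n) \<longlonglongrightarrow> (\<integral>t. f t \<partial>\<mu>)"
proof -
  have "\<exists>F :: real \<times> real \<Rightarrow> real. continuous_on UNIV F \<and> (\<forall>t. F (res_re t, res_im t) = f t)"
    by (rule compact_support_factors[OF f, of "max C 1"]) (use C in auto)
  then obtain F :: "real \<times> real \<Rightarrow> real" where F: "continuous_on UNIV F" "\<And>t. F (res_re t, res_im t) = f t"
    by blast
  have bf: "bdd_borel f"
  proof -
    have "compact (f ` {-C..C})" by (intro compact_continuous_image continuous_on_subset[OF f]) auto
    then obtain B where B: "\<And>t. t \<in> {-C..C} \<Longrightarrow> \<bar>f t\<bar> \<le> B" using compact_imp_bounded bounded_iff by (metis imageI real_norm_def)
    have "\<bar>f t\<bar> \<le> max B 0" for t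
    proof (cases "\<bar>t\<bar> > C")
      case False
      then have "t \<in> {-C..C}" by auto
      then have "\<bar>f t\<bar> \<le> B" by (rule B)
      then show ?thesis by simp
    qed (use C in simp)
    then show ?thesis unfolding bdd_borel_def using borel_measurable_continuous_onI[OF f] by blast
  qed
  show ?thesis
  proof (rule LIMSEQ_I)
    fix r :: real assume r: "0 < r"
    let ?S = "cball (0 :: real \<times> real) 2"
    have inS: "(res_re t, res_im t) \<in> ?S" for t
    proof -
      have "norm (res_re t, res_im t) \<le> norm (res_re t) + norm (res_im t)" by (rule norm_Pair_le)
      also have "\<dots> \<le> 2" using res_im_bounds[of t] res_re_bound[of t] by simp
      finally show ?thesis unfolding mem_cball_0 .
    qed
    obtain g where g: "real_polynomial_function g" "\<And>x. x \<in> ?S \<Longrightarrow> \<bar>F x - g x\<bar> < r / 3"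
      using Stone_Weierstrass_real_polynomial_function[of ?S F "r / 3"] r continuous_on_subset[OF F(1)]
      by auto
    define m where "m t = g (res_re t, res_im t)" for t
    have gm: "poly_approximable m"
      using poly_approximable_real_polynomial_function[OF g(1) poly_approximable_const[of 1]] by (simp add: m_def[abs_def])
    then have bm: "bdd_borel m" by (simp add: poly_approximable_def)
    have fm: "\<bar>f t - m t\<bar> \<le> r / 3" for t
      using g(2)[OF inS[of t]] F(2)[of t] by (simp add: m_def)
    have close: "\<bar>(\<integral>t. f t \<partial>N) - (\<integral>t. m t \<partial>N)\<bar> \<le> r / 3" if N: "N \<in> all_measures" for N
    proof -
      interpret prob_space N by (rule all_measures_prob[OF N])
      have "\<bar>\<integral>t. f t - m t \<partial>N\<bar> \<le> (\<integral>t. \<bar>f t - m t\<bar> \<partial>N)"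
        by (rule integral_abs_bound)
      also have "\<dots> \<le> (\<integral>t. r / 3 \<partial>N)"
        using fm by (intro integral_mono integrable_abs Bochner_Integration.integrable_diff bdd_integrable bdd_borel_const bf bm N) auto
      also have "\<dots> = r / 3" by (simp add: prob_space)
      finally show ?thesis using bdd_integrable[OF bf N] bdd_integrable[OF bm N] by simp
    qed
    obtain no where no: "\<And>n. n \<ge> no \<Longrightarrow> norm ((\<integral>t. m t \<partial>M n) - (\<integral>t. m t \<partial>\<mu>)) < r / 3"
      using LIMSEQ_D[OF poly_approximable_converges[OF gm], of "r / 3"] r by auto
    have "norm ((\<integral>t. f t \<partial>M n) - (\<integral>t. f t \<partial>\<mu>)) < r" if "n \<ge> no" for n
    proof -
      have "M n \<in> all_measures" "\<mu> \<in> all_measures" by (auto simp: all_measures_def)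
      from close[OF this(1)] close[OF this(2)] no[OF that] show ?thesis
        unfolding real_norm_def by linarith
    qed
    then show "\<exists>no. \<forall>n\<ge>no. norm ((\<integral>t. f t \<partial>M n) - (\<integral>t. f t \<partial>\<mu>)) < r" by blast
  qed
qed

end

section \<open>Vague convergence of the eigenvalue counting measures\<close>

lemma scale_measure_eq_density: "scale_measure c M = density M (\<lambda>_. c)"
  by (rule measure_eqI) (simp_all add: emeasure_density nn_integral_cmult)

lemma poly_1_fun: "poly (1 :: real poly) = (\<lambda>t. 1)" by (simp add: fun_eq_iff)

context jacobi_parameters
begin

text \<open>Pushed forward to the Borel sets of the line, the measurable space of the spectral measure.\<close>

definition gauss_measure :: "nat \<Rightarrow> real measure" where
  "gauss_measure n = distr (point_measure (nodes n) (\<lambda>y. ennreal (1 / K n y))) borel (\<lambda>y. y)"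

lemma K_pos: "K n x > 0" using K_ge_1[of n x] by linarith

lemma integral_gauss_measure:
  fixes f :: "real \<Rightarrow> real"
  assumes f: "f \<in> borel_measurable borel"
  shows "integrable (gauss_measure n) f" "(\<integral>y. f y \<partial>gauss_measure n) = (\<Sum>y\<in>nodes n. f y / K n y)"
proof -
  have m: "(\<lambda>y. y) \<in> measurable (point_measure (nodes n) (\<lambda>y. ennreal (1 / K n y))) borel" by simp
  have nn: "0 \<le> 1 / K n y" for y using K_pos[of n y] by simp
  have "integrable (point_measure (nodes n) (\<lambda>y. 1 / K n y)) f"
    by (rule integrable_point_measure_finite[OF nodes_finite])
  then show "integrable (gauss_measure n) f"
    unfolding gauss_measure_def by (simp add: integrable_distr_eq[OF m f])
  show "(\<integral>y. f y \<partial>gauss_measure n) = (\<Sum>y\<in>nodes n. f y / K n y)"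
    unfolding gauss_measure_def
    by (simp add: integral_distr[OF m f] lebesgue_integral_point_measure_finite[OF nodes_finite nn])
qed

lemma sets_gauss_measure: "sets (gauss_measure n) = sets borel"
  by (simp add: gauss_measure_def)

lemma gauss_mean_p: "k \<le> n \<Longrightarrow> (\<integral>y. p k y \<partial>gauss_measure n) = (if k = 0 then 1 else 0)"
  unfolding integral_gauss_measure(2)[OF p_measurable]
  using gauss_quadrature[of 0 n k] by (cases "k = 0") simp_all

lemma prob_gauss_measure: "prob_space (gauss_measure n)"
proof -
  interpret finite_measure "gauss_measure n"
    unfolding gauss_measure_def
    by (intro finite_measure.finite_measure_distr finite_measureI)
      (simp_all add: emeasure_point_measure_finite[OF nodes_finite] space_point_measure sum_ennreal[OF less_imp_le] K_pos)
  have "measure (gauss_measure n) (space (gauss_measure n)) = 1"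
    using gauss_mean_p[of 0 n] by simp
  then show ?thesis by (intro prob_spaceI) (simp add: emeasure_eq_measure)
qed

text \<open>Integrating \<open>t p\<^sub>i(t) p\<^sub>k(t)\<close> and expanding \<open>t p\<^sub>i\<close> or \<open>t p\<^sub>k\<close> by the recurrence expresses the Gram matrix in
row \<open>i + 1\<close> by the rows above it; row \<open>0\<close> is given, and the identity matrix obeys the same
recurrence.\<close>

lemma orthonormal_of_mean:
  assumes H: "\<And>k. has_bochner_integral N (p k) (if k = 0 then 1 else 0 :: real)"
  shows "has_bochner_integral N (\<lambda>t. p j t * p k t) (if j = k then 1 else 0 :: real)"
proof (induction j arbitrary: k rule: less_induct)
  case (less j)
  show ?case
  proof (cases j)
    case 0
    then show ?thesis using H[of k] by (cases "k = 0") (simp_all add: poly_1_fun)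
  next
    case (Suc i)
    have IH: "has_bochner_integral N (\<lambda>t. p l t * p k t) (if l = k then 1 else 0 :: real)" if "l \<le> i" for l k
      using less.IH[of l k] that Suc by simp
    \<comment> \<open>The contributions of the next lower index in the recurrence, which are absent at index \<open>0\<close>.\<close>
    define q where "q t = (case i of 0 \<Rightarrow> 0 | Suc m \<Rightarrow> a m * (p m t * p k t))" for t
    define q0 where "q0 = (case i of 0 \<Rightarrow> 0 | Suc m \<Rightarrow> a m * (if m = k then 1 else 0))"
    define r where "r t = (case k of 0 \<Rightarrow> 0 | Suc m \<Rightarrow> a m * (p i t * p m t))" for t
    define r0 where "r0 = (case k of 0 \<Rightarrow> 0 | Suc m \<Rightarrow> a m * (if i = m then 1 else 0))"
    have q: "has_bochner_integral N q q0"
    proof (cases i)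
      case (Suc m)
      then show ?thesis using has_bochner_integral_mult_right[OF IH[of m k], of "a m"]
        by (simp add: q_def[abs_def] q0_def)
    qed (simp add: q_def[abs_def] q0_def has_bochner_integral_zero)
    have r: "has_bochner_integral N r r0"
    proof (cases k)
      case (Suc m)
      then show ?thesis using has_bochner_integral_mult_right[OF IH[of i m], of "a m"]
        by (simp add: r_def[abs_def] r0_def)
    qed (simp add: r_def[abs_def] r0_def has_bochner_integral_zero)
    have "has_bochner_integral N
       (\<lambda>t. (1 / a i) * (a k * (p i t * p (Suc k) t) + b k * (p i t * p k t) + r t - b i * (p i t * p k t) - q t))
       ((1 / a i) * (a k * (if i = Suc k then 1 else 0) + b k * (if i = k then 1 else 0) + r0
          - b i * (if i = k then 1 else 0) - q0))"
      by (intro has_bochner_integral_mult_right has_bochner_integral_add has_bochner_integral_diff q r IH) simp_all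
    moreover have "(1 / a i) * (a k * (p i t * p (Suc k) t) + b k * (p i t * p k t) + r t - b i * (p i t * p k t) - q t)
       = p j t * p k t" for t :: real
    proof -
      have "t * p k t = a k * p (Suc k) t + b k * p k t + (case k of 0 \<Rightarrow> 0 | Suc m \<Rightarrow> a m * p m t)"
        using jac_p[of t k] by (cases k) (simp_all add: jac_def del: jpoly.simps)
      then have e1: "p i t * (t * p k t) = a k * (p i t * p (Suc k) t) + b k * (p i t * p k t) + r t"
        by (cases k) (simp_all add: r_def algebra_simps del: jpoly.simps)
      have aij: "a i * p j t = t * p i t - b i * p i t - (case i of 0 \<Rightarrow> 0 | Suc m \<Rightarrow> a m * p m t)"
        unfolding Suc p_Suc using a_nonzero[of i] by simp
      have e2: "a i * p j t * p k t = p i t * (t * p k t) - b i * (p i t * p k t) - q t"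
        unfolding aij by (cases i) (simp_all add: q_def algebra_simps del: jpoly.simps)
      have ai: "a i * (p j t * p k t) = a k * (p i t * p (Suc k) t) + b k * (p i t * p k t) + r t - b i * (p i t * p k t) - q t"
        using e2 unfolding e1 mult.assoc .
      show ?thesis unfolding ai[symmetric] using a_nonzero[of i] by simp
    qed
    moreover have "(1 / a i) * (a k * (if i = Suc k then 1 else 0) + b k * (if i = k then 1 else 0) + r0
          - b i * (if i = k then 1 else 0) - q0) = (if j = k then 1 else 0)"
      using a_nonzero[of i] by (auto simp: Suc r0_def q0_def split: nat.splits)
    ultimately show ?thesis by simp
  qed
qed

lemma integral_square_p_sum:
  assumes H: "\<And>k. has_bochner_integral N (p k) (if k = 0 then 1 else 0 :: real)"
  shows "has_bochner_integral N (\<lambda>t. (\<Sum>k\<le>n. c k * p k t)\<^sup>2) (\<Sum>k\<le>n. (c k)\<^sup>2 :: real)"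
proof -
  have "has_bochner_integral N (\<lambda>t. \<Sum>j\<le>n. \<Sum>k\<le>n. (c j * c k) * (p j t * p k t))
     (\<Sum>j\<le>n. \<Sum>k\<le>n. (c j * c k) * (if j = k then 1 else 0))"
    by (intro has_bochner_integral_sum has_bochner_integral_mult_right orthonormal_of_mean H)
  moreover have "(\<Sum>j\<le>n. \<Sum>k\<le>n. (c j * c k) * (if j = k then 1 else 0)) = (\<Sum>k\<le>n. (c k)\<^sup>2)"
    by (simp add: power2_eq_square if_distrib cong: if_cong)
  moreover have "(\<Sum>j\<le>n. \<Sum>k\<le>n. (c j * c k) * (p j t * p k t)) = (\<Sum>k\<le>n. c k * p k t)\<^sup>2" for t
    by (simp add: power2_eq_square sum_product ac_simps)
  ultimately show ?thesis by simp
qed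

lemma poly_times_p_step:
  "poly (pCons c P) t * p k t = c * p k t + a k * (poly P t * p (Suc k) t) + b k * (poly P t * p k t)
     + (case k of 0 \<Rightarrow> 0 | Suc m \<Rightarrow> a m * (poly P t * p m t))" for t :: real
proof -
  have "t * p k t = a k * p (Suc k) t + b k * p k t + (case k of 0 \<Rightarrow> 0 | Suc m \<Rightarrow> a m * p m t)"
    using jac_p[of t k] by (cases k) (simp_all add: jac_def del: jpoly.simps)
  moreover have "poly (pCons c P) t * p k t = c * p k t + poly P t * (t * p k t)"
    by (simp add: algebra_simps)
  ultimately show ?thesis by (cases k) (simp_all add: algebra_simps del: jpoly.simps)
qed

lemma integrable_poly_times_p:
  assumes "\<And>k. integrable N (p k :: real \<Rightarrow> real)"
  shows "integrable N (\<lambda>t. poly P t * p k t)"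
proof (induction P arbitrary: k)
  case (pCons c P)
  have "integrable N (\<lambda>t. case k of 0 \<Rightarrow> 0 | Suc m \<Rightarrow> a m * (poly P t * p m t))"
    using pCons.IH by (cases k) auto
  then show ?case unfolding poly_times_p_step
    by (intro Bochner_Integration.integrable_add integrable_mult_right pCons.IH assms)
qed simp

lemma integral_poly_times_p_step:
  assumes "\<And>k. integrable N (p k :: real \<Rightarrow> real)"
  shows "(\<integral>t. poly (pCons c P) t * p k t \<partial>N) = c * (\<integral>t. p k t \<partial>N) + a k * (\<integral>t. poly P t * p (Suc k) t \<partial>N)
     + b k * (\<integral>t. poly P t * p k t \<partial>N) + (case k of 0 \<Rightarrow> 0 | Suc m \<Rightarrow> a m * (\<integral>t. poly P t * p m t \<partial>N))"
proof -
  note i = integrable_poly_times_p[OF assms] assms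
  show ?thesis
  proof (cases k)
    case 0
    show ?thesis unfolding poly_times_p_step unfolding 0 using i(1)[of P 0] i(1)[of P "Suc 0"] i(2)[of 0]
      by (simp del: jpoly.simps)
  next
    case (Suc m)
    show ?thesis unfolding poly_times_p_step unfolding Suc using i(1)[of P k] i(1)[of P "Suc k"] i(1)[of P m] i(2)[of k]
      by (simp add: Suc del: jpoly.simps)
  qed
qed

text \<open>Horner induction on the polynomial: multiplication by \<open>t\<close> is absorbed into the factor \<open>p\<^sub>k\<close> by the
recurrence, which is why that factor is carried along.\<close>

lemma eventually_moments_equal:
  assumes \<mu>: "\<And>k. integrable \<mu> (p k :: real \<Rightarrow> real)" "\<And>k. (\<integral>t. p k t \<partial>\<mu>) = (if k = 0 then 1 else 0 :: real)"
  shows "\<forall>\<^sub>F n in sequentially. (\<integral>t. poly P t * p k t \<partial>gauss_measure n) = (\<integral>t. poly P t * p k t \<partial>\<mu>)"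
proof (induction P arbitrary: k)
  case (pCons c P)
  have g: "integrable (gauss_measure n) (p k :: real \<Rightarrow> real)" for n k
    by (rule integral_gauss_measure(1)) simp
  have 1: "\<forall>\<^sub>F n in sequentially. (\<integral>t. p k t \<partial>gauss_measure n) = (\<integral>t. p k t \<partial>\<mu>)"
    using gauss_mean_p \<mu>(2) by (intro eventually_sequentiallyI[of k]) simp
  have 2: "\<forall>\<^sub>F n in sequentially. (case k of 0 \<Rightarrow> 0 | Suc m \<Rightarrow> a m * (\<integral>t. poly P t * p m t \<partial>gauss_measure n)) =
      (case k of 0 \<Rightarrow> 0 | Suc m \<Rightarrow> a m * (\<integral>t. poly P t * p m t \<partial>\<mu>))"
    by (cases k) (auto intro: eventually_mono[OF pCons.IH])
  show ?case
    using 1 2 pCons.IH[of k] pCons.IH[of "Suc k"]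
    unfolding integral_poly_times_p_step[OF \<mu>(1)] integral_poly_times_p_step[OF g]
    by eventually_elim simp
qed simp

text \<open>Expand \<open>Q\<close> and \<open>R\<close> in the orthonormal polynomials with the real and imaginary parts of a finite vector
\<open>v\<close> as coefficients. Multiplication by \<open>t\<close> becomes the action of the matrix, so that the
coefficients of \<open>(t - \<i>)(Q + \<i> R) - 1\<close> are those of \<open>(J - \<i>)v - e\<^sub>0\<close>, and Parseval's identity gives the
integral.\<close>

lemma moment_convergence_gauss:
  assumes K: "filterlim (\<lambda>n. K n t) at_top sequentially"
    and prob: "prob_space \<mu>" and sets: "sets \<mu> = sets borel"
    and \<mu>: "\<And>k. integrable \<mu> (p k :: real \<Rightarrow> real)" "\<And>k. (\<integral>t. p k t \<partial>\<mu>) = (if k = 0 then 1 else 0 :: real)"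
  shows "moment_convergence gauss_measure \<mu>"
proof (rule moment_convergence.intro)
  show "prob_space \<mu>" "sets \<mu> = sets borel" by (fact prob, fact sets)
  show "prob_space (gauss_measure n)" "sets (gauss_measure n) = sets borel" for n
    by (rule prob_gauss_measure, rule sets_gauss_measure)
  show "integrable \<mu> (poly P)" for P using integrable_poly_times_p[OF \<mu>(1), of P 0] by simp
  show "integrable (gauss_measure n) (poly P)" for n P
    by (intro integral_gauss_measure borel_measurable_continuous_onI continuous_intros)
  show "\<forall>\<^sub>F n in sequentially. (\<integral>t. poly P t \<partial>gauss_measure n) = (\<integral>t. poly P t \<partial>\<mu>)" for P
    using eventually_moments_equal[OF \<mu>, of P 0] by simp
  have H: "has_bochner_integral \<mu> (p k) (if k = 0 then 1 else 0 :: real)" for k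
    using \<mu>(1)[of k] \<mu>(2)[of k] by (simp add: has_bochner_integral_iff)
  fix e :: real assume e: "e > 0"
  obtain v :: "nat \<Rightarrow> complex" and N where N: "\<forall>k>N. v k = 0"
    and lt: "(\<Sum>k\<le>Suc N. (cmod (J v k - \<i> * v k - (if k = 0 then 1 else 0)))\<^sup>2) < e"
    using resolvent_approximation[OF K e] by blast
  define x where "x k = Re (v k)" for k
  define y where "y k = Im (v k)" for k
  define Q where "Q = (\<Sum>k\<le>Suc N. Polynomial.smult (x k) (jpoly a b k))"
  define R where "R = (\<Sum>k\<le>Suc N. Polynomial.smult (y k) (jpoly a b k))"
  define c where "c k = J x k + y k - (if k = 0 then 1 else 0)" for k
  define d where "d k = J y k - x k" for k
  have Q: "poly Q t = (\<Sum>k\<le>Suc N. x k * p k t)" and R: "poly R t = (\<Sum>k\<le>Suc N. y k * p k t)" for t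
    by (simp_all only: Q_def R_def poly_sum poly_smult)
  have shift: "(\<Sum>k\<le>Suc N. J u k * p k t) = t * (\<Sum>k\<le>Suc N. u k * p k t)" if "\<And>k. k > N \<Longrightarrow> u k = 0" for u :: "nat \<Rightarrow> real" and t
  proof -
    have "(\<Sum>k\<le>Suc N. J u k * p k t - u k * J (\<lambda>k. p k t) k) = 0"
      unfolding green_formula using that by simp
    then have "(\<Sum>k\<le>Suc N. J u k * p k t) = (\<Sum>k\<le>Suc N. u k * J (\<lambda>k. p k t) k)"
      by (simp only: sum_subtractf right_minus_eq)
    also have "\<dots> = (\<Sum>k\<le>Suc N. t * (u k * p k t))"
      by (intro sum.cong refl) (simp only: jac_p mult.left_commute)
    finally show ?thesis by (simp only: sum_distrib_left)
  qed
  have delta: "(\<Sum>k\<le>Suc N. (if k = 0 then 1 else 0) * p k t) = 1" for t :: real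
    by (simp only: sum.atMost_Suc_shift) simp
  have ct: "t * poly Q t + poly R t - 1 = (\<Sum>k\<le>Suc N. c k * p k t)" for t
  proof -
    have "(\<Sum>k\<le>Suc N. c k * p k t) = (\<Sum>k\<le>Suc N. J x k * p k t) + (\<Sum>k\<le>Suc N. y k * p k t)
        - (\<Sum>k\<le>Suc N. (if k = 0 then 1 else 0) * p k t)"
      by (simp only: c_def left_diff_distrib distrib_right sum_subtractf sum.distrib)
    then show ?thesis unfolding Q R delta using shift[of x t] N by (simp only: x_def) simp
  qed
  have dt: "t * poly R t - poly Q t = (\<Sum>k\<le>Suc N. d k * p k t)" for t
  proof -
    have "(\<Sum>k\<le>Suc N. d k * p k t) = (\<Sum>k\<le>Suc N. J y k * p k t) - (\<Sum>k\<le>Suc N. x k * p k t)"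
      by (simp only: d_def left_diff_distrib sum_subtractf)
    then show ?thesis unfolding Q R using shift[of y t] N by (simp only: y_def) simp
  qed
  have "has_bochner_integral \<mu> (\<lambda>t. (t * poly Q t + poly R t - 1)\<^sup>2 + (t * poly R t - poly Q t)\<^sup>2)
      ((\<Sum>k\<le>Suc N. (c k)\<^sup>2) + (\<Sum>k\<le>Suc N. (d k)\<^sup>2))"
    unfolding ct dt by (intro has_bochner_integral_add integral_square_p_sum H)
  then have "(\<integral>t. (t * poly Q t + poly R t - 1)\<^sup>2 + (t * poly R t - poly Q t)\<^sup>2 \<partial>\<mu>) =
      (\<Sum>k\<le>Suc N. (c k)\<^sup>2) + (\<Sum>k\<le>Suc N. (d k)\<^sup>2)" by (rule has_bochner_integral_integral_eq)
  also have "\<dots> = (\<Sum>k\<le>Suc N. (cmod (J v k - \<i> * v k - (if k = 0 then 1 else 0)))\<^sup>2)"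
  proof -
    have "(c k)\<^sup>2 + (d k)\<^sup>2 = (cmod (J v k - \<i> * v k - (if k = 0 then 1 else 0)))\<^sup>2" for k
    proof -
      have "Re (J v k) = J x k" "Im (J v k) = J y k"
        by (cases k; simp add: jac_def x_def y_def)+
      then show ?thesis unfolding cmod_power2 by (simp add: c_def d_def x_def y_def)
    qed
    then show ?thesis by (simp only: sum.distrib[symmetric])
  qed
  also note lt
  finally show "\<exists>Q R. (\<integral>t. (t * poly Q t + poly R t - 1)\<^sup>2 + (t * poly R t - poly Q t)\<^sup>2 \<partial>\<mu>) < e" by blast
qed

lemma integral_eigenvalue_measure:
  fixes f :: "real \<Rightarrow> real"
  assumes U: "open U" and f: "f \<in> borel_measurable borel" "\<And>x. x \<notin> U \<Longrightarrow> f x = 0" and c: "c > 0"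
  shows "(\<integral>x. f x \<partial>scale_measure (ennreal c) (restrict_measure (eigenvalue_measure a b n) U)) =
    c * (\<Sum>y\<in>nodes n. f y)"
proof -
  have [measurable]: "U \<in> sets borel" using U by simp
  note [measurable] = f(1)
  have sets [measurable_cong]: "sets (eigenvalue_measure a b n) = sets borel" by (simp add: eigenvalue_measure_def)
  have "(\<integral>x. f x \<partial>scale_measure (ennreal c) (restrict_measure (eigenvalue_measure a b n) U)) =
      c * (\<integral>x. f x \<partial>restrict_measure (eigenvalue_measure a b n) U)"
    unfolding scale_measure_eq_density
    by (subst integral_density) (use c in \<open>auto simp: restrict_measure_def\<close>)
  also have "(\<integral>x. f x \<partial>restrict_measure (eigenvalue_measure a b n) U) = (\<integral>x. f x \<partial>eigenvalue_measure a b n)"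
  proof -
    have "restrict_measure (eigenvalue_measure a b n) U = density (eigenvalue_measure a b n) (\<lambda>x. ennreal (indicator U x))"
      by (simp add: restrict_measure_def ennreal_indicator)
    then have "(\<integral>x. f x \<partial>restrict_measure (eigenvalue_measure a b n) U) = (\<integral>x. indicator U x *\<^sub>R f x \<partial>eigenvalue_measure a b n)"
      by (simp add: integral_density)
    also have "(\<lambda>x. indicator U x *\<^sub>R f x) = f" using f(2) by (auto simp: fun_eq_iff indicator_def)
    finally show ?thesis .
  qed
  also have "\<dots> = (\<integral>x. f x \<partial>count_space (nodes n))"
    unfolding eigenvalue_measure_def spectrum_trunc by (rule integral_distr) (use f in auto)
  also have "\<dots> = (\<Sum>y\<in>nodes n. f y)" by (rule lebesgue_integral_count_space_finite[OF nodes_finite])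
  finally show ?thesis .
qed

end

lemma uniform_limit_compact_of_local:
  assumes lim: "locally_uniform_limit U f g" and C: "compact C" "C \<subseteq> U"
  shows "uniform_limit C f g sequentially"
proof (rule uniform_limitI)
  fix e :: real assume e: "e > 0"
  have "\<forall>x\<in>C. \<exists>V. open V \<and> x \<in> V \<and> uniform_limit V f g sequentially"
    using lim C(2) unfolding locally_uniform_limit_def by blast
  then obtain V where V: "\<And>x. x \<in> C \<Longrightarrow> open (V x)" "\<And>x. x \<in> C \<Longrightarrow> x \<in> V x"
    "\<And>x. x \<in> C \<Longrightarrow> uniform_limit (V x) f g sequentially" by metis
  obtain D where D: "D \<subseteq> C" "finite D" "C \<subseteq> (\<Union>x\<in>D. V x)"
    using compactE_image[OF C(1), of C V] V(1,2) by blast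
  have "\<forall>\<^sub>F n in sequentially. \<forall>x\<in>D. \<forall>y\<in>V x. dist (f n y) (g y) < e"
    using D V(3) e by (intro eventually_ball_finite) (auto simp: uniform_limit_iff)
  then show "\<forall>\<^sub>F n in sequentially. \<forall>y\<in>C. dist (f n y) (g y) < e"
    by eventually_elim (use D(3) in blast)
qed

lemma continuous_on_locally_uniform_limit:
  assumes lim: "locally_uniform_limit U f g" and cont: "\<And>n. continuous_on UNIV (f n)"
  shows "continuous_on U g"
proof (rule continuous_at_imp_continuous_on, rule ballI)
  fix x assume "x \<in> U"
  then obtain V where V: "open V" "x \<in> V" "uniform_limit V f g sequentially"
    using lim unfolding locally_uniform_limit_def by blast
  have "continuous_on V g"
    by (rule uniform_limit_theorem[OF always_eventually V(3)])
      (auto intro: continuous_on_subset[OF cont])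
  then show "isCont g x" using V(1,2) by (simp add: continuous_on_eq_continuous_at)
qed

theorem theorem5:
  fixes a b \<rho> :: "nat \<Rightarrow> real" and U :: "real set" and h :: "real \<Rightarrow> real"
  assumes a_pos: "\<And>n. a n > 0"
    and rho_pos: "\<And>n. \<rho> n > 0"
    and rho_lim: "filterlim \<rho> at_top sequentially"
    and U_open: "open U"
    and h_nonneg: "\<And>x. x \<in> U \<Longrightarrow> h x \<ge> 0"
    and h_nonzero: "\<exists>x\<in>U. h x \<noteq> 0"
    and K_lim: "locally_uniform_limit U
      (\<lambda>n x. 1 / complex_of_real (\<rho> n) * CD_kernel a b n (complex_of_real x) (complex_of_real x))
      (\<lambda>x. complex_of_real (h x))"
  shows "self_adjoint (jacobi_operator a b) \<and>
    (\<forall>E \<mu>. spectral_measure_of (jacobi_operator a b) E \<longrightarrow> \<mu> = pvm_measure E (ell2_basis 0) \<longrightarrow>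
      vaguely_converges_on U
        (\<lambda>n. scale_measure (ennreal (1 / \<rho> n)) (restrict_measure (eigenvalue_measure a b n) U))
        (density \<mu> (\<lambda>x. ennreal (indicator U x * h x))))"
proof -
  interpret jacobi_parameters a b by unfold_locales (rule a_pos)
  have K_eq: "1 / complex_of_real (\<rho> n) * CD_kernel a b n (complex_of_real x) (complex_of_real x) =
      complex_of_real (K n x / \<rho> n)" for n x by (simp add: CD_kernel_eq)
  note lim = K_lim[unfolded K_eq]
  have unif: "uniform_limit C (\<lambda>n x. K n x / \<rho> n) h sequentially" if "compact C" "C \<subseteq> U" for C
    using uniform_limit_compact_of_local[OF lim that] by (simp add: uniform_limit_iff dist_of_real del: of_real_divide)
  have "continuous_on U (\<lambda>x. complex_of_real (h x))"
    by (rule continuous_on_locally_uniform_limit[OF lim])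
      (use rho_pos in \<open>auto simp: K_def less_imp_neq[THEN not_sym] intro!: continuous_intros\<close>)
  from continuous_on_Re[OF this] have h_cont: "continuous_on U h" by simp
  obtain x0 where x0: "x0 \<in> U" "h x0 > 0" using h_nonzero h_nonneg by force
  have "(\<lambda>n. K n x0 / \<rho> n) \<longlonglongrightarrow> h x0"
    by (rule tendsto_uniform_limitI[OF unif[of "{x0}"]]) (use x0 in auto)
  from filterlim_tendsto_pos_mult_at_top[OF this x0(2) rho_lim]
  have K_inf: "filterlim (\<lambda>n. K n x0) at_top sequentially"
    using rho_pos by (simp add: less_imp_neq[THEN not_sym])
  note max = jacobi_operator_eq_max_graph[OF K_inf]
  have sa: "self_adjoint (jacobi_operator a b)" by (rule self_adjoint_jacobi[OF K_inf])
  have "(\<lambda>n. \<integral>x. f x \<partial>scale_measure (ennreal (1 / \<rho> n)) (restrict_measure (eigenvalue_measure a b n) U))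
       \<longlonglongrightarrow> (\<integral>x. f x \<partial>density \<mu> (\<lambda>x. ennreal (indicator U x * h x)))"
    if E: "spectral_measure_of (jacobi_operator a b) E" and \<mu>: "\<mu> = pvm_measure E (ell2_basis 0)"
      and f: "continuous_on UNIV f" and C: "compact C" "C \<subseteq> U" "\<And>x. x \<notin> C \<Longrightarrow> f x = 0"
    for E \<mu> C and f :: "real \<Rightarrow> real"
  proof -
    note sp = spectral_measure_p[OF max max_graph_symmetric[OF K_inf] E, folded \<mu>]
    interpret moment_convergence gauss_measure \<mu>
      by (rule moment_convergence_gauss[OF K_inf sp])
    \<comment> \<open>The limit integrand, extended by zero; it is continuous on \<open>U\<close> and vanishes on the open complement of \<open>C\<close>.\<close>
    define F where "F x = indicator U x * h x * f x" for x
    have [measurable]: "f \<in> borel_measurable borel" by (rule borel_measurable_continuous_onI[OF f])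
    have hm [measurable]: "(\<lambda>x. indicator U x * h x) \<in> borel_measurable borel"
      using borel_measurable_continuous_on_indicator[OF _ h_cont] U_open by simp
    have F_cont: "continuous_on UNIV F"
    proof -
      have "continuous_on (U \<union> - C) F"
      proof (rule continuous_on_open_Un)
        show "open U" "open (- C)" using U_open compact_imp_closed[OF C(1)] by auto
        have "continuous_on U (\<lambda>x. h x * f x)"
          by (intro continuous_intros h_cont continuous_on_subset[OF f]) auto
        then show "continuous_on U F" by (rule continuous_on_eq) (simp add: F_def)
        show "continuous_on (- C) F"
          by (rule continuous_on_eq[of _ "\<lambda>_. 0"]) (use C(3) in \<open>auto simp: F_def\<close>)
      qed
      moreover have "U \<union> - C = UNIV" using C(2) by auto
      ultimately show ?thesis by simp
    qed
    obtain c where c: "\<And>x. x \<in> C \<Longrightarrow> \<bar>x\<bar> \<le> c" using compact_imp_bounded[OF C(1)] by (auto simp: bounded_iff)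
    have "F t = 0" if "\<bar>t\<bar> > c" for t using c[of t] C(3)[of t] that by (force simp: F_def)
    then have F_lim: "(\<lambda>n. \<integral>t. F t \<partial>gauss_measure n) \<longlonglongrightarrow> (\<integral>t. F t \<partial>\<mu>)"
      by (rule compact_support_converges[OF F_cont])
    obtain B where B: "\<And>x. \<bar>f x\<bar> \<le> B" "B > 0"
    proof -
      have "bounded (f ` C)" by (intro compact_imp_bounded compact_continuous_image C continuous_on_subset[OF f]) auto
      then obtain B where "\<And>x. x \<in> C \<Longrightarrow> \<bar>f x\<bar> \<le> B" by (auto simp: bounded_iff)
      then have "\<bar>f x\<bar> \<le> max B 1" for x using C(3)[of x] by (cases "x \<in> C") force+
      then show ?thesis using that[of "max B 1"] by simp
    qed
    define A where "A n = (1 / \<rho> n) * (\<Sum>y\<in>nodes n. f y)" for n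
    have A_eq: "(\<integral>x. f x \<partial>scale_measure (ennreal (1 / \<rho> n)) (restrict_measure (eigenvalue_measure a b n) U)) = A n" for n
      unfolding A_def using C(2,3) rho_pos[of n] by (intro integral_eigenvalue_measure U_open) auto
    \<comment> \<open>Each node \<open>y\<close> carries the quadrature weight \<open>1 / K n y\<close>, so that \<open>A n\<close> is the quadrature of \<open>f K n / \<rho> n\<close>.\<close>
    have diff: "(\<lambda>n. A n - (\<integral>t. F t \<partial>gauss_measure n)) \<longlonglongrightarrow> 0"
    proof (rule LIMSEQ_I)
      fix r :: real assume r: "0 < r"
      have "r / (2 * B) > 0" using r B(2) by simp
      then have "\<forall>\<^sub>F n in sequentially. \<forall>x\<in>C. dist (K n x / \<rho> n) (h x) < r / (2 * B)"
        using unif[OF C(1,2)] unfolding uniform_limit_iff by blast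
      then have "\<forall>\<^sub>F n in sequentially. norm (A n - (\<integral>t. F t \<partial>gauss_measure n) - 0) < r"
      proof eventually_elim
        case (elim n)
        have summand_le: "\<bar>f y / \<rho> n - F y / K n y\<bar> \<le> (r / 2) / K n y" for y
        proof (cases "y \<in> C")
          case True
          then have "f y / \<rho> n - F y / K n y = f y * (K n y / \<rho> n - h y) / K n y"
            using C(2) K_pos[of n y] rho_pos[of n] by (auto simp: F_def field_simps)
          also have "\<bar>\<dots>\<bar> = \<bar>f y\<bar> * \<bar>K n y / \<rho> n - h y\<bar> / K n y" using K_pos[of n y] by (simp add: abs_mult)
          also have "\<dots> \<le> (B * (r / (2 * B))) / K n y"
            using elim True B K_pos[of n y]
            by (intro divide_right_mono mult_mono) (auto simp: dist_real_def intro: less_imp_le)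
          also have "B * (r / (2 * B)) = r / 2" using B(2) by simp
          finally show ?thesis .
        next
          case False
          then show ?thesis using C(3)[of y] K_pos[of n y] r by (simp add: F_def)
        qed
        have "A n - (\<integral>t. F t \<partial>gauss_measure n) = (\<Sum>y\<in>nodes n. f y / \<rho> n - F y / K n y)"
          using integral_gauss_measure(2)[OF borel_measurable_continuous_onI[OF F_cont], of n]
          by (simp add: A_def sum_subtractf sum_divide_distrib)
        also have "\<bar>\<dots>\<bar> \<le> (\<Sum>y\<in>nodes n. (r / 2) / K n y)"
          by (rule order_trans[OF sum_abs sum_mono[OF summand_le]])
        also have "\<dots> = (r / 2) * (\<Sum>y\<in>nodes n. p 0 y * p 0 y / K n y)" by (simp add: sum_distrib_left)
        also have "\<dots> = r / 2" using gauss_quadrature[of 0 n 0] by simp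
        finally show ?case using r by simp
      qed
      then show "\<exists>no. \<forall>n\<ge>no. norm (A n - (\<integral>t. F t \<partial>gauss_measure n) - 0) < r"
        by (simp add: eventually_sequentially)
    qed
    have "(\<integral>x. f x \<partial>density \<mu> (\<lambda>x. ennreal (indicator U x * h x))) = (\<integral>t. F t \<partial>\<mu>)"
    proof -
      have "(\<integral>x. f x \<partial>density \<mu> (\<lambda>x. ennreal (indicator U x * h x))) = (\<integral>x. (indicator U x * h x) *\<^sub>R f x \<partial>\<mu>)"
      proof (rule integral_density)
        show "f \<in> borel_measurable \<mu>"
          using borel_measurable_continuous_onI[OF f] sp(2) by (simp cong: measurable_cong_sets)
        show "(\<lambda>x. indicator U x * h x) \<in> borel_measurable \<mu>"
          using hm sp(2) by (simp cong: measurable_cong_sets)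
        show "AE x in \<mu>. 0 \<le> indicator U x * h x"
          using h_nonneg by (intro AE_I2) (simp add: indicator_def)
      qed
      then show ?thesis by (simp add: F_def)
    qed
    then show ?thesis using tendsto_add[OF diff F_lim] by (simp add: A_eq)
  qed
  with sa show ?thesis unfolding vaguely_converges_on_def by blast
qed

end
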